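(* Let $p$ be a prime and put $\mathbf p=4$ if $p=2$ and $\mathbf p=p$ if $p$ is odd. Let $R$ be a commutative Noetherian local pro-$p$ domain of characteristic $0$, let $G$ be an $R$-standard group of dimension $d$ and level $1$, let $A=R[[x_1,\dots,x_d]]$ and let $\mathbb L=\operatorname{Der}_l(A)$ be the Lie $R$-algebra of left invariant derivations of $A$. Then the groups $\{\rho_{\mathbf x}\mid \mathbf x\in G(\mathbf pR)\}$ and $\{e^a\mid a\in\mathbf p\mathbb L\}$ (both consisting of $R$-automorphisms of $A$, under composition) coincide. In particular, $G(\mathbf pR)\cong\Gamma(\mathbf p\mathbb L)$.
   Context: A commutative Noetherian local pro-$p$ domain $R$ is a commutative Noetherian local integral domain with maximal ideal $\mathfrak m$, complete in the $\mathfrak m$-adic topology, with finite residue field of characteristic $p$. A formal group law of dimension $d$ over $R$ is a $d$-tuple $\mathbf F=(F_1,\dots,F_d)$ of power series over $R$ in $2d$ variables with $\mathbf F(\mathbf x,\mathbf 0)=\mathbf x$, $\mathbf F(\mathbf 0,\mathbf y)=\mathbf y$, $\mathbf F(\mathbf F(\mathbf x,\mathbf y),\mathbf z)=\mathbf F(\mathbf x,\mathbf F(\mathbf y,\mathbf z))$. An $R$-standard group $G$ of dimension $d$ and level $1$ is the set $\mathfrak m^{(d)}$ (product of $d$ copies of $\mathfrak m$) with multiplication $\mathbf x\cdot\mathbf y=\mathbf F(\mathbf x,\mathbf y)$. For an ideal $J\subseteq\mathfrak m$ of $R$, $G(J)$ denotes the subgroup $J^{(d)}$ of $G$. Elements of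 $A$ are regarded as functions from $G$ to $R$ by evaluation (distinct elements give distinct functions). For $\mathbf x\in G$, $f\in A$, the elements $\lambda_{\mathbf x}f,\rho_{\mathbf x}f\in A$ are defined by $(\lambda_{\mathbf x}f)(\mathbf y)=f(\mathbf x^{-1}\mathbf y)$ and $(\rho_{\mathbf x}f)(\mathbf y)=f(\mathbf y\mathbf x)$ for $\mathbf y\in G$. $\operatorname{Der}_l(A)$ is the set of $R$-derivations $w$ of $A$ with $w\lambda_{\mathbf x}=\lambda_{\mathbf x}w$ for all $\mathbf x\in G$; it is a Lie $R$-algebra under the commutator bracket. For $a\in\mathbf p\mathbb L\subseteq\mathbf p\operatorname{End}_R(A)$, $e^a=\sum_{n\ge 0}a^n/n!$, which converges in $\operatorname{End}_R(A)$ in the $p$-adic topology. The Baker–Campbell–Hausdorff series is the formal power series $H(x_1,x_2)=\log(e^{x_1}e^{x_2})=\sum_{n\ge1}H_n(x_1,x_2)$ over $\mathbb Q$ in two non-commuting variables, where the homogeneous component $H_n$ of degree $n$ is a Lie polynomial with rational coefficients. If $M$ is a Lie $\mathbb Z_p$-algebra without $\mathbb Z_p$-torsion, with $\bigcap_i p^iM=0$ and complete in the topology defined by the filtration $p^iM$, then for $a,b\in\mathbf pM$ the series $H(a,b)=\sum_n H_n(a,b)$ (with $H_n(a,b)$ evaluated in $M\otimes\mathbb Q$) converges in $\mathbf pM$, and $\Gamma(\mathbf pM)$ denotes the group $(\mathbf pM,H)$. *)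

theory Defs
  imports
    "HOL-Library.Function_Algebras"
    "HOL-Computational_Algebra.Primes"
    "HOL-Algebra.Algebra"
    "HOL-Algebra.Algebraic_Closure_Type"
begin

section \<open>Noetherian local pro-p rings\<close>

text \<open>The ring \<open>R\<close> is a whole type \<open>'a\<close>; ideals, quotients and the Noetherian property
  are those of HOL-Algebra for the record \<^const>\<open>ring_of_type_algebra\<close>.\<close>

fun ideal_power :: "'a::comm_ring_1 set \<Rightarrow> nat \<Rightarrow> 'a set" where
  "ideal_power I 0 = UNIV"
| "ideal_power I (Suc n) = ideal_prod ring_of_type_algebra I (ideal_power I n)"

definition adic_limit :: "'a::comm_ring_1 set \<Rightarrow> (nat \<Rightarrow> 'a) \<Rightarrow> 'a \<Rightarrow> bool" where
  "adic_limit I s l \<longleftrightarrow> (\<forall>k. \<exists>N. \<forall>n\<ge>N. s n - l \<in> ideal_power I k)"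

definition adic_Cauchy :: "'a::comm_ring_1 set \<Rightarrow> (nat \<Rightarrow> 'a) \<Rightarrow> bool" where
  "adic_Cauchy I s \<longleftrightarrow> (\<forall>k. \<exists>N. \<forall>m\<ge>N. \<forall>n\<ge>N. s m - s n \<in> ideal_power I k)"

definition adic_complete :: "'a::comm_ring_1 set \<Rightarrow> bool" where
  "adic_complete I \<longleftrightarrow>
     (\<Inter>k. ideal_power I k) = {0} \<and> (\<forall>s. adic_Cauchy I s \<longrightarrow> (\<exists>l. adic_limit I s l))"

definition has_characteristic :: "('b, 'c) ring_scheme \<Rightarrow> nat \<Rightarrow> bool" where
  "has_characteristic K p \<longleftrightarrow> (\<forall>n::nat. add_pow K n \<one>\<^bsub>K\<^esub> = \<zero>\<^bsub>K\<^esub> \<longleftrightarrow> p dvd n)"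

text \<open>The set \<open>mm\<close> is the maximal ideal of \<open>R\<close>.\<close>

definition noetherian_local_pro_p_domain :: "nat \<Rightarrow> 'a::idom set \<Rightarrow> bool" where
  "noetherian_local_pro_p_domain p mm \<longleftrightarrow>
     noetherian_domain (ring_of_type_algebra :: 'a ring) \<and>
     (\<forall>I. maximalideal I (ring_of_type_algebra :: 'a ring) \<longleftrightarrow> I = mm) \<and>
     finite (carrier ((ring_of_type_algebra :: 'a ring) Quot mm)) \<and>
     has_characteristic ((ring_of_type_algebra :: 'a ring) Quot mm) p \<and>
     adic_complete mm"


section \<open>Power series in finitely many variables\<close>

text \<open>The variables are the elements of the finite type \<open>'v\<close>; a monomial is its exponent
  function \<open>'v \<Rightarrow> nat\<close>, with pointwise order and arithmetic.\<close>

typedef ('a, 'v) mps = "UNIV :: (('v \<Rightarrow> nat) \<Rightarrow> 'a) set"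
  morphisms mps_coeff Abs_mps by simp

lemma mps_coeff_Abs [simp]: "mps_coeff (Abs_mps f) = f"
  by (simp add: Abs_mps_inverse)

lemma mps_eqI: "(\<And>k. mps_coeff f k = mps_coeff g k) \<Longrightarrow> f = g"
  by (metis mps_coeff_inverse ext)

lemma finite_atMost_monomial [simp]: "finite {..k :: 'v::finite \<Rightarrow> nat}"
proof -
  have "{..k} \<subseteq> PiE UNIV (\<lambda>i. {..k i})"
    by (auto simp: le_fun_def)
  moreover have "finite (PiE UNIV (\<lambda>i. {..k i}))"
    by (rule finite_PiE) auto
  ultimately show ?thesis
    by (rule finite_subset)
qed

lemma monomial_diff_diff: "l \<le> k \<Longrightarrow> k - (k - l) = l" for k l :: "'v \<Rightarrow> nat"
  by (simp add: le_fun_def fun_eq_iff)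

lemma monomial_diff_le: "k - l \<le> k" for k l :: "'v \<Rightarrow> nat"
  by (simp add: le_fun_def)

lemma monomial_add_diff: "(l + k) - l = k" for k l :: "'v \<Rightarrow> nat"
  by (simp add: fun_eq_iff)

lemma monomial_diff_add: "l \<le> k \<Longrightarrow> l + (k - l) = k" for k l :: "'v \<Rightarrow> nat"
  by (simp add: le_fun_def fun_eq_iff)

lemma monomial_diff_diff_left: "k - l - j = k - (l + j)" for j k l :: "'v \<Rightarrow> nat"
  by (simp add: fun_eq_iff)

lemma monomial_le_diff_conv: "l \<le> k \<Longrightarrow> j \<le> k - l \<longleftrightarrow> l + j \<le> k" for j k l :: "'v \<Rightarrow> nat"
  unfolding le_fun_def plus_fun_apply fun_diff_def
  by (metis Nat.le_diff_conv2 add.commute)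

lemma monomial_le_add: "l \<le> l + k" for k l :: "'v \<Rightarrow> nat"
  by (simp add: le_fun_def)

instantiation mps :: (comm_ring_1, finite) comm_ring_1
begin

definition "0 = Abs_mps (\<lambda>k. 0)"
definition "1 = Abs_mps (\<lambda>k. if k = 0 then 1 else 0)"
definition "f + g = Abs_mps (\<lambda>k. mps_coeff f k + mps_coeff g k)"
definition "- f = Abs_mps (\<lambda>k. - mps_coeff f k)"
definition "f - g = Abs_mps (\<lambda>k. mps_coeff f k - mps_coeff g k)"
definition "f * g = Abs_mps (\<lambda>k. \<Sum>l\<in>{..k}. mps_coeff f l * mps_coeff g (k - l))"

instance
proof
  fix f g h :: "('a, 'b) mps"
  have swap: "(\<Sum>l\<in>{..k}. u l (k - l)) = (\<Sum>l\<in>{..k}. u (k - l) l)"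
    for k :: "'b \<Rightarrow> nat" and u :: "('b \<Rightarrow> nat) \<Rightarrow> ('b \<Rightarrow> nat) \<Rightarrow> 'a"
    by (rule sum.reindex_bij_witness[where i = "\<lambda>l. k - l" and j = "\<lambda>l. k - l"])
       (auto simp: monomial_diff_diff monomial_diff_le)
  show "f * g * h = f * (g * h)"
  proof (rule mps_eqI)
    fix k
    have "mps_coeff (f * g * h) k =
        (\<Sum>(l, j)\<in>Sigma {..k} (\<lambda>l. {..l}). mps_coeff f j * mps_coeff g (l - j) * mps_coeff h (k - l))"
      by (simp add: times_mps_def sum_distrib_right sum.Sigma)
    also have "\<dots> = (\<Sum>(j, i)\<in>Sigma {..k} (\<lambda>j. {..k - j}).
        mps_coeff f j * (mps_coeff g i * mps_coeff h (k - j - i)))"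
    proof (rule sum.reindex_bij_witness[where i = "\<lambda>(j, i). (j + i, j)" and j = "\<lambda>(l, j). (j, l - j)"],
        goal_cases)
      case (2 c)
      then obtain l j where c: "c = (l, j)" "l \<le> k" "j \<le> l" by auto
      then show ?case
        using order_trans[OF \<open>j \<le> l\<close> \<open>l \<le> k\<close>]
        by (simp add: monomial_le_diff_conv monomial_diff_add)
    next
      case (4 c)
      then show ?case
        by (clarsimp simp: monomial_le_diff_conv monomial_le_add)
    qed (clarsimp simp: monomial_add_diff monomial_diff_add monomial_diff_diff_left mult.assoc)+
    also have "\<dots> = mps_coeff (f * (g * h)) k"
      by (simp add: times_mps_def sum_distrib_left sum.Sigma)
    finally show "mps_coeff (f * g * h) k = mps_coeff (f * (g * h)) k" .
  qed
  show "f * g = g * f"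
    unfolding times_mps_def by (subst swap) (simp add: mult.commute)
  show "1 * f = f"
  proof (rule mps_eqI)
    fix k :: "'b \<Rightarrow> nat"
    have "mps_coeff (1 * f) k = (\<Sum>l\<in>{..k}. if l = 0 then mps_coeff f k else 0)"
      unfolding times_mps_def one_mps_def mps_coeff_Abs
      by (rule sum.cong) (auto simp: fun_diff_def)
    also have "\<dots> = mps_coeff f k"
      by (subst sum.delta) (auto simp: le_fun_def)
    finally show "mps_coeff (1 * f) k = mps_coeff f k" .
  qed
  show "(0::('a, 'b) mps) \<noteq> 1"
  proof
    assume "(0::('a, 'b) mps) = 1"
    then have "mps_coeff (0::('a, 'b) mps) 0 = mps_coeff 1 0" by (rule arg_cong)
    then show False
      unfolding zero_mps_def one_mps_def mps_coeff_Abs by simp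
  qed
qed (simp_all add: plus_mps_def zero_mps_def minus_mps_def uminus_mps_def
      times_mps_def algebra_simps sum.distrib mps_coeff_inverse)

end

definition mps_const :: "'a \<Rightarrow> ('a::comm_ring_1, 'v) mps" where
  "mps_const c = Abs_mps (\<lambda>k. if k = 0 then c else 0)"

definition mps_var :: "'v \<Rightarrow> ('a::comm_ring_1, 'v) mps" where
  "mps_var i = Abs_mps (\<lambda>k. if k = (\<lambda>j. if j = i then 1 else 0) then 1 else 0)"

definition mdeg :: "('v::finite \<Rightarrow> nat) \<Rightarrow> nat" where
  "mdeg k = (\<Sum>i\<in>UNIV. k i)"

text \<open>Substitution of series \<open>g w\<close> without constant term for the variables of \<open>f\<close>: a
  monomial of degree greater than \<^term>\<open>mdeg k\<close> then contributes nothing to the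
  coefficient at \<open>k\<close>, so that coefficient is a finite sum.\<close>

definition mps_subst ::
    "('a::comm_ring_1, 'w::finite) mps \<Rightarrow> ('w \<Rightarrow> ('a, 'v::finite) mps) \<Rightarrow> ('a, 'v) mps" where
  "mps_subst f g = Abs_mps (\<lambda>k. \<Sum>l | mdeg l \<le> mdeg k.
     mps_coeff f l * mps_coeff (\<Prod>w\<in>UNIV. g w ^ l w) k)"

definition mps_eval :: "'a::comm_ring_1 set \<Rightarrow> ('a, 'v::finite) mps \<Rightarrow> ('v \<Rightarrow> 'a) \<Rightarrow> 'a" where
  "mps_eval mm f x =
     (THE s. adic_limit mm (\<lambda>N. \<Sum>k | mdeg k < N. mps_coeff f k * (\<Prod>i\<in>UNIV. x i ^ k i)) s)"


section \<open>Formal group laws and standard groups\<close>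

text \<open>The dimension is the cardinality of \<open>'n\<close>. The first \<open>n\<close>-tuple of variables of \<open>F i\<close>
  is indexed by \<^const>\<open>Inl\<close>, the second one by \<^const>\<open>Inr\<close>.\<close>

definition formal_group_law :: "('n::finite \<Rightarrow> ('a::comm_ring_1, 'n + 'n) mps) \<Rightarrow> bool" where
  "formal_group_law F \<longleftrightarrow>
     (\<forall>i. mps_subst (F i) (case_sum mps_var (\<lambda>_. 0)) = (mps_var i :: ('a, 'n) mps)) \<and>
     (\<forall>i. mps_subst (F i) (case_sum (\<lambda>_. 0) mps_var) = (mps_var i :: ('a, 'n) mps)) \<and>
     (let x = (\<lambda>j. mps_var (Inl j)) :: 'n \<Rightarrow> ('a, 'n + 'n + 'n) mps;
          y = (\<lambda>j. mps_var (Inr (Inl j)));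
          z = (\<lambda>j. mps_var (Inr (Inr j)))
      in \<forall>i. mps_subst (F i) (case_sum (\<lambda>j. mps_subst (F j) (case_sum x y)) z) =
             mps_subst (F i) (case_sum x (\<lambda>j. mps_subst (F j) (case_sum y z))))"

text \<open>The group \<open>G(J)\<close>; the standard group \<open>G\<close> itself is the case \<open>J = mm\<close>.\<close>

definition standard_group ::
    "'a::comm_ring_1 set \<Rightarrow> ('n::finite \<Rightarrow> ('a, 'n + 'n) mps) \<Rightarrow> 'a set \<Rightarrow> ('n \<Rightarrow> 'a) monoid" where
  "standard_group mm F J =
     \<lparr>carrier = {x. \<forall>i. x i \<in> J},
      monoid.mult = (\<lambda>x y i. mps_eval mm (F i) (case_sum x y)),
      one = (\<lambda>_. 0)\<rparr>"

definition left_trans ::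
    "'a::comm_ring_1 set \<Rightarrow> ('n::finite \<Rightarrow> ('a, 'n + 'n) mps) \<Rightarrow> ('n \<Rightarrow> 'a)
       \<Rightarrow> ('a, 'n) mps \<Rightarrow> ('a, 'n) mps" where
  "left_trans mm F x f = (let G = standard_group mm F mm in
     (THE g. \<forall>y\<in>carrier G. mps_eval mm g y = mps_eval mm f (inv\<^bsub>G\<^esub> x \<otimes>\<^bsub>G\<^esub> y)))"

definition right_trans ::
    "'a::comm_ring_1 set \<Rightarrow> ('n::finite \<Rightarrow> ('a, 'n + 'n) mps) \<Rightarrow> ('n \<Rightarrow> 'a)
       \<Rightarrow> ('a, 'n) mps \<Rightarrow> ('a, 'n) mps" where
  "right_trans mm F x f = (let G = standard_group mm F mm in
     (THE g. \<forall>y\<in>carrier G. mps_eval mm g y = mps_eval mm f (y \<otimes>\<^bsub>G\<^esub> x)))"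


section \<open>Endomorphisms, automorphisms and derivations of the power series algebra\<close>

definition mps_End :: "(('a::comm_ring_1, 'n::finite) mps \<Rightarrow> ('a, 'n) mps) set" where
  "mps_End = {u. module_hom (\<lambda>c f. mps_const c * f) (\<lambda>c f. mps_const c * f) u}"

definition mps_Aut :: "(('a::comm_ring_1, 'n::finite) mps \<Rightarrow> ('a, 'n) mps) monoid" where
  "mps_Aut =
     \<lparr>carrier = {u \<in> mps_End. bij u \<and> u 1 = 1 \<and> (\<forall>f g. u (f * g) = u f * u g)},
      monoid.mult = (\<circ>),
      one = id\<rparr>"

definition left_inv_der ::
    "'a::comm_ring_1 set \<Rightarrow> ('n::finite \<Rightarrow> ('a, 'n + 'n) mps)
       \<Rightarrow> (('a, 'n) mps \<Rightarrow> ('a, 'n) mps) set" where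
  "left_inv_der mm F = {w \<in> mps_End.
     (\<forall>f g. w (f * g) = w f * g + f * w g) \<and>
     (\<forall>x\<in>carrier (standard_group mm F mm). \<forall>f. w (left_trans mm F x f) = left_trans mm F x (w f))}"

definition commutator :: "('b \<Rightarrow> 'b::ab_group_add) \<Rightarrow> ('b \<Rightarrow> 'b) \<Rightarrow> ('b \<Rightarrow> 'b)" where
  "commutator u v = (\<lambda>f. u (v f) - v (u f))"

definition zmult :: "int \<Rightarrow> 'l::ab_group_add \<Rightarrow> 'l" where
  "zmult z u = (\<Sum>_<nat z. u) - (\<Sum>_<nat (- z). u)"

definition bold_p :: "nat \<Rightarrow> nat" where
  "bold_p p = (if p = 2 then 4 else p)"

definition bold_p_multiples :: "nat \<Rightarrow> 'l::ab_group_add set \<Rightarrow> 'l set" where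
  "bold_p_multiples p M = zmult (int (bold_p p)) ` M"

definition padic_limit :: "nat \<Rightarrow> 'l::ab_group_add set \<Rightarrow> (nat \<Rightarrow> 'l) \<Rightarrow> 'l \<Rightarrow> bool" where
  "padic_limit p M s l \<longleftrightarrow>
     l \<in> M \<and> (\<forall>k. \<exists>N. \<forall>n\<ge>N. l - s n \<in> zmult (int p ^ k) ` M)"

text \<open>\<open>a\<^sup>n/n!\<close> is the endomorphism whose \<open>n!\<close>-multiple is the \<open>n\<close>-fold composite of \<open>a\<close>.\<close>

definition mps_End_exp ::
    "nat \<Rightarrow> (('a::comm_ring_1, 'n::finite) mps \<Rightarrow> ('a, 'n) mps) \<Rightarrow> (('a, 'n) mps \<Rightarrow> ('a, 'n) mps)" where
  "mps_End_exp p a = (THE e. padic_limit p mps_End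
     (\<lambda>N. \<Sum>n<N. (THE u. u \<in> mps_End \<and> zmult (fact n) u = a ^^ n)) e)"


section \<open>The Baker--Campbell--Hausdorff series\<close>

text \<open>Formal power series over the rationals in the noncommuting variables \<open>x\<^sub>1\<close>, \<open>x\<^sub>2\<close>, as
  coefficient functions on words; the letter \<^const>\<open>True\<close> stands for \<open>x\<^sub>1\<close>, \<^const>\<open>False\<close>
  for \<open>x\<^sub>2\<close>. Sums are pointwise; the product is \<open>nc_mult\<close>, not the pointwise \<open>*\<close> on functions.\<close>

type_synonym nc_series = "bool list \<Rightarrow> rat"

definition nc_var :: "bool \<Rightarrow> nc_series" where
  "nc_var c = (\<lambda>w. if w = [c] then 1 else 0)"

definition nc_one :: nc_series where
  "nc_one = (\<lambda>w. if w = [] then 1 else 0)"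

definition nc_mult :: "nc_series \<Rightarrow> nc_series \<Rightarrow> nc_series" where
  "nc_mult f g = (\<lambda>w. \<Sum>i\<le>length w. f (take i w) * g (drop i w))"

definition nc_power :: "nc_series \<Rightarrow> nat \<Rightarrow> nc_series" where
  "nc_power f n = (nc_mult f ^^ n) nc_one"

text \<open>\<open>nc_exp f\<close> is the exponential of an \<open>f\<close> without constant term and \<open>nc_log f\<close> the logarithm
  of an \<open>f\<close> with constant term \<open>1\<close>: the \<open>k\<close>-th power of a series without constant term
  vanishes on words shorter than \<open>k\<close>, so the sums over \<open>k\<close> may be cut off at the length.\<close>

definition nc_exp :: "nc_series \<Rightarrow> nc_series" where
  "nc_exp f = (\<lambda>w. \<Sum>k\<le>length w. nc_power f k w / fact k)"

definition nc_log :: "nc_series \<Rightarrow> nc_series" where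
  "nc_log f = (\<lambda>w. \<Sum>k=1..length w. (-1) ^ (k + 1) / of_nat k * nc_power (f - nc_one) k w)"

definition bch :: nc_series where
  "bch = nc_log (nc_mult (nc_exp (nc_var True)) (nc_exp (nc_var False)))"

definition bch_hom :: "nat \<Rightarrow> nc_series" where
  "bch_hom n = (\<lambda>w. if length w = n then bch w else 0)"

datatype lie_monomial = Lie_Var bool | Lie_Bracket lie_monomial lie_monomial

type_synonym lie_polynomial = "(rat \<times> lie_monomial) list"

fun lie_monomial_eval :: "('l \<Rightarrow> 'l \<Rightarrow> 'l) \<Rightarrow> 'l \<Rightarrow> 'l \<Rightarrow> lie_monomial \<Rightarrow> 'l" where
  "lie_monomial_eval br a b (Lie_Var c) = (if c then a else b)"
| "lie_monomial_eval br a b (Lie_Bracket s t) =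
     br (lie_monomial_eval br a b s) (lie_monomial_eval br a b t)"

definition nc_bracket :: "nc_series \<Rightarrow> nc_series \<Rightarrow> nc_series" where
  "nc_bracket f g = nc_mult f g - nc_mult g f"

definition nc_of_lie_polynomial :: "lie_polynomial \<Rightarrow> nc_series" where
  "nc_of_lie_polynomial P =
     (\<lambda>w. \<Sum>(q, t)\<leftarrow>P. q * lie_monomial_eval nc_bracket (nc_var True) (nc_var False) t w)"

text \<open>\<open>H\<^sub>n\<close> written as a Lie polynomial. The choice of the expression is immaterial for its values
  in Lie algebras over the rationals, the free Lie algebra being embedded in the free
  associative algebra.\<close>

definition bch_lie :: "nat \<Rightarrow> lie_polynomial" where
  "bch_lie n = (SOME P. nc_of_lie_polynomial P = bch_hom n)"

text \<open>A list of pairs \<open>(q, u)\<close> denotes the element \<open>\<Sum> u \<otimes> q\<close> of \<open>M \<otimes> \<rat>\<close>. The following says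
  that this element is the image \<open>c \<otimes> 1\<close> of \<open>c\<close>, where \<open>M\<close> is torsion free.\<close>

definition eq_in_tensor_Q :: "'l::ab_group_add \<Rightarrow> (rat \<times> 'l) list \<Rightarrow> bool" where
  "eq_in_tensor_Q c us \<longleftrightarrow>
     (\<exists>N::int. N > 0 \<and> (\<forall>(q, u)\<in>set us. of_int N * q \<in> \<int>) \<and>
        zmult N c = (\<Sum>(q, u)\<leftarrow>us. zmult \<lfloor>of_int N * q\<rfloor> u))"

definition bch_partial_sum :: "('l \<Rightarrow> 'l \<Rightarrow> 'l) \<Rightarrow> 'l \<Rightarrow> 'l \<Rightarrow> nat \<Rightarrow> (rat \<times> 'l) list" where
  "bch_partial_sum br a b N =
     concat (map (\<lambda>n. map (\<lambda>(q, t). (q, lie_monomial_eval br a b t)) (bch_lie n)) [1..<Suc N])"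

text \<open>\<open>H(a, b)\<close> is the limit in the topology of \<open>M \<otimes> \<rat>\<close> given by the filtration \<open>p\<^sup>k M\<close>:
  the partial sums eventually lie in \<open>h - p\<^sup>k M\<close>.\<close>

definition bch_value ::
    "nat \<Rightarrow> 'l::ab_group_add set \<Rightarrow> ('l \<Rightarrow> 'l \<Rightarrow> 'l) \<Rightarrow> 'l \<Rightarrow> 'l \<Rightarrow> 'l" where
  "bch_value p M br a b = (THE h. h \<in> M \<and>
     (\<forall>k. \<exists>N0. \<forall>N\<ge>N0. \<exists>m\<in>M. eq_in_tensor_Q (h - zmult (int p ^ k) m) (bch_partial_sum br a b N)))"

definition bch_group ::
    "nat \<Rightarrow> 'l::ab_group_add set \<Rightarrow> ('l \<Rightarrow> 'l \<Rightarrow> 'l) \<Rightarrow> 'l monoid" where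
  "bch_group p M br =
     \<lparr>carrier = bold_p_multiples p M, monoid.mult = bch_value p M br, one = 0\<rparr>"

end

theory Submission imports Defs begin

text \<open>Evaluating a left invariant endomorphism at the identity determines it, so the automorphism
  \<open>e\<^sup>a\<close>, which commutes with the left translations, is the right translation by the point with
  coordinates \<open>(e\<^sup>a x\<^sub>i)(0)\<close>. Conversely, a right translation \<open>\<sigma>\<close> by a point of \<open>G(bp R)\<close> is congruent
  to \<open>1\<close> modulo \<open>bp\<close> (that is, \<open>4\<close> or \<open>p\<close>), hence equal to \<open>e\<^sup>a\<close> for \<open>a = log \<sigma>\<close>, and \<open>a\<close> is a derivation because it is the
  limit of \<open>(\<sigma>\<^sup>q - 1)/q\<close> for \<open>q = p\<^sup>k\<close>, where the \<open>\<sigma>\<^sup>q\<close> are multiplicative. For the second statement,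
  the identities between exponential, logarithm and the Baker--Campbell--Hausdorff series hold for
  noncommutative formal power series and are transported to \<open>End(A)\<close> by evaluation, which converges
  because the coefficients of words of length \<open>n\<close> have \<open>p\<close>-adic valuation at least
  \<open>-(n - 1)/(p - 1)\<close>. That the homogeneous components of the series are Lie polynomials
  follows by recursion on the degree from the formula for the derivative of the exponential.\<close>


section \<open>Noncommutative formal power series as a ring\<close>

text \<open>Two obstacles shape the proof. \<open>End(A)\<close> is noncommutative and does not
  contain the fractions \<open>1/n!\<close>, so identities of exponentials are proved over the
  rationals, where words record the order of factors. They can be evaluated because
  \<open>End(A)\<close> is torsion free: limits are compared after multiplication by a denominator,
  which is then cancelled. The second obstacle is convergence. For \<open>p = 2\<close> the factor 2
  would leave the surplus 1 in every degree, hence the 4. The surplus also keeps values of series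
  without constant term divisible by \<open>bp\<close>, so that evaluations can be composed. That
  \<open>H(a, b)\<close> lies in \<open>bp L\<close> is read off from the group:
  \<open>e^a e^b\<close> is the right translation by a product of points, hence \<open>e^c\<close>
  with \<open>c\<close> in \<open>bp L\<close>, and injectivity of the exponential gives
  \<open>c = H(a, b)\<close>. The Lie polynomials place the partial sums in
  \<open>L\<close>.\<close>

typedef free_series = "UNIV :: nc_series set"
  morphisms fs_coeff Abs_fs ..

setup_lifting type_definition_free_series

lemma fs_eqI: "(\<And>w. fs_coeff f w = fs_coeff g w) \<Longrightarrow> f = g"
  by (metis fs_coeff_inverse ext)

lemma nc_mult_assoc: "nc_mult (nc_mult f g) h = nc_mult f (nc_mult g h)"
proof
  fix w :: "bool list"
  let ?n = "length w"
  have "nc_mult (nc_mult f g) h w =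
      (\<Sum>i\<le>?n. \<Sum>j\<le>i. f (take j w) * g (drop j (take i w)) * h (drop i w))"
    unfolding nc_mult_def sum_distrib_right
    by (intro sum.cong) (auto simp: min_def)
  also have "\<dots> = (\<Sum>(i,j)\<in>Sigma {..?n} (\<lambda>i. {..i}). f (take j w) * g (drop j (take i w)) * h (drop i w))"
    by (simp add: sum.Sigma)
  also have "\<dots> = (\<Sum>(j,i)\<in>Sigma {..?n} (\<lambda>j. {..?n - j}).
        f (take j w) * (g (take i (drop j w)) * h (drop i (drop j w))))"
    by (rule sum.reindex_bij_witness[where i = "\<lambda>(j, i). (j + i, j)" and j = "\<lambda>(l, j). (j, l - j)"])
       (auto simp: drop_take add.commute mult.assoc)
  also have "\<dots> = nc_mult f (nc_mult g h) w"
    unfolding nc_mult_def sum_distrib_left by (subst sum.Sigma[symmetric]) auto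
  finally show "nc_mult (nc_mult f g) h w = nc_mult f (nc_mult g h) w" .
qed

lemma nc_mult_one_left: "nc_mult nc_one f = f"
proof
  fix w :: "bool list"
  have "nc_mult nc_one f w = (\<Sum>i\<le>length w. if i = 0 then f w else 0)"
    unfolding nc_mult_def nc_one_def by (rule sum.cong) auto
  then show "nc_mult nc_one f w = f w" by simp
qed

lemma nc_mult_one_right: "nc_mult f nc_one = f"
proof
  fix w :: "bool list"
  have "nc_mult f nc_one w = (\<Sum>i\<le>length w. if i = length w then f w else 0)"
    unfolding nc_mult_def nc_one_def by (rule sum.cong) auto
  then show "nc_mult f nc_one w = f w" by simp
qed

instantiation free_series :: ring_1
begin

lift_definition zero_free_series :: free_series is "\<lambda>_. 0" .
lift_definition one_free_series :: free_series is nc_one .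
lift_definition plus_free_series :: "free_series \<Rightarrow> free_series \<Rightarrow> free_series" is "\<lambda>f g w. f w + g w" .
lift_definition minus_free_series :: "free_series \<Rightarrow> free_series \<Rightarrow> free_series" is "\<lambda>f g w. f w - g w" .
lift_definition uminus_free_series :: "free_series \<Rightarrow> free_series" is "\<lambda>f w. - f w" .
lift_definition times_free_series :: "free_series \<Rightarrow> free_series \<Rightarrow> free_series" is nc_mult .

instance
proof
  fix f g h :: free_series
  show "f * g * h = f * (g * h)" by transfer (rule nc_mult_assoc)
  show "1 * f = f" by transfer (rule nc_mult_one_left)
  show "f * 1 = f" by transfer (rule nc_mult_one_right)
  show "(f + g) * h = f * h + g * h"
    by transfer (simp add: nc_mult_def algebra_simps sum.distrib)
  show "f * (g + h) = f * g + f * h"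
    by transfer (simp add: nc_mult_def algebra_simps sum.distrib)
  show "(0::free_series) \<noteq> 1"
    by transfer (auto simp: nc_one_def fun_eq_iff)
qed (transfer; simp add: algebra_simps)+

end

lift_definition fs_var :: "bool \<Rightarrow> free_series" is nc_var .
lift_definition fs_scale :: "rat \<Rightarrow> free_series \<Rightarrow> free_series" is "\<lambda>q f w. q * f w" .

text \<open>Meaningful only if \<open>F k\<close> vanishes on words shorter than \<open>k\<close>: the cut-off then omits nothing.\<close>
lift_definition fs_suminf :: "(nat \<Rightarrow> free_series) \<Rightarrow> free_series" is "\<lambda>F w. \<Sum>k\<le>length w. F k w" .

lemma fs_coeff_simps [simp]:
  "fs_coeff 0 w = 0" "fs_coeff (f + g) w = fs_coeff f w + fs_coeff g w"
  "fs_coeff (f - g) w = fs_coeff f w - fs_coeff g w" "fs_coeff (- f) w = - fs_coeff f w"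
  "fs_coeff (fs_scale q f) w = q * fs_coeff f w"
  by (transfer, simp)+

lemma fs_coeff_one: "fs_coeff 1 w = (if w = [] then 1 else 0)"
  by transfer (simp add: nc_one_def)

lemma fs_coeff_var: "fs_coeff (fs_var c) w = (if w = [c] then 1 else 0)"
  by transfer (simp add: nc_var_def)

lemma fs_coeff_var_Nil [simp]: "fs_coeff (fs_var c) [] = 0"
  by (simp add: fs_coeff_var)

lemma fs_coeff_mult: "fs_coeff (f * g) w = (\<Sum>i\<le>length w. fs_coeff f (take i w) * fs_coeff g (drop i w))"
  by transfer (simp add: nc_mult_def)

lemma fs_coeff_suminf: "fs_coeff (fs_suminf F) w = (\<Sum>k\<le>length w. fs_coeff (F k) w)"
  by transfer simp

lemma fs_coeff_sum [simp]: "fs_coeff (sum F A) w = (\<Sum>k\<in>A. fs_coeff (F k) w)"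
  by (induction A rule: infinite_finite_induct) auto

lemma fs_coeff_power: "fs_coeff (f ^ k) = nc_power (fs_coeff f) k"
  by (induction k) (auto simp: nc_power_def one_free_series.rep_eq times_free_series.rep_eq)

lemma fs_scale_simps [simp]:
  "fs_scale 1 f = f" "fs_scale 0 f = 0" "fs_scale q 0 = 0" "fs_scale a (fs_scale b f) = fs_scale (a * b) f"
  by (rule fs_eqI; simp)+

lemma fs_scale_mult_left: "fs_scale q f * g = fs_scale q (f * g)"
  by (rule fs_eqI) (simp add: fs_coeff_mult sum_distrib_left mult.assoc)

lemma fs_scale_mult_right: "f * fs_scale q g = fs_scale q (f * g)"
  by (rule fs_eqI) (simp add: fs_coeff_mult sum_distrib_left mult.left_commute)

lemma fs_scale_distrib:
  "fs_scale q (f + g) = fs_scale q f + fs_scale q g" "fs_scale (a + b) f = fs_scale a f + fs_scale b f"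
  "fs_scale q (f - g) = fs_scale q f - fs_scale q g" "fs_scale (- q) f = - fs_scale q f"
  by (rule fs_eqI; simp add: algebra_simps)+

lemma fs_scale_sum_left: "fs_scale (sum c A) f = (\<Sum>k\<in>A. fs_scale (c k) f)"
  by (rule fs_eqI) (simp add: sum_distrib_right)

lemma fs_scale_of_nat: "fs_scale (of_nat n) f = of_nat n * f"
  by (induction n) (simp_all add: fs_scale_distrib distrib_right)

section \<open>Order of vanishing\<close>

definition fs_order_ge :: "nat \<Rightarrow> free_series \<Rightarrow> bool" where
  "fs_order_ge k f \<longleftrightarrow> (\<forall>w. length w < k \<longrightarrow> fs_coeff f w = 0)"

lemma fs_order_ge_0 [simp]: "fs_order_ge 0 f"
  by (simp add: fs_order_ge_def)

lemma fs_order_ge_1_iff [simp]: "fs_order_ge (Suc 0) f \<longleftrightarrow> fs_coeff f [] = 0"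
  by (auto simp: fs_order_ge_def)

lemma fs_order_ge_mono: "fs_order_ge k f \<Longrightarrow> j \<le> k \<Longrightarrow> fs_order_ge j f"
  by (auto simp: fs_order_ge_def)

lemma fs_order_ge_scale: "fs_order_ge k f \<Longrightarrow> fs_order_ge k (fs_scale q f)"
  by (auto simp: fs_order_ge_def)

lemma fs_order_ge_diff: "fs_order_ge k f \<Longrightarrow> fs_order_ge k g \<Longrightarrow> fs_order_ge k (f - g)"
  by (auto simp: fs_order_ge_def)

lemma fs_order_ge_mult:
  assumes "fs_order_ge i f" "fs_order_ge j g"
  shows "fs_order_ge (i + j) (f * g)"
  unfolding fs_order_ge_def
proof safe
  fix w :: "bool list"
  assume w: "length w < i + j"
  show "fs_coeff (f * g) w = 0"
    unfolding fs_coeff_mult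
  proof (rule sum.neutral, safe)
    fix k assume "k \<le> length w"
    then show "fs_coeff f (take k w) * fs_coeff g (drop k w) = 0"
      using w assms unfolding fs_order_ge_def by (cases "k < i") auto
  qed
qed

lemma fs_order_ge_power: "fs_order_ge 1 f \<Longrightarrow> fs_order_ge k (f ^ k)"
  using fs_order_ge_mult[of 1 f] by (induction k) auto

lemma fs_order_ge_var [simp]: "fs_order_ge 1 (fs_var c)"
  by (simp add: fs_coeff_var)

text \<open>The cut-off in \<open>fs_suminf\<close> varies with the word; one common
  \<open>N\<close> is what allows the sums for the pieces \<open>take i w\<close> and
  \<open>drop i w\<close> to be interchanged.\<close>

lemma fs_coeff_suminf_cut:
  assumes "\<And>k. fs_order_ge k (F k)" "length w \<le> N"
  shows "fs_coeff (fs_suminf F) w = (\<Sum>k\<le>N. fs_coeff (F k) w)"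
  unfolding fs_coeff_suminf using assms
  by (intro sum.mono_neutral_left) (auto simp: fs_order_ge_def)

lemma fs_suminf_mult:
  assumes F: "\<And>k. fs_order_ge k (F k)" and G: "\<And>k. fs_order_ge k (G k)"
  shows "fs_suminf F * fs_suminf G = fs_suminf (\<lambda>n. \<Sum>i\<le>n. F i * G (n - i))"
proof (rule fs_eqI)
  fix w :: "bool list"
  let ?N = "length w"
  have "fs_coeff (fs_suminf F * fs_suminf G) w =
      (\<Sum>i\<le>?N. (\<Sum>a\<le>?N. fs_coeff (F a) (take i w)) * (\<Sum>b\<le>?N. fs_coeff (G b) (drop i w)))"
    unfolding fs_coeff_mult
    by (intro sum.cong refl arg_cong2[of _ _ _ _ "(*)"] fs_coeff_suminf_cut F G) auto
  also have "\<dots> = (\<Sum>i\<le>?N. \<Sum>a\<le>?N. \<Sum>b\<le>?N. fs_coeff (F a) (take i w) * fs_coeff (G b) (drop i w))"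
    by (simp add: sum_product)
  also have "\<dots> = (\<Sum>a\<le>?N. \<Sum>b\<le>?N. fs_coeff (F a * G b) w)"
    unfolding fs_coeff_mult by (subst sum.swap, rule sum.cong, rule refl, rule sum.swap)
  also have "\<dots> = (\<Sum>(a,b)\<in>{..?N} \<times> {..?N}. fs_coeff (F a * G b) w)"
    by (simp add: sum.cartesian_product)
  \<comment> \<open>Outside the triangle the product has order \<open>a + b\<close>, larger than the
    length of \<open>w\<close>.\<close>
  also have "\<dots> = (\<Sum>(a,b)\<in>{(a,b). a + b \<le> ?N}. fs_coeff (F a * G b) w)"
  proof (rule sum.mono_neutral_right)
    show "\<forall>c\<in>{..?N} \<times> {..?N} - {(a, b). a + b \<le> ?N}. (case c of (a, b) \<Rightarrow> fs_coeff (F a * G b) w) = 0"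
      using fs_order_ge_mult[OF F G] unfolding fs_order_ge_def by (clarsimp simp: not_le) (meson not_le)
  qed auto
  also have "\<dots> = (\<Sum>n\<le>?N. \<Sum>i\<le>n. fs_coeff (F i * G (n - i)) w)"
    by (rule sum.triangle_reindex_eq)
  also have "\<dots> = fs_coeff (fs_suminf (\<lambda>n. \<Sum>i\<le>n. F i * G (n - i))) w"
    by (simp add: fs_coeff_suminf)
  finally show "fs_coeff (fs_suminf F * fs_suminf G) w =
      fs_coeff (fs_suminf (\<lambda>n. \<Sum>i\<le>n. F i * G (n - i))) w" .
qed

text \<open>In the coefficient of \<open>e * (f - g)\<close> at \<open>w\<close> only the empty
  prefix meets \<open>f - g\<close> at \<open>w\<close> itself; all other terms involve shorter
  words, so induction on the length applies.\<close>

lemma fs_mult_left_cancel: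
  assumes "fs_coeff e [] = 1" "e * f = e * g"
  shows "f = g"
proof -
  have "fs_coeff (f - g) w = 0" for w
  proof (induction w rule: length_induct)
    case (1 w)
    have "0 = fs_coeff (e * (f - g)) w"
      using assms(2) by (simp add: algebra_simps)
    also have "\<dots> = (\<Sum>i\<in>insert 0 {1..length w}. fs_coeff e (take i w) * fs_coeff (f - g) (drop i w))"
      unfolding fs_coeff_mult by (intro sum.cong) auto
    also have "\<dots> = fs_coeff (f - g) w + (\<Sum>i=1..length w. fs_coeff e (take i w) * fs_coeff (f - g) (drop i w))"
      using assms(1) by (subst sum.insert) auto
    also have "(\<Sum>i=1..length w. fs_coeff e (take i w) * fs_coeff (f - g) (drop i w)) = 0"
      using 1 by (intro sum.neutral) auto
    finally show ?case by simp
  qed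
  then show ?thesis by (intro fs_eqI) simp
qed


section \<open>Substitution of a noncommutative series into a rational power series\<close>

definition fs_compose :: "rat fps \<Rightarrow> free_series \<Rightarrow> free_series" where
  "fs_compose g f = fs_suminf (\<lambda>k. fs_scale (fps_nth g k) (f ^ k))"

lemma fs_coeff_compose: "fs_coeff (fs_compose g f) w = (\<Sum>k\<le>length w. fps_nth g k * fs_coeff (f ^ k) w)"
  by (simp add: fs_compose_def fs_coeff_suminf)

lemma fs_coeff_compose_Nil [simp]: "fs_coeff (fs_compose g f) [] = fps_nth g 0"
  by (simp add: fs_coeff_compose fs_coeff_one)

lemma fs_compose_mult:
  assumes "fs_order_ge 1 f"
  shows "fs_compose (g * h) f = fs_compose g f * fs_compose h f"
proof -
  have "fs_compose g f * fs_compose h f =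
     fs_suminf (\<lambda>n. \<Sum>i\<le>n. fs_scale (fps_nth g i) (f ^ i) * fs_scale (fps_nth h (n - i)) (f ^ (n - i)))"
    unfolding fs_compose_def
    by (rule fs_suminf_mult) (auto intro: fs_order_ge_scale fs_order_ge_power assms)
  also have "\<dots> = fs_compose (g * h) f"
    unfolding fs_compose_def
    by (intro arg_cong[of _ _ fs_suminf] ext)
       (simp add: fs_scale_mult_left fs_scale_mult_right fps_mult_nth fs_scale_sum_left atMost_atLeast0 mult.commute
         flip: power_add)
  finally show ?thesis ..
qed

lemma fs_compose_one: "fs_compose 1 f = 1"
  by (rule fs_eqI) (simp add: fs_coeff_compose if_distrib[of "\<lambda>x. x * _"] sum.delta cong: if_cong)

lemma fs_compose_X: "fs_order_ge 1 f \<Longrightarrow> fs_compose fps_X f = f"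
  by (rule fs_eqI)
     (auto simp: fs_coeff_compose fps_X_def if_distrib[of "\<lambda>x. x * _"] sum.delta Suc_le_eq cong: if_cong)

lemma fs_compose_diff: "fs_compose (g - h) f = fs_compose g f - fs_compose h f"
  by (rule fs_eqI) (simp add: fs_coeff_compose algebra_simps sum_subtractf)

lemma fs_compose_add: "fs_compose (g + h) f = fs_compose g f + fs_compose h f"
  by (rule fs_eqI) (simp add: fs_coeff_compose algebra_simps sum.distrib)

lemma fs_compose_power:
  assumes "fs_order_ge 1 f"
  shows "fs_compose (g ^ k) f = fs_compose g f ^ k"
  by (induction k) (simp_all add: fs_compose_one fs_compose_mult[OF assms])

lemma fs_order_ge_compose: "fps_nth g 0 = 0 \<Longrightarrow> fs_order_ge 1 (fs_compose g f)"
  by simp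

text \<open>Since \<open>h ^ i\<close> starts in degree \<open>i\<close>, all inner sums can be
  extended to the bound \<open>length w\<close> before they are swapped.\<close>

lemma fs_compose_compose:
  assumes "fs_order_ge 1 f" "fps_nth h 0 = 0"
  shows "fs_compose (g oo h) f = fs_compose g (fs_compose h f)"
proof (rule fs_eqI)
  fix w :: "bool list"
  let ?N = "length w"
  have "fs_coeff (fs_compose (g oo h) f) w =
      (\<Sum>k\<le>?N. (\<Sum>i\<le>?N. fps_nth g i * fps_nth (h ^ i) k) * fs_coeff (f ^ k) w)"
    unfolding fs_coeff_compose fps_compose_nth using startsby_zero_power_prefix[OF assms(2)]
    by (intro sum.cong refl arg_cong2[of _ _ _ _ "(*)"] sum.mono_neutral_left) auto
  also have "\<dots> = (\<Sum>i\<le>?N. \<Sum>k\<le>?N. fps_nth g i * fps_nth (h ^ i) k * fs_coeff (f ^ k) w)"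
    by (subst sum.swap) (simp add: sum_distrib_right)
  also have "\<dots> = fs_coeff (fs_compose g (fs_compose h f)) w"
    by (simp add: fs_coeff_compose fs_compose_power[OF assms(1), symmetric] sum_distrib_left mult.assoc)
  finally show "fs_coeff (fs_compose (g oo h) f) w = fs_coeff (fs_compose g (fs_compose h f)) w" .
qed

abbreviation fs_exp :: "free_series \<Rightarrow> free_series" where
  "fs_exp \<equiv> fs_compose (fps_exp 1)"

text \<open>\<open>fps_ln 1\<close> is the series of log (1 + X), the compositional inverse of
  \<open>fps_exp 1 - 1\<close>; this accounts for the shifts by 1 here and below.\<close>

lemma fps_exp_compose_ln: "fps_exp (1::rat) oo fps_ln 1 = 1 + fps_X"
proof -
  have "(fps_exp (1::rat) - 1) oo fps_ln 1 = fps_X"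
    using fps_inv_fps_exp_compose(2)[of "1::rat"] by (simp add: fps_ln_fps_exp_inv)
  then show ?thesis by (simp add: fps_compose_sub_distrib algebra_simps)
qed

lemma fps_ln_compose_exp: "fps_ln 1 oo (fps_exp (1::rat) - 1) = fps_X"
  using fps_inv_fps_exp_compose(1)[of "1::rat"] by (simp add: fps_ln_fps_exp_inv)

lemma fs_exp_ln: "fs_order_ge 1 f \<Longrightarrow> fs_exp (fs_compose (fps_ln 1) f) = 1 + f"
  by (subst fs_compose_compose[symmetric])
     (auto simp: fps_exp_compose_ln fs_compose_add fs_compose_one fs_compose_X)

lemma fs_ln_exp: "fs_order_ge 1 f \<Longrightarrow> fs_compose (fps_ln 1) (fs_exp f - 1) = f"
  using fs_compose_compose[of f "fps_exp 1 - 1" "fps_ln 1"]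
  by (simp add: fps_ln_compose_exp fs_compose_diff fs_compose_one fs_compose_X)

definition fs_bch :: free_series where
  "fs_bch = fs_compose (fps_ln 1) (fs_exp (fs_var True) * fs_exp (fs_var False) - 1)"

lemma fs_coeff_exp: "fs_coeff (fs_exp f) = nc_exp (fs_coeff f)"
  by (rule ext) (simp add: fs_coeff_compose nc_exp_def fs_coeff_power)

lemma fs_coeff_bch: "fs_coeff fs_bch = bch"
proof
  fix w
  let ?g = "fs_exp (fs_var True) * fs_exp (fs_var False)"
  have g: "fs_coeff (?g - 1) =
      nc_mult (nc_exp (nc_var True)) (nc_exp (nc_var False)) - nc_one"
    by (auto simp: fun_eq_iff times_free_series.rep_eq fs_coeff_exp fs_var.rep_eq one_free_series.rep_eq)
  show "fs_coeff fs_bch w = bch w"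
    unfolding fs_bch_def bch_def nc_log_def fs_coeff_compose fs_coeff_power g
    by (rule sum.mono_neutral_cong_right) (auto simp: fps_ln_nth not_le gr0_conv_Suc Suc_le_eq)
qed

lemma fs_order_ge_bch: "fs_order_ge 1 fs_bch"
  unfolding fs_bch_def by (rule fs_order_ge_compose) simp

lemma fs_order_ge_exp_prod: "fs_order_ge 1 (fs_exp (fs_var True) * fs_exp (fs_var False) - 1)"
  by (simp add: fs_coeff_mult fs_coeff_one)

lemma fs_exp_bch: "fs_exp fs_bch = fs_exp (fs_var True) * fs_exp (fs_var False)"
  unfolding fs_bch_def by (subst fs_exp_ln[OF fs_order_ge_exp_prod]) simp


section \<open>The homogeneous components of the Baker--Campbell--Hausdorff series are Lie polynomials\<close>

fun fs_lie_monomial :: "lie_monomial \<Rightarrow> free_series" where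
  "fs_lie_monomial (Lie_Var c) = fs_var c"
| "fs_lie_monomial (Lie_Bracket s t) =
     fs_lie_monomial s * fs_lie_monomial t - fs_lie_monomial t * fs_lie_monomial s"

definition fs_lie_polynomial :: "lie_polynomial \<Rightarrow> free_series" where
  "fs_lie_polynomial P = (\<Sum>(q, t)\<leftarrow>P. fs_scale q (fs_lie_monomial t))"

lemma fs_coeff_lie_monomial:
  "fs_coeff (fs_lie_monomial t) = lie_monomial_eval nc_bracket (nc_var True) (nc_var False) t"
proof (induction t)
  case (Lie_Var c)
  then show ?case by (cases c) (simp_all add: fs_var.rep_eq)
next
  case (Lie_Bracket s t)
  have "fs_coeff (f * g - g * f) = nc_bracket (fs_coeff f) (fs_coeff g)" for f g
    by (rule ext) (simp add: nc_bracket_def times_free_series.rep_eq)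
  with Lie_Bracket show ?case by simp
qed

lemma fs_coeff_lie_polynomial: "fs_coeff (fs_lie_polynomial P) = nc_of_lie_polynomial P"
proof
  fix w
  show "fs_coeff (fs_lie_polynomial P) w = nc_of_lie_polynomial P w"
    unfolding fs_lie_polynomial_def nc_of_lie_polynomial_def
    by (induction P) (auto simp: fs_coeff_lie_monomial)
qed

definition is_lie :: "free_series \<Rightarrow> bool" where
  "is_lie f \<longleftrightarrow> (\<exists>P. f = fs_lie_polynomial P)"

text \<open>Defined in an arbitrary ring because it serves both for free series and for
  endomorphisms of the power series ring.\<close>

definition ad :: "'b::ring_1 \<Rightarrow> 'b \<Rightarrow> 'b" where
  "ad z x = z * x - x * z"

lemma is_lie_0 [simp]: "is_lie 0"
  unfolding is_lie_def by (rule exI[of _ "[]"]) (simp add: fs_lie_polynomial_def)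

lemma is_lie_monomial: "is_lie (fs_lie_monomial t)"
  unfolding is_lie_def by (rule exI[of _ "[(1, t)]"]) (simp add: fs_lie_polynomial_def)

lemma is_lie_var: "is_lie (fs_var c)"
  using is_lie_monomial[of "Lie_Var c"] by simp

lemma is_lie_add: "is_lie f \<Longrightarrow> is_lie g \<Longrightarrow> is_lie (f + g)"
  unfolding is_lie_def
proof safe
  fix P Q
  show "\<exists>S. fs_lie_polynomial P + fs_lie_polynomial Q = fs_lie_polynomial S"
    by (rule exI[of _ "P @ Q"]) (simp add: fs_lie_polynomial_def)
qed

lemma is_lie_scale: "is_lie f \<Longrightarrow> is_lie (fs_scale q f)"
  unfolding is_lie_def
proof safe
  fix P
  have "fs_scale q (fs_lie_polynomial P) = fs_lie_polynomial (map (\<lambda>(r, t). (q * r, t)) P)"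
    unfolding fs_lie_polynomial_def by (induction P) (auto simp: fs_scale_distrib)
  then show "\<exists>S. fs_scale q (fs_lie_polynomial P) = fs_lie_polynomial S" by blast
qed

lemma is_lie_diff: "is_lie f \<Longrightarrow> is_lie g \<Longrightarrow> is_lie (f - g)"
  using is_lie_add[of f "fs_scale (-1) g"] is_lie_scale[of g "-1"] by (simp add: fs_scale_distrib)

lemma is_lie_sum: "(\<And>k. k \<in> A \<Longrightarrow> is_lie (F k)) \<Longrightarrow> is_lie (sum F A)"
  by (induction A rule: infinite_finite_induct) (auto intro: is_lie_add)

lemma ad_add_left: "ad (y + z) x = ad y x + ad z x"
  and ad_add_right: "ad z (x + y) = ad z x + ad z y"
  by (simp_all add: ad_def algebra_simps)

lemma ad_0 [simp]: "ad 0 x = 0" "ad z 0 = 0"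
  by (simp_all add: ad_def)

lemma ad_funpow_0 [simp]: "(ad z ^^ m) 0 = 0"
  by (induction m) simp_all

lemma ad_fs_scale: "ad (fs_scale q f) g = fs_scale q (ad f g)" "ad f (fs_scale q g) = fs_scale q (ad f g)"
  by (simp_all add: ad_def fs_scale_mult_left fs_scale_mult_right fs_scale_distrib)

text \<open>By bilinearity two monomials suffice, and their bracket is a monomial by
  construction.\<close>

lemma is_lie_ad:
  assumes "is_lie f" "is_lie g"
  shows "is_lie (ad f g)"
proof -
  have mono: "is_lie (ad (fs_lie_monomial s) (fs_lie_monomial t))" for s t
    using is_lie_monomial[of "Lie_Bracket s t"] by (simp add: ad_def)
  have "is_lie (ad (fs_lie_monomial s) (fs_lie_polynomial Q))" for s Q
    unfolding fs_lie_polynomial_def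
    by (induction Q) (auto simp: ad_add_right ad_fs_scale intro!: is_lie_add is_lie_scale mono)
  then have "is_lie (ad (fs_lie_polynomial P) (fs_lie_polynomial Q))" for P Q
    unfolding fs_lie_polynomial_def[of P]
    by (induction P) (auto simp: ad_add_left ad_fs_scale intro!: is_lie_add is_lie_scale)
  with assms show ?thesis by (auto simp: is_lie_def)
qed

text \<open>Right multiplication by \<open>z\<close> is left multiplication by \<open>z\<close>
  minus \<open>ad z\<close>, and these two operators commute; this is the binomial theorem for their
  difference.\<close>

lemma mult_power_ad:
  fixes z x :: "'b::ring_1"
  shows "x * z ^ k = (\<Sum>m\<le>k. of_int ((-1) ^ m * int (k choose m)) * z ^ (k - m) * (ad z ^^ m) x)"
proof (induction k)
  case (Suc k)
  let ?c = "\<lambda>k m. of_int ((-1) ^ m * int (k choose m)) :: 'b"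
  let ?y = "\<lambda>m. (ad z ^^ m) x"
  have *: "?c k m * z ^ (k - m) * ?y m * z = ?c k m * z ^ (Suc k - m) * ?y m - ?c k m * z ^ (k - m) * ?y (Suc m)"
    if "m \<le> k" for m
    using that by (simp add: ad_def algebra_simps Suc_diff_le power_commutes)
       (simp add: power_commutes flip: mult.assoc)
  have "x * z ^ Suc k = (\<Sum>m\<le>k. ?c k m * z ^ (k - m) * ?y m * z)"
    unfolding power_Suc2 mult.assoc[symmetric] Suc.IH sum_distrib_right ..
  also have "\<dots> = (\<Sum>m\<le>k. ?c k m * z ^ (Suc k - m) * ?y m) - (\<Sum>m\<le>k. ?c k m * z ^ (k - m) * ?y (Suc m))"
    by (simp only: sum_subtractf[symmetric]) (rule sum.cong, auto simp only: * atMost_iff)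
  also have "(\<Sum>m\<le>k. ?c k m * z ^ (Suc k - m) * ?y m) = (\<Sum>m\<le>Suc k. ?c k m * z ^ (Suc k - m) * ?y m)"
    by (simp add: binomial_eq_0)
  also have "\<dots> = z ^ Suc k * ?y 0 + (\<Sum>m\<le>k. ?c k (Suc m) * z ^ (k - m) * ?y (Suc m))"
    by (subst sum.atMost_Suc_shift) simp
  also have "\<dots> - (\<Sum>m\<le>k. ?c k m * z ^ (k - m) * ?y (Suc m)) =
      z ^ Suc k * ?y 0 + (\<Sum>m\<le>k. ?c (Suc k) (Suc m) * z ^ (k - m) * ?y (Suc m))"
    by (simp add: algebra_simps sum_subtractf sum.distrib sum_negf)
  also have "\<dots> = (\<Sum>m\<le>Suc k. ?c (Suc k) m * z ^ (Suc k - m) * ?y m)"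
    by (subst sum.atMost_Suc_shift) simp
  finally show ?case .
qed simp

lemma fs_mult_suminf:
  assumes "\<And>k. fs_order_ge k (F k)"
  shows "x * fs_suminf F = fs_suminf (\<lambda>k. x * F k)"
proof (rule fs_eqI)
  fix w :: "bool list"
  have "fs_coeff (x * fs_suminf F) w =
      (\<Sum>i\<le>length w. fs_coeff x (take i w) * (\<Sum>k\<le>length w. fs_coeff (F k) (drop i w)))"
    unfolding fs_coeff_mult
    by (intro sum.cong refl arg_cong2[of _ _ _ _ "(*)"] fs_coeff_suminf_cut assms) auto
  also have "\<dots> = (\<Sum>k\<le>length w. \<Sum>i\<le>length w. fs_coeff x (take i w) * fs_coeff (F k) (drop i w))"
    unfolding sum_distrib_left by (rule sum.swap)
  finally show "fs_coeff (x * fs_suminf F) w = fs_coeff (fs_suminf (\<lambda>k. x * F k)) w"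
    by (simp add: fs_coeff_suminf fs_coeff_mult)
qed

lemma fs_order_ge_ad: "fs_order_ge i z \<Longrightarrow> fs_order_ge j x \<Longrightarrow> fs_order_ge (i + j) (ad z x)"
  unfolding ad_def using fs_order_ge_mult[of i z j x] fs_order_ge_mult[of j x i z]
  by (intro fs_order_ge_diff) (auto simp: add.commute)

lemma fs_order_ge_ad_funpow:
  assumes "fs_order_ge 1 z" "fs_order_ge j x"
  shows "fs_order_ge (m + j) ((ad z ^^ m) x)"
  by (induction m) (use assms fs_order_ge_ad[OF assms(1)] in auto)

lemma fs_coeff_of_int_mult: "fs_coeff (of_int n * f) w = of_int n * fs_coeff f w"
proof -
  have "of_int n * f = fs_scale (of_int n) f"
    by (cases n rule: int_cases2) (simp_all add: fs_scale_distrib fs_scale_of_nat)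
  then show ?thesis by simp
qed

text \<open>The last factor is exp (- ad z) applied to \<open>x\<close>. Division of
  \<open>mult_power_ad\<close> by \<open>k!\<close> turns its binomial sum into the
  \<open>k\<close>-th term of a Cauchy product.\<close>

lemma fs_mult_exp:
  assumes "fs_order_ge 1 z"
  shows "x * fs_exp z = fs_exp z * fs_suminf (\<lambda>m. fs_scale ((-1) ^ m / fact m) ((ad z ^^ m) x))"
proof -
  let ?F = "\<lambda>i. fs_scale (fps_nth (fps_exp 1) i) (z ^ i)"
  let ?G = "\<lambda>m. fs_scale ((-1) ^ m / fact m) ((ad z ^^ m) x)"
  have ordF: "fs_order_ge k (?F k)" and ordG: "fs_order_ge k (?G k)" for k
    using fs_order_ge_power[OF assms] fs_order_ge_ad_funpow[OF assms, of 0 x k]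
    by (auto intro: fs_order_ge_scale)
  have "x * ?F k = (\<Sum>i\<le>k. ?F i * ?G (k - i))" for k
  proof (rule fs_eqI)
    fix w
    have "fs_coeff (x * ?F k) w = (\<Sum>m\<le>k. 1 / fact k * ((-1) ^ m * of_nat (k choose m)) *
        fs_coeff (z ^ (k - m) * (ad z ^^ m) x) w)"
      unfolding fs_scale_mult_right
      by (subst mult_power_ad)
        (simp add: mult.assoc fs_coeff_of_int_mult sum_distrib_left del: of_int_mult, simp add: mult.assoc)
    also have "\<dots> = (\<Sum>i\<le>k. 1 / fact k * ((-1) ^ (k - i) * of_nat (k choose i)) *
        fs_coeff (z ^ i * (ad z ^^ (k - i)) x) w)"
      by (rule sum.reindex_bij_witness[where i = "\<lambda>i. k - i" and j = "\<lambda>i. k - i"])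
         (auto simp: binomial_symmetric[symmetric])
    also have "\<dots> = fs_coeff (\<Sum>i\<le>k. ?F i * ?G (k - i)) w"
      by (simp add: fs_scale_mult_left fs_scale_mult_right binomial_fact mult.commute)
    finally show "fs_coeff (x * ?F k) w = fs_coeff (\<Sum>i\<le>k. ?F i * ?G (k - i)) w" .
  qed
  then show ?thesis
    unfolding fs_compose_def by (simp only: fs_mult_suminf[OF ordF] fs_suminf_mult[OF ordF ordG])
qed

text \<open>The Euler derivation of the grading takes the place of differentiation along
  \<open>t\<close> in H(t x, t y). It multiplies the component of degree \<open>n\<close> by
  \<open>n\<close>, so for positive \<open>n\<close> that component can be recovered over the
  rationals.\<close>

lift_definition fs_euler :: "free_series \<Rightarrow> free_series" is "\<lambda>f w. of_nat (length w) * f w" .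

lemma fs_coeff_euler [simp]: "fs_coeff (fs_euler f) w = of_nat (length w) * fs_coeff f w"
  by transfer simp

lemma fs_euler_mult: "fs_euler (f * g) = fs_euler f * g + f * fs_euler g"
proof (rule fs_eqI)
  fix w :: "bool list"
  have "fs_coeff (fs_euler (f * g)) w =
      (\<Sum>i\<le>length w. of_nat (i + (length w - i)) * (fs_coeff f (take i w) * fs_coeff g (drop i w)))"
    by (simp add: fs_coeff_mult sum_distrib_left)
  also have "\<dots> = fs_coeff (fs_euler f * g + f * fs_euler g) w"
    by (simp add: fs_coeff_mult flip: sum.distrib) (rule sum.cong, auto simp: algebra_simps min_def)
  finally show "fs_coeff (fs_euler (f * g)) w = fs_coeff (fs_euler f * g + f * fs_euler g) w" .
qed

lemma fs_order_ge_euler: "fs_order_ge k f \<Longrightarrow> fs_order_ge k (fs_euler f)"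
  by (auto simp: fs_order_ge_def)

text \<open>The derivative of each factor of the power is moved to the right end by
  \<open>mult_power_ad\<close>, and Pascal's rule collects the coefficients.\<close>

lemma fs_euler_power:
  "fs_euler (z ^ k) = (\<Sum>m<k. of_int ((-1) ^ m * int (k choose Suc m)) * z ^ (k - Suc m) * (ad z ^^ m) (fs_euler z))"
proof (induction k)
  case 0
  show ?case by (rule fs_eqI) (simp add: fs_coeff_one)
next
  case (Suc k)
  let ?c = "\<lambda>k m. of_int ((-1) ^ m * int (k choose m)) :: free_series"
  let ?d = "\<lambda>k m. of_int ((-1) ^ m * int (k choose Suc m)) :: free_series"
  let ?y = "\<lambda>m. (ad z ^^ m) (fs_euler z)"
  have c: "z * (of_int n * f) = of_int n * (z * f)" for n :: int and f
    by (metis mult.assoc mult_of_int_commute)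
  have "fs_euler (z ^ Suc k) = fs_euler z * z ^ k + z * (\<Sum>m<k. ?d k m * z ^ (k - Suc m) * ?y m)"
    by (simp add: fs_euler_mult Suc)
  also have "z * (\<Sum>m<k. ?d k m * z ^ (k - Suc m) * ?y m) = (\<Sum>m<k. ?d k m * z ^ (k - m) * ?y m)"
    unfolding sum_distrib_left
  proof (rule sum.cong)
    fix m assume "m \<in> {..<k}"
    then have "k - m = Suc (k - Suc m)" by auto
    then show "z * (?d k m * z ^ (k - Suc m) * ?y m) = ?d k m * z ^ (k - m) * ?y m"
      by (simp add: mult.assoc c del: of_int_mult)
  qed simp
  \<comment> \<open>The added term \<open>m = k\<close> has binomial coefficient zero; it aligns the
    two sums for Pascal's rule.\<close>
  also have "\<dots> = (\<Sum>m\<le>k. ?d k m * z ^ (k - m) * ?y m)"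
    by (rule sum.mono_neutral_left) (auto simp: not_less binomial_eq_0)
  also have "fs_euler z * z ^ k = (\<Sum>m\<le>k. ?c k m * z ^ (k - m) * ?y m)"
    by (rule mult_power_ad)
  also have "\<dots> + (\<Sum>m\<le>k. ?d k m * z ^ (k - m) * ?y m) =
      (\<Sum>m\<le>k. ?d (Suc k) m * z ^ (Suc k - Suc m) * ?y m)"
    by (simp add: algebra_simps flip: sum.distrib)
  finally show ?case by (simp only: lessThan_Suc_atMost)
qed

text \<open>The terms of \<open>(1 - exp (- t)) / t\<close> at \<open>t = ad z\<close>, applied to \<open>fs_euler z\<close>.\<close>

definition fs_dexp :: "free_series \<Rightarrow> nat \<Rightarrow> free_series" where
  "fs_dexp z k = (case k of 0 \<Rightarrow> 0 | Suc m \<Rightarrow> fs_scale ((-1) ^ m / fact (Suc m)) ((ad z ^^ m) (fs_euler z)))"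

lemma fs_order_ge_dexp:
  assumes "fs_order_ge 1 z"
  shows "fs_order_ge k (fs_dexp z k)"
  unfolding fs_dexp_def using fs_order_ge_ad_funpow[OF assms fs_order_ge_euler[OF assms]]
  by (auto split: nat.split intro: fs_order_ge_scale)

text \<open>The formula for the derivative of the exponential map: after division by
  \<open>k!\<close> the \<open>m\<close>-th term of \<open>fs_euler_power\<close> splits into the
  exponential term of index \<open>k - Suc m\<close> and the \<open>fs_dexp\<close> term of index
  \<open>Suc m\<close>.\<close>

lemma fs_euler_exp:
  assumes "fs_order_ge 1 z"
  shows "fs_euler (fs_exp z) = fs_exp z * fs_suminf (fs_dexp z)"
proof -
  let ?F = "\<lambda>i. fs_scale (fps_nth (fps_exp 1) i) (z ^ i)"
  have ordF: "fs_order_ge k (?F k)" for k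
    using fs_order_ge_power[OF assms] by (auto intro: fs_order_ge_scale)
  have "fs_euler (?F k) = (\<Sum>i\<le>k. ?F i * fs_dexp z (k - i))" for k
  proof (rule fs_eqI)
    fix w
    have "fs_coeff (fs_euler (?F k)) w = 1 / fact k * fs_coeff (fs_euler (z ^ k)) w"
      by simp
    also have "\<dots> = (\<Sum>m<k. 1 / fact k * ((-1) ^ m * of_nat (k choose Suc m)) *
        fs_coeff (z ^ (k - Suc m) * (ad z ^^ m) (fs_euler z)) w)"
      unfolding fs_euler_power
      by (simp add: mult.assoc fs_coeff_of_int_mult sum_distrib_left del: of_int_mult fs_coeff_euler)
        (simp add: mult.assoc)
    also have "\<dots> = (\<Sum>i<k. fs_coeff (?F i * fs_dexp z (k - i)) w)"
    proof (rule sum.reindex_bij_witness[where i = "\<lambda>i. k - Suc i" and j = "\<lambda>i. k - Suc i"], goal_cases)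
      case (5 m)
      then have "k - (k - Suc m) = Suc m" and
        "of_nat (k choose Suc m) = (fact k / (fact (Suc m) * fact (k - Suc m)) :: rat)"
        using binomial_fact[of "Suc m" k, where 'a = rat] by auto
      then show ?case
        unfolding fs_dexp_def by (simp add: fs_scale_mult_left fs_scale_mult_right)
    qed auto
    also have "\<dots> = (\<Sum>i\<le>k. fs_coeff (?F i * fs_dexp z (k - i)) w)"
      by (rule sum.mono_neutral_left) (auto simp: fs_dexp_def not_less)
    finally show "fs_coeff (fs_euler (?F k)) w = fs_coeff (\<Sum>i\<le>k. ?F i * fs_dexp z (k - i)) w"
      by simp
  qed
  moreover have "fs_euler (fs_suminf F) = fs_suminf (\<lambda>k. fs_euler (F k))" for F
    by (rule fs_eqI) (simp add: fs_coeff_suminf sum_distrib_left)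
  ultimately show ?thesis
    unfolding fs_compose_def by (simp only: fs_suminf_mult[OF ordF fs_order_ge_dexp[OF assms]])
qed

lemma fs_euler_var: "fs_euler (fs_var c) = fs_var c"
  by (rule fs_eqI) (simp add: fs_coeff_var)

text \<open>A letter is its own Euler derivative and commutes with itself, so only the term of index
  1 of \<open>fs_dexp\<close> survives.\<close>

lemma fs_euler_exp_var: "fs_euler (fs_exp (fs_var c)) = fs_exp (fs_var c) * fs_var c"
proof -
  have "ad x x = 0" for x :: free_series by (simp add: ad_def)
  then have "fs_dexp (fs_var c) k = (if k = 1 then fs_var c else 0)" for k
    by (cases k) (auto simp: fs_dexp_def fs_euler_var ad_def gr0_conv_Suc funpow_swap1 split: nat.split)
  then have "fs_suminf (fs_dexp (fs_var c)) = fs_var c"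
    by (intro fs_eqI) (auto simp: fs_coeff_suminf fs_coeff_var if_distrib[of "\<lambda>x. fs_coeff x _"] sum.delta cong: if_cong)
  then show ?thesis by (simp add: fs_euler_exp[OF fs_order_ge_var])
qed

text \<open>The Euler derivation is applied to \<open>fs_exp_bch\<close> and the factor
  \<open>fs_exp fs_bch\<close> is cancelled; moving \<open>fs_var True\<close> past the second
  exponential produces the conjugation series. The result is the recursion for the components of
  \<open>fs_bch\<close>.\<close>

lemma fs_dexp_bch:
  "fs_suminf (fs_dexp fs_bch) =
     fs_suminf (\<lambda>m. fs_scale ((-1) ^ m / fact m) ((ad (fs_var False) ^^ m) (fs_var True))) + fs_var False"
  (is "_ = ?psi + _")
proof (rule fs_mult_left_cancel)
  let ?x = "fs_var True" and ?y = "fs_var False"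
  show "fs_coeff (fs_exp fs_bch) [] = 1" by simp
  have "fs_exp fs_bch * fs_suminf (fs_dexp fs_bch) = fs_euler (fs_exp ?x * fs_exp ?y)"
    by (metis fs_euler_exp fs_order_ge_bch fs_exp_bch)
  also have "\<dots> = fs_exp ?x * (?x * fs_exp ?y) + fs_exp ?x * fs_exp ?y * ?y"
    by (simp add: fs_euler_mult fs_euler_exp_var mult.assoc)
  also have "?x * fs_exp ?y = fs_exp ?y * ?psi"
    by (rule fs_mult_exp) simp
  finally show "fs_exp fs_bch * fs_suminf (fs_dexp fs_bch) = fs_exp fs_bch * (?psi + ?y)"
    by (simp add: fs_exp_bch algebra_simps)
qed

section \<open>Homogeneous components\<close>

lift_definition fs_hom :: "nat \<Rightarrow> free_series \<Rightarrow> free_series" is "\<lambda>n f w. if length w = n then f w else 0" .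

lemma fs_coeff_hom: "fs_coeff (fs_hom n f) w = (if length w = n then fs_coeff f w else 0)"
  by transfer simp

lemma fs_hom_simps [simp]:
  "fs_hom n (f + g) = fs_hom n f + fs_hom n g" "fs_hom n (f - g) = fs_hom n f - fs_hom n g"
  "fs_hom n (fs_scale q f) = fs_scale q (fs_hom n f)" "fs_hom n 0 = 0"
  "fs_hom n (sum F A) = (\<Sum>k\<in>A. fs_hom n (F k))" "fs_hom n (fs_euler f) = fs_scale (of_nat n) (fs_hom n f)"
  by (rule fs_eqI; simp add: fs_coeff_hom)+

lemma fs_hom_var: "fs_hom n (fs_var c) = (if n = 1 then fs_var c else 0)"
  by (rule fs_eqI) (simp add: fs_coeff_hom fs_coeff_var)

lemma fs_hom_suminf: "fs_hom n (fs_suminf F) = (\<Sum>k\<le>n. fs_hom n (F k))"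
  by (rule fs_eqI) (simp add: fs_coeff_hom fs_coeff_suminf)

lemma fs_hom_eq_0: "fs_order_ge k f \<Longrightarrow> n < k \<Longrightarrow> fs_hom n f = 0"
  by (rule fs_eqI) (auto simp: fs_coeff_hom fs_order_ge_def)

lemma fs_hom_mult: "fs_hom n (f * g) = (\<Sum>i\<le>n. fs_hom i f * fs_hom (n - i) g)"
proof (rule fs_eqI)
  fix w :: "bool list"
  have "fs_coeff (\<Sum>i\<le>n. fs_hom i f * fs_hom (n - i) g) w =
     (\<Sum>i\<le>n. \<Sum>j\<le>length w. if j = i \<and> length w = n then fs_coeff f (take j w) * fs_coeff g (drop j w) else 0)"
    unfolding fs_coeff_sum fs_coeff_mult by (intro sum.cong refl) (auto simp: fs_coeff_hom min_def)
  also have "\<dots> = fs_coeff (fs_hom n (f * g)) w"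
    by (cases "length w = n") (simp_all add: fs_coeff_hom fs_coeff_mult sum.delta)
  finally show "fs_coeff (fs_hom n (f * g)) w = fs_coeff (\<Sum>i\<le>n. fs_hom i f * fs_hom (n - i) g) w" ..
qed

lemma fs_hom_ad: "fs_hom n (ad f g) = (\<Sum>i\<le>n. ad (fs_hom i f) (fs_hom (n - i) g))"
proof -
  have "fs_hom n (g * f) = (\<Sum>i\<le>n. fs_hom (n - i) g * fs_hom i f)"
    unfolding fs_hom_mult
    by (rule sum.reindex_bij_witness[where i = "\<lambda>i. n - i" and j = "\<lambda>i. n - i"]) auto
  then show ?thesis by (simp add: ad_def fs_hom_mult sum_subtractf)
qed

text \<open>As neither series has a constant term, a component of degree at most \<open>n\<close> of
  the bracket only meets components of degree strictly below \<open>n\<close>. This gain of one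
  degree makes the recursion well founded.\<close>

lemma is_lie_hom_ad:
  assumes z: "fs_order_ge 1 z" "\<And>k. k < n \<Longrightarrow> is_lie (fs_hom k z)"
    and x: "fs_order_ge 1 x" "\<And>k. k < n \<Longrightarrow> is_lie (fs_hom k x)"
    and "k \<le> n"
  shows "is_lie (fs_hom k (ad z x))"
  unfolding fs_hom_ad
proof (rule is_lie_sum)
  fix i assume "i \<in> {..k}"
  have "fs_hom 0 z = 0" "fs_hom 0 x = 0"
    using fs_hom_eq_0[OF z(1)] fs_hom_eq_0[OF x(1)] by auto
  then show "is_lie (ad (fs_hom i z) (fs_hom (k - i) x))"
    using \<open>k \<le> n\<close> \<open>i \<in> {..k}\<close>
    by (cases "i = 0 \<or> i = k") (auto, intro is_lie_ad z(2) x(2), auto)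
qed

text \<open>At least one application of \<open>ad\<close> is required for degree \<open>n\<close>
  itself to be reached from components below \<open>n\<close>.\<close>

lemma is_lie_hom_ad_funpow:
  assumes z: "fs_order_ge 1 z" "\<And>k. k < n \<Longrightarrow> is_lie (fs_hom k z)"
    and x: "fs_order_ge 1 x" "\<And>k. k < n \<Longrightarrow> is_lie (fs_hom k x)"
    and "k \<le> n"
  shows "is_lie (fs_hom k ((ad z ^^ Suc m) x))"
  using \<open>k \<le> n\<close>
proof (induction m arbitrary: k)
  case 0
  then show ?case using is_lie_hom_ad[OF z x] by simp
next
  case (Suc m)
  have "fs_order_ge 1 ((ad z ^^ Suc m) x)"
    using fs_order_ge_ad_funpow[OF z(1) x(1), of "Suc m"] fs_order_ge_mono by fastforce
  then have "is_lie (fs_hom k (ad z ((ad z ^^ Suc m) x)))"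
    using Suc by (intro is_lie_hom_ad[OF z]) auto
  then show ?case by simp
qed

lemma is_lie_hom_bch: "is_lie (fs_hom n fs_bch)"
proof (induction n rule: less_induct)
  case (less n)
  show ?case
  proof (cases "n = 0")
    case True
    then show ?thesis using fs_hom_eq_0[OF fs_order_ge_bch] by simp
  next
    case False
    let ?x = "fs_var True" and ?y = "fs_var False" and ?z = fs_bch
    define psi where "psi = fs_suminf (\<lambda>m. fs_scale ((-1) ^ m / fact m) ((ad ?y ^^ m) ?x))"
    have var: "is_lie (fs_hom k (fs_var c))" for k c
      by (simp add: fs_hom_var is_lie_var)
    have "is_lie (fs_hom n ((ad ?y ^^ m) ?x))" for m
    proof (cases m)
      case 0
      then show ?thesis using var by simp
    next
      case (Suc m)
      show ?thesis unfolding Suc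
        by (rule is_lie_hom_ad_funpow[where n = n]) (auto intro: var simp: fs_coeff_var)
    qed
    then have psi: "is_lie (fs_hom n psi)"
      unfolding psi_def fs_hom_suminf by (auto intro!: is_lie_sum is_lie_scale)
    have ad: "is_lie (fs_hom n ((ad ?z ^^ Suc m) (fs_euler ?z)))" for m
      by (rule is_lie_hom_ad_funpow[where n = n])
         (use less fs_order_ge_bch fs_order_ge_euler[OF fs_order_ge_bch] in \<open>auto intro: is_lie_scale\<close>)
    \<comment> \<open>The term of index 0 vanishes and that of index 1 is the Euler derivative,
      which gives \<open>n\<close> times the unknown component. All later terms contain a bracket
      and so involve only components already known to be Lie.\<close>
    have "fs_hom n (fs_suminf (fs_dexp ?z)) = (\<Sum>k\<in>insert 1 (insert 0 {2..n}). fs_hom n (fs_dexp ?z k))"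
      unfolding fs_hom_suminf using False by (intro sum.cong) auto
    also have "\<dots> = fs_scale (of_nat n) (fs_hom n ?z) + (\<Sum>k=2..n. fs_hom n (fs_dexp ?z k))"
      by (subst sum.insert) (auto simp: fs_dexp_def)
    finally have "fs_scale (of_nat n) (fs_hom n ?z) =
        fs_hom n (psi + ?y) - (\<Sum>k=2..n. fs_hom n (fs_dexp ?z k))"
      using fs_dexp_bch unfolding psi_def by simp
    moreover have "is_lie (fs_hom n (fs_dexp ?z k))" if "k \<in> {2..n}" for k
    proof -
      obtain m where "k = Suc (Suc m)"
        using \<open>k \<in> {2..n}\<close> by (cases k; cases "k - 1") auto
      then show ?thesis
        using ad[of m] by (auto simp: fs_dexp_def intro: is_lie_scale)
    qed
    ultimately have "is_lie (fs_scale (of_nat n) (fs_hom n ?z))"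
      using psi var by (auto intro!: is_lie_diff is_lie_add is_lie_sum)
    then have "is_lie (fs_scale (1 / of_nat n) (fs_scale (of_nat n) (fs_hom n ?z)))"
      by (rule is_lie_scale)
    then show ?thesis using False by simp
  qed
qed

lemma nc_of_bch_lie: "nc_of_lie_polynomial (bch_lie n) = bch_hom n"
proof -
  obtain P where "fs_hom n fs_bch = fs_lie_polynomial P"
    using is_lie_hom_bch is_lie_def by auto
  then have "nc_of_lie_polynomial P = fs_coeff (fs_hom n fs_bch)"
    by (simp add: fs_coeff_lie_polynomial)
  then have "nc_of_lie_polynomial P = bch_hom n"
    by (simp add: bch_hom_def fun_eq_iff fs_coeff_hom fs_coeff_bch)
  then show ?thesis
    unfolding bch_lie_def by (rule someI)
qed


section \<open>Denominators of the coefficients of exponential, logarithm and their composites\<close>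

locale prime_nat =
  fixes p :: nat
  assumes prime_p: "Factorial_Ring.prime p"
begin

lemma p_ge_2: "p \<ge> 2"
  using prime_p prime_ge_2_nat by blast

section \<open>The localisation of the integers at \<open>p\<close>\<close>

definition Zloc :: "rat set" where
  "Zloc = {q. \<exists>n m::int. \<not> int p dvd n \<and> of_int n * q = of_int m}"

lemma ZlocI: "\<not> int p dvd n \<Longrightarrow> of_int n * q = of_int m \<Longrightarrow> q \<in> Zloc"
  unfolding Zloc_def by blast

lemma ZlocE:
  assumes "q \<in> Zloc"
  obtains n m where "\<not> int p dvd n" "n \<noteq> 0" "of_int n * q = of_int m"
  using assms unfolding Zloc_def by auto

lemma not_dvd_mult: "\<not> int p dvd m \<Longrightarrow> \<not> int p dvd n \<Longrightarrow> \<not> int p dvd m * n"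
  using prime_p by (simp add: prime_dvd_mult_iff)

lemma Zloc_of_int [simp]: "of_int m \<in> Zloc"
  by (rule ZlocI[of 1]) (use p_ge_2 in auto)

lemma Zloc_simps [simp]: "of_nat m \<in> Zloc" "0 \<in> Zloc" "1 \<in> Zloc" "of_nat m ^ k \<in> Zloc"
  using Zloc_of_int[of "int m"] Zloc_of_int[of 0] Zloc_of_int[of 1] Zloc_of_int[of "int m ^ k"] by auto

lemma Zloc_add: "a \<in> Zloc \<Longrightarrow> b \<in> Zloc \<Longrightarrow> a + b \<in> Zloc"
proof (elim ZlocE)
  fix n m n' m'
  assume *: "\<not> int p dvd n" "\<not> int p dvd n'" "of_int n * a = of_int m" "of_int n' * b = of_int m'"
  show "a + b \<in> Zloc"
    by (rule ZlocI[of "n * n'" _ "m * n' + m' * n"], rule not_dvd_mult[OF *(1,2)])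
       (simp add: *(3,4)[symmetric] algebra_simps)
qed

lemma Zloc_mult: "a \<in> Zloc \<Longrightarrow> b \<in> Zloc \<Longrightarrow> a * b \<in> Zloc"
proof (elim ZlocE)
  fix n m n' m'
  assume *: "\<not> int p dvd n" "\<not> int p dvd n'" "of_int n * a = of_int m" "of_int n' * b = of_int m'"
  show "a * b \<in> Zloc"
    by (rule ZlocI[of "n * n'" _ "m * m'"], rule not_dvd_mult[OF *(1,2)])
       (simp add: *(3,4)[symmetric] algebra_simps)
qed

lemma Zloc_uminus: "a \<in> Zloc \<Longrightarrow> - a \<in> Zloc"
  using Zloc_mult[OF Zloc_of_int[of "-1"], of a] by simp

lemma Zloc_diff: "a \<in> Zloc \<Longrightarrow> b \<in> Zloc \<Longrightarrow> a - b \<in> Zloc"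
  using Zloc_add[of a "- b"] Zloc_uminus[of b] by simp

lemma Zloc_sum: "(\<And>x. x \<in> A \<Longrightarrow> f x \<in> Zloc) \<Longrightarrow> sum f A \<in> Zloc"
  by (induction A rule: infinite_finite_induct) (auto intro: Zloc_add)

lemma Zloc_inverse: "\<not> p dvd n \<Longrightarrow> 1 / of_nat n \<in> Zloc"
  by (rule ZlocI[of "int n" _ 1]) (auto intro!: Nat.gr0I)

text \<open>An upper bound for the \<open>p\<close>-adic valuation of \<open>n!\<close> for \<open>n \<ge> 1\<close>; it vanishes at \<open>0\<close> by truncated
  subtraction.\<close>
definition fact_bound :: "nat \<Rightarrow> nat" where
  "fact_bound n = (n - 1) div (p - 1)"

lemma div_add_le: "a div r + b div r \<le> (a + b) div (r::nat)"
  by (subst div_add1_eq[of a b]) simp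

text \<open>Superadditivity is what makes the denominator bound stable under products.\<close>

lemma fact_bound_add: "fact_bound i + fact_bound j \<le> fact_bound (i + j)"
  unfolding fact_bound_def
  by (rule order_trans[OF div_add_le]) (auto intro: div_le_mono)

text \<open>Among the factors of \<open>k!\<close> the multiples of \<open>p\<close> are
  \<open>p\<close>, \<open>2 p\<close>, ..., \<open>(k div p) p\<close>, which contribute
  \<open>p ^ (k div p) * fact (k div p)\<close>; the others are prime to \<open>p\<close>.\<close>

lemma fact_factor: "\<exists>u. \<not> p dvd u \<and> fact k = p ^ (k div p) * fact (k div p) * u"
proof (induction k)
  case 0
  show ?case using p_ge_2 by (intro exI[of _ 1]) auto
next
  case (Suc k)
  then obtain u where u: "\<not> p dvd u" "fact k = p ^ (k div p) * fact (k div p) * u" by blast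
  show ?case
  proof (cases "p dvd Suc k")
    case True
    then have d: "Suc k div p = Suc (k div p)"
      by (simp add: div_Suc dvd_eq_mod_eq_0)
    have "Suc k = p * Suc (k div p)"
      using True d by (metis dvd_mult_div_cancel)
    then have "fact (Suc k) = p * Suc (k div p) * fact k"
      by (metis fact_Suc of_nat_id)
    then show ?thesis
      using u by (intro exI[of _ u]) (simp add: d algebra_simps)
  next
    case False
    then have "Suc k div p = k div p"
      by (simp add: div_Suc dvd_eq_mod_eq_0)
    moreover have "\<not> p dvd Suc k * u"
      using False u prime_p by (simp add: prime_dvd_mult_iff del: mult_Suc)
    ultimately show ?thesis
      using u by (intro exI[of _ "Suc k * u"]) (simp add: algebra_simps)
  qed
qed

text \<open>The bound has to be compatible with the recursion that \<open>fact_factor\<close> gives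
  for the valuation of a factorial.\<close>

lemma fact_bound_div:
  assumes "k > 0"
  shows "k div p + fact_bound (k div p) \<le> fact_bound k"
proof (cases "k div p = 0")
  case True
  then show ?thesis by (simp add: fact_bound_def)
next
  case False
  define q r where "q = k div p" and "r = p - 1"
  have r: "r > 0" "p = Suc r" using p_ge_2 by (auto simp: r_def)
  \<comment> \<open>The numerator on the right is \<open>q p - 1\<close>, and \<open>q p\<close> is
    at most \<open>k\<close>.\<close>
  have "q + (q - 1) div r = (q * r + (q - 1)) div r"
    using r by simp
  also have "\<dots> \<le> (k - 1) div r"
  proof (rule div_le_mono)
    have "q * p \<le> k" unfolding q_def by simp
    then show "q * r + (q - 1) \<le> k - 1"
      using False[folded q_def] unfolding r(2) by (simp add: algebra_simps)
  qed
  finally show ?thesis by (simp add: q_def r_def fact_bound_def)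
qed

lemma Zloc_fact: "of_nat p ^ fact_bound k / fact k \<in> Zloc"
proof (induction k rule: less_induct)
  case (less k)
  show ?case
  proof (cases "k = 0")
    case True
    then show ?thesis by (simp add: fact_bound_def)
  next
    case False
    define q where "q = k div p"
    have "q < k" using False p_ge_2 by (simp add: q_def)
    obtain u where u: "\<not> p dvd u" "fact k = p ^ q * fact q * u"
      using fact_factor[of k] unfolding q_def by blast
    have "(fact k :: rat) = of_nat (fact k)" by simp
    also have "\<dots> = of_nat p ^ q * fact q * of_nat u" unfolding u(2) by simp
    finally have f: "(fact k :: rat) = of_nat p ^ q * fact q * of_nat u" .
    have e: "fact_bound k = q + (fact_bound q + (fact_bound k - q - fact_bound q))"
      using fact_bound_div[of k] False by (simp add: q_def)
    have "of_nat p ^ fact_bound k / fact k =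
        of_nat p ^ (fact_bound k - q - fact_bound q) * (of_nat p ^ fact_bound q / fact q) * (1 / of_nat u :: rat)"
      unfolding f by (subst e) (use p_ge_2 in \<open>simp add: power_add\<close>)
    then show ?thesis
      using less[OF \<open>q < k\<close>] Zloc_inverse[OF u(1)] by (simp only: Zloc_mult Zloc_simps)
  qed
qed

lemma Zloc_exp_coeff: "of_nat p ^ fact_bound k * fps_nth (fps_exp (of_nat n)) k \<in> Zloc"
  using Zloc_mult[OF Zloc_fact[of k] Zloc_simps(4)[of n k]] by simp

lemma Zloc_ln_coeff: "of_nat p ^ fact_bound k * fps_nth (fps_ln 1) k \<in> Zloc"
proof (cases k)
  case (Suc m)
  \<comment> \<open>As \<open>1/k = (k - 1)!/k!\<close>, the bound for factorials also covers the
    logarithm.\<close>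
  have "of_nat p ^ fact_bound k * fps_nth (fps_ln 1) k =
      of_nat p ^ fact_bound k / fact k * (of_int ((-1) ^ m * fact m) :: rat)"
    using fact_Suc[of m, where 'a = rat] by (simp add: fps_ln_nth Suc del: fact_Suc of_nat_Suc)
  then show ?thesis
    using Zloc_mult[OF Zloc_fact[of k] Zloc_of_int] by metis
qed (simp add: fps_ln_nth)

text \<open>The \<open>p\<close>-part of the denominators obeys the bound for factorials. The class
  is closed under products and under substitution into exponential and logarithm, hence contains
  \<open>fs_bch\<close>.\<close>

definition fs_bounded :: "free_series \<Rightarrow> bool" where
  "fs_bounded f \<longleftrightarrow> (\<forall>w. of_nat p ^ fact_bound (length w) * fs_coeff f w \<in> Zloc)"

lemma Zloc_power_le: "of_nat p ^ i * q \<in> Zloc \<Longrightarrow> i \<le> j \<Longrightarrow> of_nat p ^ j * q \<in> Zloc"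
  using Zloc_mult[OF Zloc_simps(4)[of p "j - i"], of "of_nat p ^ i * q"]
  by (simp flip: mult.assoc power_add)

lemma Zloc_power_mult:
  assumes "of_nat p ^ i * a \<in> Zloc" "of_nat p ^ j * b \<in> Zloc" "i + j \<le> k"
  shows "of_nat p ^ k * (a * b) \<in> Zloc"
  using Zloc_power_le[OF _ assms(3), of "a * b"] Zloc_mult[OF assms(1,2)]
  by (simp add: power_add mult_ac)

lemma fs_bounded_one: "fs_bounded 1"
  by (simp add: fs_bounded_def fs_coeff_one)

lemma fs_bounded_var: "fs_bounded (fs_var c)"
  by (simp add: fs_bounded_def fs_coeff_var)

lemma fs_bounded_diff: "fs_bounded f \<Longrightarrow> fs_bounded g \<Longrightarrow> fs_bounded (f - g)"
  by (simp add: fs_bounded_def right_diff_distrib Zloc_diff)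

lemma fs_bounded_mult:
  assumes "fs_bounded f" "fs_bounded g"
  shows "fs_bounded (f * g)"
  unfolding fs_bounded_def fs_coeff_mult sum_distrib_left
proof (intro allI Zloc_sum)
  fix w :: "bool list" and i
  assume "i \<in> {..length w}"
  then have "of_nat p ^ fact_bound i * fs_coeff f (take i w) \<in> Zloc"
      "of_nat p ^ fact_bound (length w - i) * fs_coeff g (drop i w) \<in> Zloc"
    using assms[unfolded fs_bounded_def, rule_format, of "take i w"]
      assms[unfolded fs_bounded_def, rule_format, of "drop i w"] by (auto simp: min_absorb2)
  then show "of_nat p ^ fact_bound (length w) * (fs_coeff f (take i w) * fs_coeff g (drop i w)) \<in> Zloc"
    using fact_bound_add[of i "length w - i"] \<open>i \<in> {..length w}\<close> by (intro Zloc_power_mult) auto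
qed

text \<open>Each of the \<open>k\<close> factors uses at least one letter and saves one in its
  exponent, which improves \<open>n - 1\<close> to \<open>n - k\<close> for words of length
  \<open>n\<close>.\<close>

lemma Zloc_coeff_power:
  assumes f: "fs_bounded f" "fs_order_ge 1 f"
  shows "of_nat p ^ ((length w - k) div (p - 1)) * fs_coeff (f ^ k) w \<in> Zloc"
proof (induction k arbitrary: w)
  case 0
  show ?case by (simp add: fs_coeff_one)
next
  case (Suc k)
  show ?case
    unfolding power_Suc fs_coeff_mult sum_distrib_left
  proof (rule Zloc_sum)
    fix i assume i: "i \<in> {..length w}"
    show "of_nat p ^ ((length w - Suc k) div (p - 1)) * (fs_coeff f (take i w) * fs_coeff (f ^ k) (drop i w)) \<in> Zloc"
    proof (cases "i = 0 \<or> length w - i < k")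
      case True
      then have "fs_coeff f (take i w) = 0 \<or> fs_coeff (f ^ k) (drop i w) = 0"
        using f(2) fs_order_ge_power[OF f(2), of k] by (auto simp: fs_order_ge_def)
      then show ?thesis by auto
    next
      case False
      have "(i - 1) div (p - 1) + (length w - i - k) div (p - 1) \<le> (length w - Suc k) div (p - 1)"
        using False i by (intro order_trans[OF div_add_le]) (auto intro: div_le_mono)
      moreover have "of_nat p ^ ((i - 1) div (p - 1)) * fs_coeff f (take i w) \<in> Zloc"
        using f(1)[unfolded fs_bounded_def fact_bound_def, rule_format, of "take i w"] i by (simp add: min_absorb2)
      moreover have "of_nat p ^ ((length w - i - k) div (p - 1)) * fs_coeff (f ^ k) (drop i w) \<in> Zloc"
        using Suc[of "drop i w"] by simp
      ultimately show ?thesis by (blast intro: Zloc_power_mult)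
    qed
  qed
qed

text \<open>The exponents add up: \<open>k - 1\<close> for the coefficient \<open>g\<close> and
  \<open>n - k\<close> for the power give \<open>n - 1\<close>, the bound for a word of length
  \<open>n\<close>.\<close>

lemma Zloc_compose_term:
  assumes f: "fs_bounded f" "fs_order_ge 1 f"
    and g: "of_nat p ^ fact_bound k * g \<in> Zloc"
  shows "of_nat p ^ fact_bound (length w) * (g * fs_coeff (f ^ k) w) \<in> Zloc"
proof (cases "k = 0 \<or> length w < k")
  case True
  then have "fs_coeff (f ^ k) w = (if k = 0 \<and> w = [] then 1 else 0)"
    using fs_order_ge_power[OF f(2), of k] by (auto simp: fs_coeff_one fs_order_ge_def)
  then show ?thesis using g by auto
next
  case False
  have "fact_bound k + (length w - k) div (p - 1) \<le> fact_bound (length w)"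
    unfolding fact_bound_def
    using False by (intro order_trans[OF div_add_le]) (auto intro: div_le_mono)
  then show ?thesis
    by (rule Zloc_power_mult[OF g Zloc_coeff_power[OF f]])
qed

lemma fs_bounded_compose_term:
  assumes "fs_bounded f" "fs_order_ge 1 f" "of_nat p ^ fact_bound k * g \<in> Zloc"
  shows "fs_bounded (fs_scale g (f ^ k))"
  using Zloc_compose_term[OF assms] by (simp add: fs_bounded_def)

lemma fs_bounded_compose:
  assumes "fs_bounded f" "fs_order_ge 1 f"
    and "\<And>k. of_nat p ^ fact_bound k * fps_nth g k \<in> Zloc"
  shows "fs_bounded (fs_compose g f)"
  unfolding fs_bounded_def fs_coeff_compose sum_distrib_left
  by (intro allI Zloc_sum Zloc_compose_term assms)

lemma fs_bounded_exp: "fs_bounded f \<Longrightarrow> fs_order_ge 1 f \<Longrightarrow> fs_bounded (fs_exp f)"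
  using Zloc_exp_coeff[of _ 1] by (intro fs_bounded_compose) auto

lemma fs_bounded_exp_prod: "fs_bounded (fs_exp (fs_var True) * fs_exp (fs_var False) - 1)"
  by (intro fs_bounded_diff fs_bounded_mult fs_bounded_exp fs_bounded_var fs_bounded_one fs_order_ge_var)

lemma fs_bounded_bch: "fs_bounded fs_bch"
  unfolding fs_bch_def
  by (intro fs_bounded_compose fs_bounded_exp_prod fs_order_ge_exp_prod Zloc_ln_coeff)

section \<open>Valuations of the powers of \<open>bold_p\<close>\<close>

definition bold_exponent :: nat where
  "bold_exponent = (if p = 2 then 2 else 1)"

lemma bold_p_eq: "bold_p p = p ^ bold_exponent"
  by (simp add: bold_p_def bold_exponent_def)

definition bold_val :: "nat \<Rightarrow> nat" where
  "bold_val n = bold_exponent * n - fact_bound n"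

lemma fact_bound_le: "fact_bound n \<le> n"
  unfolding fact_bound_def by (meson diff_le_self div_le_dividend order_trans)

lemma fact_bound_le_half: "p \<noteq> 2 \<Longrightarrow> fact_bound n \<le> (n - 1) div 2"
  unfolding fact_bound_def using p_ge_2 by (intro div_le_mono2) auto

lemma bold_p_power: "bold_p p ^ n = p ^ bold_val n * p ^ fact_bound n"
proof -
  have "fact_bound n \<le> bold_exponent * n"
    using fact_bound_le[of n] by (auto simp: bold_exponent_def)
  then show ?thesis
    by (simp add: bold_p_eq bold_val_def flip: power_mult power_add)
qed

text \<open>Drives the convergence. For \<open>n \<ge> 1\<close> the surplus is
  \<open>2 n - (n - 1)\<close> if \<open>p = 2\<close>, growing only thanks to the factor 4, and at
  least \<open>n - (n - 1) div 2\<close> for odd \<open>p\<close>.\<close>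

lemma bold_val_ge_half: "n div 2 \<le> bold_val n"
  using fact_bound_le_half[of n] fact_bound_le[of n]
  unfolding bold_val_def bold_exponent_def by (cases "p = 2") simp_all

text \<open>Every term of positive degree stays divisible by \<open>bold_p\<close>; hence the value
  of a series without constant term can again be inserted into a series.\<close>

lemma bold_val_ge: "n > 0 \<Longrightarrow> bold_exponent \<le> bold_val n"
  using fact_bound_le_half[of n] by (auto simp: bold_val_def bold_exponent_def fact_bound_def)

end


section \<open>Rings complete in the \<open>p\<close>-adic topology\<close>

text \<open>Noncommutative, to cover the coefficient ring, the power series ring and its
  endomorphism ring alike. Completeness is expressed by \<open>p\<close>-adic expansions, a form
  that can be checked coefficientwise or pointwise; \<open>unit_of_nat\<close> provides the scalars
  from \<open>Zloc\<close>.\<close>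

locale padic_ring = prime_nat p
  for p :: nat and ty :: "'e::ring_1 itself" +
  assumes torsion_free: "of_nat n * (x::'e) = 0 \<Longrightarrow> n = 0 \<or> x = 0"
    and separated: "(\<And>k. \<exists>y::'e. x = of_nat p ^ k * y) \<Longrightarrow> x = 0"
    and complete: "\<And>f::nat \<Rightarrow> 'e. \<exists>s. \<forall>N. \<exists>y. s = (\<Sum>n<N. of_nat p ^ n * f n) + of_nat p ^ N * y"
    and unit_of_nat: "\<not> p dvd n \<Longrightarrow> \<exists>u::'e. of_nat n * u = 1"
begin

definition pmult :: "nat \<Rightarrow> 'e \<Rightarrow> bool" where
  "pmult k x \<longleftrightarrow> (\<exists>y. x = of_nat p ^ k * y)"

lemma of_nat_power_commute: "x * of_nat n ^ k = of_nat n ^ k * (x::'e)"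
  by (metis mult_of_nat_commute of_nat_power)

lemma pmult_0 [simp]: "pmult 0 x" "pmult k 0"
  unfolding pmult_def by (auto intro: exI[of _ 0])

lemma pmultI [simp]: "pmult k (of_nat p ^ k * x)"
  unfolding pmult_def by blast

lemma pmult_add: "pmult k x \<Longrightarrow> pmult k y \<Longrightarrow> pmult k (x + y)"
  unfolding pmult_def by (metis distrib_left)

lemma pmult_diff: "pmult k x \<Longrightarrow> pmult k y \<Longrightarrow> pmult k (x - y)"
  unfolding pmult_def by (metis right_diff_distrib)

lemma pmult_minus_commute: "pmult k (x - y) \<Longrightarrow> pmult k (y - x)"
  using pmult_diff[of k 0 "x - y"] by simp

lemma pmult_trans: "pmult k (x - y) \<Longrightarrow> pmult k (y - z) \<Longrightarrow> pmult k (x - z)"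
  using pmult_add[of k "x - y" "y - z"] by simp

lemma pmult_sum: "(\<And>i. i \<in> A \<Longrightarrow> pmult k (f i)) \<Longrightarrow> pmult k (sum f A)"
  by (induction A rule: infinite_finite_induct) (auto intro: pmult_add)

lemma pmult_mult_left: "pmult k x \<Longrightarrow> pmult k (y * x)"
  unfolding pmult_def by (metis mult.assoc of_nat_power_commute)

lemma pmult_mult_right: "pmult k x \<Longrightarrow> pmult k (x * y)"
  unfolding pmult_def by (metis mult.assoc)

lemma pmult_mono: "pmult k x \<Longrightarrow> j \<le> k \<Longrightarrow> pmult j x"
  unfolding pmult_def by (metis le_add_diff_inverse mult.assoc power_add)

lemma eq_0_if_pmult: "(\<And>k. pmult k x) \<Longrightarrow> x = 0"
  unfolding pmult_def by (rule separated)

lemma of_nat_mult_cancel: "of_nat n * x = of_nat n * (y::'e) \<Longrightarrow> n > 0 \<Longrightarrow> x = y"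
  using torsion_free[of n "x - y"] by (auto simp: algebra_simps)

lemma of_int_mult_cancel: "of_int n * x = of_int n * (y::'e) \<Longrightarrow> n \<noteq> 0 \<Longrightarrow> x = y"
  using of_nat_mult_cancel[of "nat \<bar>n\<bar>" x y] by (cases "n \<ge> 0") (auto simp: abs_if)

lemma p_power_cancel: "of_nat p ^ k * x = of_nat p ^ k * (y::'e) \<Longrightarrow> x = y"
  using of_nat_mult_cancel[of "p ^ k" x y] p_ge_2 by auto

section \<open>Convergent sums\<close>

definition psums :: "(nat \<Rightarrow> 'e) \<Rightarrow> 'e \<Rightarrow> bool" where
  "psums f s \<longleftrightarrow> (\<forall>K. \<exists>N. \<forall>n\<ge>N. pmult K (s - (\<Sum>i<n. f i)))"

definition pnull :: "(nat \<Rightarrow> 'e) \<Rightarrow> bool" where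
  "pnull f \<longleftrightarrow> (\<forall>K. \<exists>N. \<forall>n\<ge>N. pmult K (f n))"

lemma psums_unique: "psums f s \<Longrightarrow> psums f t \<Longrightarrow> s = t"
proof -
  assume st: "psums f s" "psums f t"
  have "pmult K (s - t)" for K
  proof -
    obtain N M where "\<forall>n\<ge>N. pmult K (s - (\<Sum>i<n. f i))" "\<forall>n\<ge>M. pmult K (t - (\<Sum>i<n. f i))"
      using st unfolding psums_def by meson
    then have "pmult K (s - (\<Sum>i<max N M. f i))" "pmult K ((\<Sum>i<max N M. f i) - t)"
      by (auto intro: pmult_minus_commute)
    then show ?thesis by (rule pmult_trans)
  qed
  then show "s = t" using eq_0_if_pmult[of "s - t"] by simp
qed

lemma psums_null: "psums f s \<Longrightarrow> pnull f"
  unfolding pnull_def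
proof
  fix K assume "psums f s"
  then obtain N where N: "\<forall>n\<ge>N. pmult K (s - (\<Sum>i<n. f i))"
    unfolding psums_def by meson
  have "pmult K (f n)" if "n \<ge> N" for n
  proof -
    have "pmult K ((s - (\<Sum>i<n. f i)) - (s - (\<Sum>i<Suc n. f i)))"
      by (rule pmult_diff[OF N[rule_format] N[rule_format]]) (use that in auto)
    then show ?thesis by simp
  qed
  then show "\<exists>N. \<forall>n\<ge>N. pmult K (f n)" by blast
qed

text \<open>Divisibility of the remainder can be tested at one late partial sum; between it and
  \<open>M\<close> lie only terms divisible by \<open>p ^ K\<close>.\<close>

lemma psums_tail:
  assumes "psums f s" "\<And>n. n \<ge> N \<Longrightarrow> pmult K (f n)" "M \<ge> N"
  shows "pmult K (s - (\<Sum>i<M. f i))"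
proof -
  obtain N' where N': "\<forall>n\<ge>N'. pmult K (s - (\<Sum>i<n. f i))"
    using assms(1) unfolding psums_def by meson
  have "(\<Sum>i<max M N'. f i) - (\<Sum>i<M. f i) = (\<Sum>i\<in>{..<max M N'} - {..<M}. f i)"
    by (subst sum_diff) auto
  moreover have "pmult K (\<Sum>i\<in>{..<max M N'} - {..<M}. f i)"
    using assms(2,3) by (intro pmult_sum) auto
  ultimately show ?thesis
    using pmult_trans[of K s "\<Sum>i<max M N'. f i" "\<Sum>i<M. f i"] N' by simp
qed

text \<open>The terms are grouped into blocks, the \<open>k\<close>-th one divisible by
  \<open>p ^ k\<close>, so that the sum becomes an expansion as in \<open>complete\<close>.\<close>

lemma pnull_summable:
  assumes "pnull f"
  shows "\<exists>s. psums f s"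
proof -
  obtain M where M: "\<And>K n. n \<ge> M K \<Longrightarrow> pmult K (f n)"
    using assms unfolding pnull_def by metis
  \<comment> \<open>Cumulative sums make the block boundaries increasing and keep them at least
    \<open>M k\<close>.\<close>
  define N where "N k = (\<Sum>j\<le>k. M j)" for k
  have N: "M k \<le> N k" "N k \<le> N (Suc k)" for k
    unfolding N_def by (auto intro: member_le_sum)
  have "\<exists>y. (\<Sum>i\<in>{N k..<N (Suc k)}. f i) = of_nat p ^ k * y" for k
    using pmult_sum[of "{N k..<N (Suc k)}" k f] M[of k] N(1)[of k] unfolding pmult_def by fastforce
  then obtain g where g: "\<And>k. (\<Sum>i\<in>{N k..<N (Suc k)}. f i) = of_nat p ^ k * g k"
    by metis
  have S: "(\<Sum>i<N K. f i) = (\<Sum>i<N 0. f i) + (\<Sum>k<K. of_nat p ^ k * g k)" for K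
  proof (induction K)
    case (Suc K)
    have "{..<N (Suc K)} = {..<N K} \<union> {N K..<N (Suc K)}" using N(2)[of K] by auto
    then have "(\<Sum>i<N (Suc K). f i) = (\<Sum>i<N K. f i) + (\<Sum>i\<in>{N K..<N (Suc K)}. f i)"
      by (simp add: sum.union_disjoint ivl_disj_int)
    then show ?case using Suc by (simp add: g add.assoc)
  qed simp
  obtain t where t: "\<And>K. \<exists>y. t = (\<Sum>k<K. of_nat p ^ k * g k) + of_nat p ^ K * y"
    using complete[of g] by blast
  have "psums f ((\<Sum>i<N 0. f i) + t)"
    unfolding psums_def
  proof (intro allI exI impI)
    fix K n assume n: "n \<ge> N K"
    have "pmult K ((\<Sum>i<N 0. f i) + t - (\<Sum>i<N K. f i))"
      using t[of K] unfolding S[of K] pmult_def by auto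
    moreover have "pmult K ((\<Sum>i<n. f i) - (\<Sum>i<N K. f i))"
    proof -
      have "(\<Sum>i<n. f i) - (\<Sum>i<N K. f i) = (\<Sum>i\<in>{..<n} - {..<N K}. f i)"
        using n by (subst sum_diff) auto
      moreover have "pmult K (\<Sum>i\<in>{..<n} - {..<N K}. f i)"
        using M[of K] N(1)[of K] by (intro pmult_sum) auto
      ultimately show ?thesis by simp
    qed
    ultimately show "pmult K ((\<Sum>i<N 0. f i) + t - (\<Sum>i<n. f i))"
      using pmult_trans pmult_minus_commute by blast
  qed
  then show ?thesis by blast
qed

lemma psums_mult_left: "psums f s \<Longrightarrow> psums (\<lambda>n. x * f n) (x * s)"
  unfolding psums_def by (metis pmult_mult_left right_diff_distrib sum_distrib_left)

lemma psums_mult_right: "psums f s \<Longrightarrow> psums (\<lambda>n. f n * x) (s * x)"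
  unfolding psums_def by (metis pmult_mult_right left_diff_distrib sum_distrib_right)

lemma psums_diff: "psums f s \<Longrightarrow> psums g t \<Longrightarrow> psums (\<lambda>n. f n - g n) (s - t)"
  unfolding psums_def
proof
  fix K assume "\<forall>K. \<exists>N. \<forall>n\<ge>N. pmult K (s - sum f {..<n})" "\<forall>K. \<exists>N. \<forall>n\<ge>N. pmult K (t - sum g {..<n})"
  then obtain N M where N: "\<forall>n\<ge>N. pmult K (s - sum f {..<n})" and M: "\<forall>n\<ge>M. pmult K (t - sum g {..<n})"
    by meson
  have "pmult K ((s - sum f {..<n}) - (t - sum g {..<n}))" if "n \<ge> max N M" for n
    by (rule pmult_diff[OF N[rule_format] M[rule_format]]) (use that in auto)
  then show "\<exists>N. \<forall>n\<ge>N. pmult K (s - t - (\<Sum>n<n. f n - g n))"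
    by (intro exI[of _ "max N M"]) (simp add: sum_subtractf algebra_simps)
qed

lemma psums_finite:
  assumes "\<And>n. n \<ge> N \<Longrightarrow> f n = 0"
  shows "psums f (\<Sum>i<N. f i)"
  unfolding psums_def
proof (intro allI exI[of _ N] impI)
  fix K n assume "n \<ge> N"
  then have "(\<Sum>i<n. f i) = (\<Sum>i<N. f i)"
    using assms by (intro sum.mono_neutral_right) auto
  then show "pmult K ((\<Sum>i<N. f i) - (\<Sum>i<n. f i))" by simp
qed

lemma psums_product:
  assumes "psums f s" "psums g t"
  shows "psums (\<lambda>n. \<Sum>i\<le>n. f i * g (n - i)) (s * t)"
  unfolding psums_def
proof
  fix K
  obtain N1 where N1: "\<forall>n\<ge>N1. pmult K (f n)"
    using psums_null[OF assms(1)] unfolding pnull_def by blast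
  obtain N2 where N2: "\<forall>n\<ge>N2. pmult K (g n)"
    using psums_null[OF assms(2)] unfolding pnull_def by blast
  obtain N3 where N3: "\<forall>n\<ge>N3. pmult K (s - sum f {..<n})"
    using assms(1) unfolding psums_def by blast
  obtain N4 where N4: "\<forall>n\<ge>N4. pmult K (t - sum g {..<n})"
    using assms(2) unfolding psums_def by blast
  note N = N1 N2 N3 N4
  \<comment> \<open>The size of \<open>n\<close> ensures that \<open>i \<ge> N1\<close> or
    \<open>j \<ge> N2\<close> outside the triangle.\<close>
  have "pmult K (s * t - (\<Sum>m<n. \<Sum>i\<le>m. f i * g (m - i)))" if n: "n \<ge> N1 + N2 + N3 + N4" for n
  proof -
    have "(\<Sum>m<n. \<Sum>i\<le>m. f i * g (m - i)) = (\<Sum>(i,j)\<in>{(i,j). i + j < n}. f i * g j)"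
      by (rule sum.triangle_reindex[symmetric])
    moreover have "sum f {..<n} * sum g {..<n} = (\<Sum>(i,j)\<in>{..<n} \<times> {..<n}. f i * g j)"
      by (simp add: sum_product sum.cartesian_product)
    moreover have "(\<Sum>(i,j)\<in>{..<n} \<times> {..<n}. f i * g j) - (\<Sum>(i,j)\<in>{(i,j). i + j < n}. f i * g j) =
        (\<Sum>(i,j)\<in>{..<n} \<times> {..<n} - {(i,j). i + j < n}. f i * g j)"
      by (subst sum_diff) auto
    moreover have "pmult K (\<Sum>(i,j)\<in>{..<n} \<times> {..<n} - {(i,j). i + j < n}. f i * g j)"
    proof (rule pmult_sum, clarsimp)
      fix i j assume "\<not> i + j < n"
      then have "i \<ge> N1 \<or> j \<ge> N2" using n by linarith
      then show "pmult K (f i * g j)"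
        using N(1,2) by (auto intro: pmult_mult_left pmult_mult_right)
    qed
    moreover have "pmult K ((s - sum f {..<n}) * t + sum f {..<n} * (t - sum g {..<n}))"
      using N n by (intro pmult_add pmult_mult_left pmult_mult_right) auto
    ultimately show ?thesis
      using pmult_trans[of K "s * t" "sum f {..<n} * sum g {..<n}"] by (simp add: algebra_simps)
  qed
  then show "\<exists>N. \<forall>n\<ge>N. pmult K (s * t - (\<Sum>m<n. \<Sum>i\<le>m. f i * g (m - i)))" by blast
qed

text \<open>Summation by columns is replaced by summation by rows. The null condition is uniform in
  \<open>k\<close>, so one bound truncates all rows at once.\<close>

lemma psums_exchange:
  assumes s: "psums (\<lambda>n. \<Sum>k\<le>n. e k n) s" and S: "\<And>k. psums (e k) (S k)"
    and e0: "\<And>k n. n < k \<Longrightarrow> e k n = 0"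
    and null: "\<And>K. \<exists>N. \<forall>n\<ge>N. \<forall>k. pmult K (e k n)"
  shows "psums S s"
  unfolding psums_def
proof
  fix K
  obtain N M where N: "\<forall>n\<ge>N. \<forall>k. pmult K (e k n)" and M: "\<forall>n\<ge>M. pmult K (s - (\<Sum>m<n. \<Sum>k\<le>m. e k m))"
    using null s unfolding psums_def by meson
  have "pmult K (s - (\<Sum>k<n. S k))" if n: "n \<ge> max N M" for n
  proof -
    have "(\<Sum>m<n. \<Sum>k\<le>m. e k m) = (\<Sum>m<n. \<Sum>k<n. e k m)"
      by (intro sum.cong refl sum.mono_neutral_left) (auto simp: e0)
    also have "\<dots> = (\<Sum>k<n. \<Sum>m<n. e k m)" by (rule sum.swap)
    finally have *: "(\<Sum>k<n. S k) - (\<Sum>m<n. \<Sum>k\<le>m. e k m) = (\<Sum>k<n. S k - (\<Sum>m<n. e k m))"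
      by (simp add: sum_subtractf)
    have "pmult K ((\<Sum>k<n. S k) - (\<Sum>m<n. \<Sum>k\<le>m. e k m))"
      unfolding * using n N by (intro pmult_sum psums_tail[OF S, of N]) auto
    then have "pmult K ((\<Sum>m<n. \<Sum>k\<le>m. e k m) - (\<Sum>k<n. S k))"
      by (rule pmult_minus_commute)
    moreover have "pmult K (s - (\<Sum>m<n. \<Sum>k\<le>m. e k m))"
      using M n by simp
    ultimately show ?thesis by (rule pmult_trans[rotated])
  qed
  then show "\<exists>N. \<forall>n\<ge>N. pmult K (s - (\<Sum>k<n. S k))" by blast
qed

section \<open>Scalars from the localised integers\<close>

definition rat_rel :: "rat \<Rightarrow> 'e \<Rightarrow> bool" where
  "rat_rel q e \<longleftrightarrow> (\<exists>n m::int. n \<noteq> 0 \<and> of_int n * q = of_int m \<and> of_int n * e = of_int m)"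

text \<open>The embedding of the local ring \<^const>\<open>Zloc\<close>; arbitrary elsewhere.\<close>
definition iota :: "rat \<Rightarrow> 'e" where
  "iota q = (SOME e. rat_rel q e)"

text \<open>The two elements agree once multiplied by both denominators, which can be cancelled by
  torsion-freeness. The laws of \<open>iota\<close> follow the same pattern.\<close>

lemma rat_rel_unique: "rat_rel q e \<Longrightarrow> rat_rel q e' \<Longrightarrow> e = e'"
  unfolding rat_rel_def
proof safe
  fix n m n' m' :: int
  assume *: "n \<noteq> 0" "of_int n * q = of_int m" "of_int n * e = of_int m"
    "n' \<noteq> 0" "of_int n' * q = of_int m'" "of_int n' * e' = of_int m'"
  have "rat_of_int (n' * m) = of_int (n * m')"
    by (simp flip: *(2,5))
  then have mm: "n' * m = n * m'" by (simp only: of_int_eq_iff)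
  have "of_int (n * n') * e = of_int n' * (of_int n * e)"
    by (simp add: mult.assoc[symmetric] mult.commute flip: of_int_mult)
  also have "\<dots> = of_int (n' * m)" by (simp add: *(3))
  also have "\<dots> = of_int n * (of_int n' * e')" by (simp add: *(6) mm)
  also have "\<dots> = of_int (n * n') * e'" by (simp add: mult.assoc)
  finally show "e = e'"
    using *(1,4) of_int_mult_cancel[of "n * n'"] by simp
qed

lemma iota_eqI: "rat_rel q e \<Longrightarrow> iota q = e"
  unfolding iota_def using rat_rel_unique by blast

lemma unit_of_int: "\<not> int p dvd n \<Longrightarrow> \<exists>u::'e. of_int n * u = 1"
proof -
  assume n: "\<not> int p dvd n"
  then have "\<not> p dvd nat \<bar>n\<bar>" by (simp add: nat_dvd_iff)
  then obtain u :: 'e where u: "of_nat (nat \<bar>n\<bar>) * u = 1" using unit_of_nat by blast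
  show ?thesis
  proof (cases "n \<ge> 0")
    case True
    then show ?thesis using u by (intro exI[of _ u]) simp
  next
    case False
    then show ?thesis using u by (intro exI[of _ "- u"]) simp
  qed
qed

lemma rat_rel_iota: "q \<in> Zloc \<Longrightarrow> rat_rel q (iota q)"
proof (erule ZlocE)
  fix n m :: int
  assume *: "\<not> int p dvd n" "n \<noteq> 0" "of_int n * q = of_int m"
  obtain u :: 'e where u: "of_int n * u = 1" using unit_of_int *(1) by blast
  have "of_int n * (of_int m * u) = of_int m"
    using u by (metis mult.assoc mult.right_neutral mult_of_int_commute)
  then have "rat_rel q (of_int m * u)" unfolding rat_rel_def using * by blast
  then show ?thesis unfolding iota_def by (rule someI)
qed

lemma iota_of_int: "iota (of_int m) = of_int m"
  by (rule iota_eqI) (unfold rat_rel_def, rule exI[of _ 1], auto)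

lemma iota_simps [simp]: "iota 0 = 0" "iota 1 = 1" "iota (of_nat m) = of_nat m" "iota (of_nat m ^ k) = of_nat m ^ k"
  using iota_of_int[of 0] iota_of_int[of 1] iota_of_int[of "int m"] iota_of_int[of "int m ^ k"] by simp_all

lemma iota_add:
  assumes "q \<in> Zloc" "r \<in> Zloc"
  shows "iota (q + r) = iota q + iota r"
proof (rule iota_eqI)
  obtain n m n' m' where *: "n \<noteq> 0" "of_int n * q = of_int m" "of_int n * iota q = of_int m"
      "n' \<noteq> 0" "of_int n' * r = of_int m'" "of_int n' * iota r = of_int m'"
    using rat_rel_iota[OF assms(1)] rat_rel_iota[OF assms(2)] unfolding rat_rel_def by metis
  have "of_int (n * n') * (iota q + iota r) = of_int n' * (of_int n * iota q) + of_int n * (of_int n' * iota r)"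
    by (simp add: distrib_left mult.assoc[symmetric] mult.commute flip: of_int_mult)
  then have "of_int (n * n') * (iota q + iota r) = of_int (m * n' + m' * n)"
    by (simp add: *(3,6) mult.commute flip: of_int_mult of_int_add)
  moreover have "of_int (n * n') * (q + r) = of_int (m * n' + m' * n)"
    by (simp add: *(2,5)[symmetric] algebra_simps)
  ultimately show "rat_rel (q + r) (iota q + iota r)"
    unfolding rat_rel_def using *(1,4) by (metis mult_eq_0_iff)
qed

text \<open>Integers are central, and the denominator can be cancelled.\<close>

lemma iota_commute:
  assumes "q \<in> Zloc"
  shows "iota q * x = x * iota q"
proof -
  obtain n m where *: "n \<noteq> 0" "of_int n * iota q = of_int m"
    using rat_rel_iota[OF assms] unfolding rat_rel_def by metis
  have "of_int n * (iota q * x) = of_int n * (x * iota q)"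
    using *(2) by (metis mult.assoc mult_of_int_commute)
  then show ?thesis using *(1) of_int_mult_cancel by blast
qed

lemma iota_mult:
  assumes "q \<in> Zloc" "r \<in> Zloc"
  shows "iota (q * r) = iota q * iota r"
proof (rule iota_eqI)
  obtain n m n' m' where *: "n \<noteq> 0" "of_int n * q = of_int m" "of_int n * iota q = of_int m"
      "n' \<noteq> 0" "of_int n' * r = of_int m'" "of_int n' * iota r = of_int m'"
    using rat_rel_iota[OF assms(1)] rat_rel_iota[OF assms(2)] unfolding rat_rel_def by metis
  have "of_int (n * n') * (iota q * iota r) = of_int n * iota q * (of_int n' * iota r)"
    by (simp add: mult.assoc) (metis mult.assoc mult_of_int_commute)
  then have "of_int (n * n') * (iota q * iota r) = of_int (m * m')"
    by (simp add: *(3,6))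
  moreover have "of_int (n * n') * (q * r) = of_int (m * m')"
    by (simp add: *(2,5)[symmetric] algebra_simps)
  ultimately show "rat_rel (q * r) (iota q * iota r)"
    unfolding rat_rel_def using *(1,4) by (metis mult_eq_0_iff)
qed

lemma iota_sum: "(\<And>x. x \<in> A \<Longrightarrow> f x \<in> Zloc) \<Longrightarrow> iota (sum f A) = (\<Sum>x\<in>A. iota (f x))"
  by (induction A rule: infinite_finite_induct) (auto simp: iota_add Zloc_sum)

lemma of_nat_mult_iota: "q \<in> Zloc \<Longrightarrow> of_nat n * iota q = iota (of_nat n * q)"
  by (simp add: iota_mult)

lemma iota_diff: "q \<in> Zloc \<Longrightarrow> r \<in> Zloc \<Longrightarrow> iota (q - r) = iota q - iota r"
  using iota_add[of "q - r" r] Zloc_diff by auto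

end


section \<open>Evaluation of bounded noncommutative series\<close>

context padic_ring
begin

abbreviation bp :: "'b::semiring_1" where "bp \<equiv> of_nat (bold_p p)"

lemma bp_gt_0: "bold_p p > 0"
  using p_ge_2 by (simp add: bold_p_def)

lemma of_nat_mult_power: "(of_nat n * x) ^ k = of_nat n ^ k * (x::'e) ^ k"
proof (induction k)
  case (Suc k)
  have "(of_nat n * x) ^ Suc k = of_nat n * (x * of_nat n ^ k) * x ^ k"
    by (simp only: power_Suc Suc mult.assoc)
  also have "\<dots> = of_nat n ^ Suc k * x ^ Suc k"
    by (simp only: of_nat_power_commute[of x] power_Suc mult.assoc)
  finally show ?case .
qed simp

definition word_eval :: "'e \<Rightarrow> 'e \<Rightarrow> bool list \<Rightarrow> 'e" where
  "word_eval a b w = prod_list (map (\<lambda>c. if c then a else b) w)"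

lemma word_eval_append: "word_eval a b (u @ v) = word_eval a b u * word_eval a b v"
  by (simp add: word_eval_def)

lemma word_eval_Nil [simp]: "word_eval a b [] = 1"
  and word_eval_single [simp]: "word_eval a b [c] = (if c then a else b)"
  by (simp_all add: word_eval_def)

abbreviation words :: "nat \<Rightarrow> bool list set" where "words n \<equiv> {w. length w = n}"

lemma finite_words [simp]: "finite (words n)"
  using finite_lists_length_eq[of "UNIV :: bool set" n] by simp

text \<open>The component of degree \<open>n\<close> of \<open>f\<close> at the elements \<open>bp a\<close>, \<open>bp b\<close>. The factors \<open>bp\<close> are
  moved to the coefficients, which makes these integral at \<open>p\<close>.\<close>
definition fs_eval :: "'e \<Rightarrow> 'e \<Rightarrow> free_series \<Rightarrow> nat \<Rightarrow> 'e" where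
  "fs_eval a b f n = (\<Sum>w\<in>words n. iota (bp ^ n * fs_coeff f w) * word_eval a b w)"

lemma Zloc_bp_power:
  assumes "of_nat p ^ fact_bound n * q \<in> Zloc"
  shows "bp ^ n * q \<in> Zloc" and "pmult (bold_val n) (iota (bp ^ n * q))"
proof -
  have "(of_nat (bold_p p ^ n) :: rat) = of_nat (p ^ bold_val n * p ^ fact_bound n)"
    by (simp only: bold_p_power)
  then have *: "bp ^ n * q = of_nat p ^ bold_val n * (of_nat p ^ fact_bound n * q)"
    by simp
  show "bp ^ n * q \<in> Zloc" unfolding * using assms by (simp only: Zloc_mult Zloc_simps)
  show "pmult (bold_val n) (iota (bp ^ n * q))" unfolding *
    using assms by (simp add: iota_mult)
qed

lemma Zloc_bounded: "fs_bounded f \<Longrightarrow> length w = n \<Longrightarrow> bp ^ n * fs_coeff f w \<in> Zloc"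
  using Zloc_bp_power(1) unfolding fs_bounded_def by blast

lemma pmult_fs_eval: "fs_bounded f \<Longrightarrow> pmult (bold_val n) (fs_eval a b f n)"
  unfolding fs_eval_def fs_bounded_def
  by (intro pmult_sum pmult_mult_right Zloc_bp_power(2)) auto

lemma pmult_half_fs_eval: "fs_bounded f \<Longrightarrow> pmult (n div 2) (fs_eval a b f n)"
  by (rule pmult_mono[OF pmult_fs_eval bold_val_ge_half])

lemma pnull_if_pmult_half:
  assumes "\<And>n. pmult (n div 2) (f n)"
  shows "pnull f"
  unfolding pnull_def
proof (intro allI exI impI)
  fix K n :: nat
  assume "n \<ge> 2 * K"
  then show "pmult K (f n)" by (intro pmult_mono[OF assms[of n]]) auto
qed

lemma fs_eval_summable: "fs_bounded f \<Longrightarrow> \<exists>s. psums (fs_eval a b f) s"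
  by (intro pnull_summable pnull_if_pmult_half pmult_half_fs_eval)

lemma fs_eval_diff: "fs_bounded f \<Longrightarrow> fs_bounded g \<Longrightarrow> fs_eval a b (f - g) n = fs_eval a b f n - fs_eval a b g n"
  by (simp add: fs_eval_def iota_diff Zloc_bounded right_diff_distrib left_diff_distrib flip: sum_subtractf)

lemma fs_eval_scale: "fs_bounded f \<Longrightarrow> fs_eval a b (fs_scale (of_int m) f) n = of_int m * fs_eval a b f n"
  unfolding fs_eval_def sum_distrib_left
proof (intro sum.cong refl)
  fix w assume *: "fs_bounded f" "w \<in> words n"
  have "iota (bp ^ n * fs_coeff (fs_scale (of_int m) f) w) = iota (of_int m * (bp ^ n * fs_coeff f w))"
    by (simp add: algebra_simps)
  also have "\<dots> = of_int m * iota (bp ^ n * fs_coeff f w)"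
    using * Zloc_bounded by (simp add: iota_mult iota_of_int)
  finally show "iota (bp ^ n * fs_coeff (fs_scale (of_int m) f) w) * word_eval a b w =
      of_int m * (iota (bp ^ n * fs_coeff f w) * word_eval a b w)"
    by (simp add: mult.assoc)
qed

lemma fs_eval_one: "fs_eval a b 1 n = (if n = 0 then 1 else 0)"
proof (cases n)
  case (Suc m)
  then have "fs_coeff 1 w = 0" if "w \<in> words n" for w
    using that by (auto simp: fs_coeff_one)
  then show ?thesis using Suc by (simp add: fs_eval_def)
qed (simp add: fs_eval_def fs_coeff_one)

lemma fs_eval_var: "fs_eval a b (fs_var c) n = (if n = 1 then bp * (if c then a else b) else 0)"
proof -
  have "fs_eval a b (fs_var c) n =
      (\<Sum>w\<in>words n. if w = [c] then iota (bp ^ n) * word_eval a b [c] else 0)"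
    unfolding fs_eval_def by (rule sum.cong) (auto simp: fs_coeff_var)
  then show ?thesis by (auto simp: sum.delta)
qed

text \<open>A word of length \<open>n\<close> with a cut at \<open>i\<close> is a pair of words of
  lengths \<open>i\<close> and \<open>n - i\<close>; the scalar of the second factor passes the
  first word because values of \<open>iota\<close> on \<open>Zloc\<close> are central.\<close>

lemma fs_eval_mult:
  assumes "fs_bounded f" "fs_bounded g"
  shows "fs_eval a b (f * g) n = (\<Sum>i\<le>n. fs_eval a b f i * fs_eval a b g (n - i))"
proof -
  have summand: "iota (bp ^ n * (fs_coeff f u * fs_coeff g v)) * word_eval a b (u @ v) =
      (iota (bp ^ i * fs_coeff f u) * word_eval a b u) * (iota (bp ^ (n - i) * fs_coeff g v) * word_eval a b v)"
    if "i \<le> n" "u \<in> words i" "v \<in> words (n - i)" for i u v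
  proof -
    have *: "bp ^ i * fs_coeff f u \<in> Zloc" "bp ^ (n - i) * fs_coeff g v \<in> Zloc"
      using assms that Zloc_bounded by auto
    have "bp ^ n * (fs_coeff f u * fs_coeff g v) = (bp ^ i * fs_coeff f u) * (bp ^ (n - i) * fs_coeff g v)"
      using \<open>i \<le> n\<close> power_add[of "bp :: rat" i "n - i"] by simp
    then have "iota (bp ^ n * (fs_coeff f u * fs_coeff g v)) =
        iota (bp ^ i * fs_coeff f u) * iota (bp ^ (n - i) * fs_coeff g v)"
      using * by (simp only: iota_mult)
    then show ?thesis
      using iota_commute[OF *(2), of "word_eval a b u"]
      by (metis (no_types, lifting) word_eval_append mult.assoc)
  qed
  have split: "(\<Sum>w\<in>words n. h (take i w) (drop i w)) = (\<Sum>u\<in>words i. \<Sum>v\<in>words (n - i). h u v)"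
    if "i \<le> n" for i and h :: "bool list \<Rightarrow> bool list \<Rightarrow> 'e"
    unfolding sum.cartesian_product
    by (rule sum.reindex_bij_witness[where i = "\<lambda>(u,v). u @ v" and j = "\<lambda>w. (take i w, drop i w)"])
       (use that in auto)
  have "fs_eval a b (f * g) n =
      (\<Sum>w\<in>words n. \<Sum>i\<le>n. iota (bp ^ n * (fs_coeff f (take i w) * fs_coeff g (drop i w))) * word_eval a b (take i w @ drop i w))"
    unfolding fs_eval_def
  proof (rule sum.cong[OF refl])
    fix w assume w: "w \<in> words n"
    have "iota (bp ^ n * fs_coeff (f * g) w) = iota (\<Sum>i\<le>n. bp ^ n * (fs_coeff f (take i w) * fs_coeff g (drop i w)))"
      using w by (simp add: fs_coeff_mult sum_distrib_left)
    also have "\<dots> = (\<Sum>i\<le>n. iota (bp ^ n * (fs_coeff f (take i w) * fs_coeff g (drop i w))))"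
    proof (rule iota_sum)
      fix i assume "i \<in> {..n}"
      then have "(bp ^ i * fs_coeff f (take i w)) * (bp ^ (n - i) * fs_coeff g (drop i w)) \<in> Zloc"
        using w assms by (intro Zloc_mult Zloc_bounded) auto
      moreover have "(bp ^ i * fs_coeff f (take i w)) * (bp ^ (n - i) * fs_coeff g (drop i w)) =
          bp ^ n * (fs_coeff f (take i w) * fs_coeff g (drop i w))"
        using \<open>i \<in> {..n}\<close> power_add[of "bp :: rat" i "n - i"] by simp
      ultimately show "bp ^ n * (fs_coeff f (take i w) * fs_coeff g (drop i w)) \<in> Zloc" by simp
    qed
    finally show "iota (bp ^ n * fs_coeff (f * g) w) * word_eval a b w =
      (\<Sum>i\<le>n. iota (bp ^ n * (fs_coeff f (take i w) * fs_coeff g (drop i w))) * word_eval a b (take i w @ drop i w))"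
      by (simp add: sum_distrib_right)
  qed
  also have "\<dots> = (\<Sum>i\<le>n. \<Sum>u\<in>words i. \<Sum>v\<in>words (n - i).
      iota (bp ^ n * (fs_coeff f u * fs_coeff g v)) * word_eval a b (u @ v))"
    by (subst sum.swap, intro sum.cong refl split) auto
  also have "\<dots> = (\<Sum>i\<le>n. \<Sum>u\<in>words i. \<Sum>v\<in>words (n - i).
      (iota (bp ^ i * fs_coeff f u) * word_eval a b u) * (iota (bp ^ (n - i) * fs_coeff g v) * word_eval a b v))"
    by (intro sum.cong refl summand) auto
  finally show ?thesis
    by (simp add: fs_eval_def sum_product)
qed

lemma psums_fs_eval_mult:
  assumes "fs_bounded f" "fs_bounded g" "psums (fs_eval a b f) s" "psums (fs_eval a b g) t"
  shows "psums (fs_eval a b (f * g)) (s * t)"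
  using psums_product[OF assms(3,4)] unfolding fs_eval_mult[OF assms(1,2), abs_def] .

lemma psums_fs_eval_one: "psums (fs_eval a b 1) 1"
  using psums_finite[of 1 "fs_eval a b 1"] by (simp add: fs_eval_one)

lemma psums_fs_eval_var: "psums (fs_eval a b (fs_var c)) (bp * (if c then a else b))"
  using psums_finite[of 2 "fs_eval a b (fs_var c)"] by (simp add: fs_eval_var numeral_2_eq_2)

lemma psums_fs_eval_diff:
  assumes "fs_bounded f" "fs_bounded g" "psums (fs_eval a b f) s" "psums (fs_eval a b g) t"
  shows "psums (fs_eval a b (f - g)) (s - t)"
  using psums_diff[OF assms(3,4)] unfolding fs_eval_diff[OF assms(1,2), abs_def] .

lemma fs_bounded_power: "fs_bounded f \<Longrightarrow> fs_bounded (f ^ k)"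
  by (induction k) (auto intro: fs_bounded_mult fs_bounded_one)

lemma psums_fs_eval_power:
  assumes "fs_bounded f" "psums (fs_eval a b f) s"
  shows "psums (fs_eval a b (f ^ k)) (s ^ k)"
  by (induction k) (auto intro: psums_fs_eval_mult psums_fs_eval_one fs_bounded_power assms)

text \<open>Puts the value into the form \<open>bp * s\<close>, in which it can be inserted into a
  further series.\<close>

lemma pmult_psums_fs_eval:
  assumes "fs_bounded f" "fs_order_ge 1 f" "psums (fs_eval a b f) s"
  shows "\<exists>s'. s = bp * s'"
proof -
  have "pmult bold_exponent (fs_eval a b f n)" for n
  proof (cases "n = 0")
    case True
    then show ?thesis using assms(2) by (simp add: fs_eval_def)
  next
    case False
    then show ?thesis
      using pmult_mono[OF pmult_fs_eval[OF assms(1)] bold_val_ge] by blast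
  qed
  then have "pmult bold_exponent s"
    using psums_tail[OF assms(3), of 0 bold_exponent 0] by simp
  then show ?thesis by (simp add: pmult_def bold_p_eq)
qed

text \<open>The scalar \<open>g\<close> may have \<open>p\<close> in its denominator and then does
  not act on the ring by itself. Both sides are compared after multiplication by the denominator
  \<open>D\<close>, which is then cancelled.\<close>

lemma psums_series_term:
  assumes f: "fs_bounded f" "fs_order_ge 1 f" "psums (fs_eval a b f) (bp * s)"
    and g: "of_nat p ^ fact_bound k * g \<in> Zloc"
  shows "psums (fs_eval a b (fs_scale g (f ^ k))) (iota (bp ^ k * g) * s ^ k)"
proof -
  have bd: "fs_bounded (fs_scale g (f ^ k))" by (rule fs_bounded_compose_term[OF f(1,2) g])
  then obtain t where t: "psums (fs_eval a b (fs_scale g (f ^ k))) t"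
    using fs_eval_summable by blast
  obtain m D where mD: "quotient_of g = (m, D)" by (cases "quotient_of g")
  then have D: "D > 0" "of_int D * g = of_int m"
    using quotient_of_denom_pos[OF mD] quotient_of_div[OF mD] by auto
  have "of_int D * fs_eval a b (fs_scale g (f ^ k)) n = of_int m * fs_eval a b (f ^ k) n" for n
    unfolding fs_eval_scale[OF bd, symmetric] fs_eval_scale[OF fs_bounded_power[OF f(1)], symmetric]
    by (simp add: D(2))
  then have "psums (\<lambda>n. of_int m * fs_eval a b (f ^ k) n) (of_int D * t)"
    using psums_mult_left[OF t, of "of_int D"] by simp
  moreover have "psums (\<lambda>n. of_int m * fs_eval a b (f ^ k) n) (of_int m * (bp * s) ^ k)"
    by (intro psums_mult_left psums_fs_eval_power f)
  ultimately have "of_int D * t = of_int m * (bp * s) ^ k"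
    by (rule psums_unique)
  also have "\<dots> = of_int m * bp ^ k * s ^ k"
    by (simp add: of_nat_mult_power mult.assoc)
  also have "of_int m * bp ^ k = iota (of_int m * bp ^ k)"
    by (simp only: iota_mult Zloc_of_int Zloc_simps iota_of_int iota_simps)
  also have "of_int m * bp ^ k = of_int D * (bp ^ k * g)"
    by (simp flip: D(2))
  also have "iota \<dots> = of_int D * iota (bp ^ k * g)"
    using Zloc_bp_power(1)[OF g] by (simp add: iota_mult iota_of_int)
  finally have "of_int D * t = of_int D * (iota (bp ^ k * g) * s ^ k)"
    by (simp add: mult.assoc)
  then show ?thesis
    using t D(1) of_int_mult_cancel by fastforce
qed

text \<open>Evaluation sums the composite by word length, the claim by powers of \<open>f\<close>.
  The terms obey one bound independent of \<open>k\<close>, so \<open>psums_exchange\<close>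
  applies.\<close>

lemma psums_fs_compose:
  assumes f: "fs_bounded f" "fs_order_ge 1 f" "psums (fs_eval a b f) (bp * s)"
    and g: "\<And>k. of_nat p ^ fact_bound k * fps_nth g k \<in> Zloc"
    and v: "psums (fs_eval a b (fs_compose g f)) v"
  shows "psums (\<lambda>k. iota (bp ^ k * fps_nth g k) * s ^ k) v"
proof (rule psums_exchange[where e = "\<lambda>k. fs_eval a b (fs_scale (fps_nth g k) (f ^ k))"])
  let ?F = "\<lambda>k. fs_scale (fps_nth g k) (f ^ k)"
  have bd: "fs_bounded (?F k)" for k by (rule fs_bounded_compose_term[OF f(1,2) g])
  have "fs_eval a b (fs_compose g f) n = (\<Sum>k\<le>n. fs_eval a b (?F k) n)" for n
  proof -
    have "fs_eval a b (fs_compose g f) n =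
        (\<Sum>w\<in>words n. iota (\<Sum>k\<le>n. bp ^ n * fs_coeff (?F k) w) * word_eval a b w)"
      unfolding fs_eval_def
      by (intro sum.cong refl) (auto simp: fs_coeff_compose sum_distrib_left)
    also have "\<dots> = (\<Sum>w\<in>words n. \<Sum>k\<le>n. iota (bp ^ n * fs_coeff (?F k) w) * word_eval a b w)"
    proof (rule sum.cong[OF refl])
      fix w assume "w \<in> words n"
      then have "iota (\<Sum>k\<le>n. bp ^ n * fs_coeff (?F k) w) = (\<Sum>k\<le>n. iota (bp ^ n * fs_coeff (?F k) w))"
        by (intro iota_sum Zloc_bounded bd) auto
      then show "iota (\<Sum>k\<le>n. bp ^ n * fs_coeff (?F k) w) * word_eval a b w =
          (\<Sum>k\<le>n. iota (bp ^ n * fs_coeff (?F k) w) * word_eval a b w)"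
        by (simp only: sum_distrib_right)
    qed
    finally show ?thesis
      unfolding fs_eval_def by (subst sum.swap)
  qed
  then show "psums (\<lambda>n. \<Sum>k\<le>n. fs_eval a b (?F k) n) v" using v by presburger
  show "psums (fs_eval a b (?F k)) (iota (bp ^ k * fps_nth g k) * s ^ k)" for k
    by (rule psums_series_term[OF f g])
  show "fs_eval a b (?F k) n = 0" if "n < k" for k n
    using fs_order_ge_power[OF f(2), of k] that by (simp add: fs_eval_def fs_order_ge_def)
  show "\<exists>N. \<forall>n\<ge>N. \<forall>k. pmult K (fs_eval a b (?F k) n)" for K
  proof (intro exI allI impI)
    fix n k assume "n \<ge> 2 * K"
    then show "pmult K (fs_eval a b (?F k) n)"
      by (intro pmult_mono[OF pmult_half_fs_eval[OF bd]]) auto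
  qed
qed


section \<open>The exponential map\<close>

definition exp_term :: "'e \<Rightarrow> nat \<Rightarrow> 'e" where
  "exp_term s k = iota (bp ^ k / fact k) * s ^ k"

text \<open>The exponential of \<open>bp s\<close>.\<close>
definition pexp :: "'e \<Rightarrow> 'e" where
  "pexp s = (THE v. psums (exp_term s) v)"

lemma bp_power_fact: "bp ^ k / fact k \<in> Zloc" "pmult (bold_val k) (iota (bp ^ k / fact k))"
  using Zloc_bp_power[of k "1 / fact k"] Zloc_fact[of k] by simp_all

lemma psums_exp_term: "psums (exp_term s) (pexp s)"
proof -
  have "pnull (exp_term s)"
    unfolding exp_term_def
    by (intro pnull_if_pmult_half pmult_mult_right pmult_mono[OF bp_power_fact(2) bold_val_ge_half])
  then obtain v where "psums (exp_term s) v" using pnull_summable by blast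
  then show ?thesis unfolding pexp_def by (rule theI) (blast intro: psums_unique \<open>psums _ v\<close>)
qed

lemma fact_mult_exp_term: "of_nat (fact k) * exp_term s k = (bp * s) ^ k"
proof -
  have "of_nat (fact k) * iota (bp ^ k / fact k) = iota (of_nat (fact k) * (bp ^ k / fact k))"
    by (rule of_nat_mult_iota[OF bp_power_fact(1)])
  also have "of_nat (fact k) * (bp ^ k / fact k) = (bp ^ k :: rat)" by simp
  finally show ?thesis
    by (simp add: exp_term_def of_nat_mult_power flip: mult.assoc)
qed

lemma pexp_commute:
  assumes "x * s = s * x"
  shows "x * pexp s = pexp s * x"
proof -
  have "x * s ^ k = s ^ k * x" for k
    using assms by (metis power_commuting_commutes)
  then have "x * exp_term s k = exp_term s k * x" for k
    unfolding exp_term_def using iota_commute[OF bp_power_fact(1)] by (metis mult.assoc)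
  then show ?thesis
    using psums_mult_left[OF psums_exp_term, of x s] psums_mult_right[OF psums_exp_term, of s x]
    by (simp add: psums_unique)
qed

lemma pexp_eqI:
  assumes "fs_bounded f" "fs_order_ge 1 f" "psums (fs_eval a b f) (bp * s)"
    and "psums (fs_eval a b (fs_exp f)) v"
  shows "pexp s = v"
proof -
  have "psums (\<lambda>k. iota (bp ^ k * fps_nth (fps_exp 1) k) * s ^ k) v"
    using assms Zloc_exp_coeff[of _ 1] by (intro psums_fs_compose) auto
  then have "psums (exp_term s) v" by (simp add: exp_term_def[abs_def])
  with psums_exp_term show ?thesis by (rule psums_unique)
qed

lemma psums_fs_exp:
  assumes "fs_bounded f" "fs_order_ge 1 f" "psums (fs_eval a b f) (bp * s)"
  shows "psums (fs_eval a b (fs_exp f)) (pexp s)"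
  using fs_eval_summable[OF fs_bounded_exp[OF assms(1,2)]] pexp_eqI[OF assms] by metis

lemma psums_fs_exp_var: "psums (fs_eval a b (fs_exp (fs_var c))) (pexp (if c then a else b))"
  by (rule psums_fs_exp[OF fs_bounded_var fs_order_ge_var psums_fs_eval_var])

lemma fs_bounded_exp_var: "fs_bounded (fs_exp (fs_var c))"
  by (rule fs_bounded_exp[OF fs_bounded_var fs_order_ge_var])

text \<open>The formal identity \<open>fs_exp_bch\<close> is evaluated in two ways, as the
  exponential of a series and as a product.\<close>

lemma pexp_bch: "\<exists>h. psums (fs_eval a b fs_bch) (bp * h) \<and> pexp h = pexp a * pexp b"
proof -
  obtain h where h: "psums (fs_eval a b fs_bch) (bp * h)"
    using fs_eval_summable[OF fs_bounded_bch] pmult_psums_fs_eval[OF fs_bounded_bch fs_order_ge_bch] by metis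
  have "psums (fs_eval a b (fs_exp fs_bch)) (pexp a * pexp b)"
    unfolding fs_exp_bch
    using psums_fs_eval_mult[OF fs_bounded_exp_var fs_bounded_exp_var psums_fs_exp_var[of a b True] psums_fs_exp_var[of a b False]]
    by simp
  then have "pexp h = pexp a * pexp b"
    by (rule pexp_eqI[OF fs_bounded_bch fs_order_ge_bch h])
  with h show ?thesis by blast
qed

lemma pexp_eq_one_plus: "\<exists>u. pexp s = 1 + bp * u"
proof -
  have "pmult bold_exponent (exp_term s k)" if "k \<ge> 1" for k
    unfolding exp_term_def using that
    by (intro pmult_mult_right pmult_mono[OF bp_power_fact(2) bold_val_ge]) auto
  then have "pmult bold_exponent (pexp s - (\<Sum>k<1. exp_term s k))"
    by (rule psums_tail[OF psums_exp_term]) auto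
  then show ?thesis
    by (auto simp: pmult_def exp_term_def bold_p_eq algebra_simps)
qed

text \<open>log (exp x) = x holds formally, and the evaluated logarithm series depends on
  \<open>x\<close> only through \<open>pexp x\<close>.\<close>

lemma pexp_inj:
  assumes "pexp a = pexp a'"
  shows "a = a'"
proof -
  let ?f = "fs_exp (fs_var True) - 1"
  have bd: "fs_bounded ?f" by (intro fs_bounded_diff fs_bounded_exp_var fs_bounded_one)
  have ord: "fs_order_ge 1 ?f" by (simp add: fs_coeff_one)
  have ln: "fs_compose (fps_ln 1) ?f = fs_var True" by (rule fs_ln_exp) simp
  have sums: "psums (fs_eval x x ?f) (pexp x - 1)" for x
    using psums_fs_eval_diff[OF fs_bounded_exp_var fs_bounded_one psums_fs_exp_var[of x x True] psums_fs_eval_one]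
    by simp
  obtain s where s: "pexp a - 1 = bp * s"
    using pmult_psums_fs_eval[OF bd ord sums] by blast
  have "psums (\<lambda>k. iota (bp ^ k * fps_nth (fps_ln 1) k) * s ^ k) (bp * x)" if "pexp x = pexp a" for x
  proof (rule psums_fs_compose[OF bd ord _ Zloc_ln_coeff])
    show "psums (fs_eval x x ?f) (bp * s)" using sums[of x] that s by simp
    show "psums (fs_eval x x (fs_compose (fps_ln 1) ?f)) (bp * x)"
      unfolding ln using psums_fs_eval_var[of x x True] by simp
  qed
  from this[OF refl] this[OF assms[symmetric]] have "bp * a = bp * a'"
    by (rule psums_unique)
  then show ?thesis by (rule of_nat_mult_cancel[OF _ bp_gt_0])
qed

text \<open>The witness is the logarithm of \<open>1 + bp * u\<close> divided by \<open>bp\<close>,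
  obtained from a series in a single letter evaluated at \<open>u\<close>.\<close>

lemma pexp_surj: "\<exists>c. pexp c = 1 + bp * u"
proof -
  let ?f = "fs_compose (fps_ln 1) (fs_var True)"
  have bd: "fs_bounded ?f" by (intro fs_bounded_compose fs_bounded_var fs_order_ge_var Zloc_ln_coeff)
  have ord: "fs_order_ge 1 ?f" by (rule fs_order_ge_compose) simp
  obtain c where c: "psums (fs_eval u u ?f) (bp * c)"
    using fs_eval_summable[OF bd] pmult_psums_fs_eval[OF bd ord] by metis
  \<comment> \<open>\<open>1 + x\<close> is written as \<open>x - (0 - 1)\<close> to stay within the
    rules for differences.\<close>
  have "psums (fs_eval u u (fs_var True - (0 - 1))) (bp * u - (0 - 1))"
    using psums_fs_eval_var[of u u True] psums_finite[of 0 "fs_eval u u 0"]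
    by (intro psums_fs_eval_diff fs_bounded_diff fs_bounded_var fs_bounded_one psums_fs_eval_one)
       (auto simp: fs_eval_def fs_bounded_def)
  then have "psums (fs_eval u u (fs_exp ?f)) (1 + bp * u)"
    by (simp add: fs_exp_ln add.commute)
  then show ?thesis using pexp_eqI[OF bd ord c] by blast
qed

text \<open>Two evaluations of exp (n X) = (exp X)^n: the left side as a series with coefficients
  \<open>n ^ k / fact k\<close>, the right side as a power.\<close>

lemma pexp_power: "pexp c ^ n = pexp (of_nat n * c)"
proof -
  have "fs_compose (fps_exp (of_nat n)) (fs_var True) = fs_exp (fs_var True) ^ n"
    by (simp add: fs_compose_power[symmetric] fps_exp_power_mult)
  moreover have "psums (fs_eval c c (fs_exp (fs_var True) ^ n)) (pexp c ^ n)"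
    using psums_fs_eval_power[OF fs_bounded_exp_var psums_fs_exp_var[of c c True]] by simp
  ultimately have "psums (\<lambda>k. iota (bp ^ k * fps_nth (fps_exp (of_nat n)) k) * c ^ k) (pexp c ^ n)"
    using psums_fs_eval_var[of c c True] Zloc_exp_coeff
    by (intro psums_fs_compose[OF fs_bounded_var fs_order_ge_var]) auto
  moreover have "iota (bp ^ k * fps_nth (fps_exp (of_nat n)) k) * c ^ k = exp_term (of_nat n * c) k" for k
  proof -
    have "iota (bp ^ k * fps_nth (fps_exp (of_nat n)) k) = iota (bp ^ k / fact k * of_nat n ^ k)" by simp
    also have "\<dots> = iota (bp ^ k / fact k) * of_nat n ^ k"
      by (simp only: iota_mult[OF bp_power_fact(1) Zloc_simps(4)] iota_simps)
    finally show ?thesis by (simp add: exp_term_def of_nat_mult_power mult.assoc)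
  qed
  then have "(\<lambda>k. iota (bp ^ k * fps_nth (fps_exp (of_nat n)) k) * c ^ k) = exp_term (of_nat n * c)" by blast
  ultimately have "psums (exp_term (of_nat n * c)) (pexp c ^ n)" by metis
  then show ?thesis using psums_exp_term by (rule psums_unique)
qed

text \<open>Terms of degree \<open>n \<ge> 2\<close> carry \<open>p ^ (k * n)\<close>. With
  \<open>pexp_power\<close> this exhibits \<open>bp * c\<close> as the limit of difference quotients
  of powers of \<open>pexp c\<close>.\<close>

lemma pexp_linear: "pmult (2 * k) (pexp (of_nat p ^ k * c) - 1 - bp * (of_nat p ^ k * c))"
proof -
  have "pmult (2 * k) (exp_term (of_nat p ^ k * c) n)" if "n \<ge> 2" for n
  proof -
    have "exp_term (of_nat p ^ k * c) n = iota (bp ^ n / fact n) * (of_nat p ^ (k * n) * c ^ n)"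
      using of_nat_mult_power[of "p ^ k" c n] by (simp add: exp_term_def power_mult)
    moreover have "pmult (2 * k) (of_nat p ^ (k * n) * c ^ n)"
      using that by (intro pmult_mono[OF pmultI]) auto
    ultimately show ?thesis by (simp add: pmult_mult_left)
  qed
  then have "pmult (2 * k) (pexp (of_nat p ^ k * c) - (\<Sum>n<2. exp_term (of_nat p ^ k * c) n))"
    by (rule psums_tail[OF psums_exp_term]) auto
  then show ?thesis by (simp add: exp_term_def numeral_2_eq_2 algebra_simps)
qed


section \<open>Evaluation of Lie polynomials\<close>

lemma fs_bounded_lie_monomial: "fs_bounded (fs_lie_monomial t)"
  by (induction t) (auto intro: fs_bounded_var fs_bounded_diff fs_bounded_mult)

lemma psums_lie_monomial:
  "psums (fs_eval a b (fs_lie_monomial t)) (lie_monomial_eval ad (bp * a) (bp * b) t)"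
proof (induction t)
  case (Lie_Var c)
  then show ?case using psums_fs_eval_var[of a b c] by (cases c) simp_all
next
  case (Lie_Bracket s t)
  then show ?case
    unfolding fs_lie_monomial.simps lie_monomial_eval.simps ad_def
    by (intro psums_fs_eval_diff psums_fs_eval_mult fs_bounded_mult fs_bounded_lie_monomial)
qed

text \<open>\<open>D\<close> clears the denominators of \<open>P\<close>, which may be divisible by
  \<open>p\<close>, so that integers act on the ring in place of rationals.\<close>

lemma psums_lie_polynomial:
  assumes "\<And>q t. (q, t) \<in> set P \<Longrightarrow> of_int D * q \<in> \<int>"
  shows "fs_bounded (fs_scale (of_int D) (fs_lie_polynomial P)) \<and>
    psums (fs_eval a b (fs_scale (of_int D) (fs_lie_polynomial P)))
      (\<Sum>(q, t)\<leftarrow>P. of_int \<lfloor>of_int D * q\<rfloor> * lie_monomial_eval ad (bp * a) (bp * b) t)"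
  using assms
proof (induction P)
  case Nil
  have "fs_bounded 0" "fs_eval a b 0 = (\<lambda>_. 0)" by (auto simp: fs_bounded_def fs_eval_def)
  then show ?case
    using psums_finite[of 0 "fs_eval a b 0"] by (simp add: fs_lie_polynomial_def)
next
  case (Cons x P)
  obtain q t where x: "x = (q, t)" by (cases x)
  define z where "z = \<lfloor>of_int D * q\<rfloor>"
  have z: "of_int D * q = of_int z"
    using Cons.prems[of q t] x by (simp add: z_def)
  let ?Q = "fs_scale (of_int D) (fs_lie_polynomial P)"
  have IH: "fs_bounded ?Q" "psums (fs_eval a b ?Q)
      (\<Sum>(q, t)\<leftarrow>P. of_int \<lfloor>of_int D * q\<rfloor> * lie_monomial_eval ad (bp * a) (bp * b) t)" (is "psums _ ?s")
    using Cons by auto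
  have b: "fs_bounded (fs_scale (of_int (- z)) (fs_lie_monomial t))"
    using fs_bounded_lie_monomial[of t] Zloc_mult[OF Zloc_of_int[of "-z"]]
    by (simp only: fs_bounded_def fs_coeff_simps mult.left_commute[of _ "of_int _"] simp_thms)
  have e: "fs_scale (of_int D) (fs_lie_polynomial (x # P)) = ?Q - fs_scale (of_int (- z)) (fs_lie_monomial t)"
    by (simp add: fs_lie_polynomial_def x fs_scale_distrib z add.commute)
  have "psums (fs_eval a b (fs_scale (of_int (- z)) (fs_lie_monomial t)))
      (of_int (- z) * lie_monomial_eval ad (bp * a) (bp * b) t)"
    unfolding fs_eval_scale[OF fs_bounded_lie_monomial, abs_def]
    by (rule psums_mult_left[OF psums_lie_monomial])
  then have "psums (fs_eval a b (?Q - fs_scale (of_int (- z)) (fs_lie_monomial t)))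
      (?s - of_int (- z) * lie_monomial_eval ad (bp * a) (bp * b) t)"
    by (rule psums_fs_eval_diff[OF IH(1) b IH(2)])
  then show ?case
    unfolding e using fs_bounded_diff[OF IH(1) b] by (simp add: x z_def add.commute)
qed

definition bch_partial_polynomial :: "nat \<Rightarrow> lie_polynomial" where
  "bch_partial_polynomial N = concat (map bch_lie [1..<Suc N])"

lemma fs_coeff_bch_partial:
  "fs_coeff (fs_lie_polynomial (bch_partial_polynomial N)) w = (if length w \<le> N then bch w else 0)"
proof (induction N)
  case 0
  have "bch [] = 0" using fs_order_ge_bch by (simp add: fs_coeff_bch)
  then show ?case by (simp add: bch_partial_polynomial_def fs_lie_polynomial_def)
next
  case (Suc N)
  have "fs_lie_polynomial (bch_partial_polynomial (Suc N)) =
      fs_lie_polynomial (bch_partial_polynomial N) + fs_lie_polynomial (bch_lie (Suc N))"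
    by (simp add: bch_partial_polynomial_def fs_lie_polynomial_def)
  then show ?case
    using Suc nc_of_bch_lie[of "Suc N"] by (auto simp: fs_coeff_lie_polynomial bch_hom_def)
qed

lemma common_denominator:
  "\<exists>D::int. D > 0 \<and> (\<forall>(q, t)\<in>set (P :: (rat \<times> 'z) list). of_int D * q \<in> \<int>)"
proof (induction P)
  case (Cons x P)
  then obtain D :: int where D: "D > 0" "\<forall>(q, t)\<in>set P. of_int D * q \<in> \<int>" by blast
  obtain m d where md: "quotient_of (fst x) = (m, d)" by (cases "quotient_of (fst x)")
  then have d: "d > 0" "of_int d * fst x = of_int m"
    using quotient_of_denom_pos[OF md] quotient_of_div[OF md] by auto
  have "of_int (D * d) * q \<in> \<int>" if "(q, t) \<in> set (x # P)" for q t
  proof (cases "(q, t) = x")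
    case True
    then have "of_int (D * d) * q = of_int (D * m)" using d(2) by (auto simp: mult.assoc)
    then show ?thesis by (metis Ints_of_int)
  next
    case False
    then have "of_int D * q \<in> \<int>" using D(2) that by auto
    then have "of_int d * (of_int D * q) \<in> \<int>" by (rule Ints_mult[OF Ints_of_int])
    then show ?thesis by (simp add: mult_ac)
  qed
  then show ?case using D(1) d(1) by (intro exI[of _ "D * d"]) auto
qed (auto intro: exI[of _ 1])

text \<open>The same truncated series is summed twice, by word length and by Lie monomials;
  uniqueness of sums identifies the results.\<close>

lemma bch_partial_sum_eval:
  assumes D: "\<And>q t. (q, t) \<in> set (bch_partial_polynomial N) \<Longrightarrow> of_int D * q \<in> \<int>"
  shows "of_int D * (\<Sum>n\<le>N. fs_eval a b fs_bch n) =
    (\<Sum>(q, t)\<leftarrow>bch_partial_polynomial N. of_int \<lfloor>of_int D * q\<rfloor> * lie_monomial_eval ad (bp * a) (bp * b) t)"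
proof -
  let ?P = "fs_scale (of_int D) (fs_lie_polynomial (bch_partial_polynomial N))"
  have "fs_eval a b ?P n = (if n \<le> N then of_int D * fs_eval a b fs_bch n else 0)" for n
  proof (cases "n \<le> N")
    case True
    then have "fs_eval a b ?P n = fs_eval a b (fs_scale (of_int D) fs_bch) n"
      unfolding fs_eval_def by (intro sum.cong) (auto simp: fs_coeff_bch_partial fs_coeff_bch)
    then show ?thesis using True fs_eval_scale[OF fs_bounded_bch] by simp
  qed (simp add: fs_eval_def fs_coeff_bch_partial)
  then have "psums (fs_eval a b ?P) (\<Sum>n<Suc N. of_int D * fs_eval a b fs_bch n)"
    using psums_finite[of "Suc N" "fs_eval a b ?P"] by simp
  then show ?thesis
    unfolding sum_distrib_left lessThan_Suc_atMost
    by (rule psums_unique[OF _ psums_lie_polynomial[THEN conjunct2]]) (use D in auto)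
qed

end


section \<open>Multivariate power series and their evaluation\<close>

lemma mps_coeff_simps [simp]:
  "mps_coeff 0 l = 0" "mps_coeff (f + g) l = mps_coeff f l + mps_coeff g l"
  "mps_coeff (f - g) l = mps_coeff f l - mps_coeff g l" "mps_coeff (- f) l = - mps_coeff f l"
  by (simp_all add: zero_mps_def plus_mps_def minus_mps_def uminus_mps_def)

lemma mps_coeff_sum [simp]: "mps_coeff (sum f A) l = (\<Sum>x\<in>A. mps_coeff (f x) l)"
  by (induction A rule: infinite_finite_induct) auto

lemma mps_coeff_mult: "mps_coeff (f * g) k = (\<Sum>l\<in>{..k}. mps_coeff f l * mps_coeff g (k - l))"
  by (simp add: times_mps_def)

lemma mps_coeff_const: "mps_coeff (mps_const r) l = (if l = 0 then r else 0)"
  by (simp add: mps_const_def)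

lemma mps_coeff_const_mult [simp]: "mps_coeff (mps_const r * f) l = r * mps_coeff f l"
proof -
  have "mps_coeff (mps_const r * f) l = (\<Sum>k\<in>{..l}. if k = 0 then r * mps_coeff f l else 0)"
    unfolding mps_coeff_mult by (rule sum.cong) (auto simp: mps_coeff_const fun_diff_def)
  then show ?thesis by (simp add: sum.delta le_fun_def)
qed

lemma mps_const_hom:
  "mps_const 1 = 1" "mps_const 0 = 0" "mps_const (a + b) = mps_const a + mps_const b" "mps_const (a * b) = mps_const a * mps_const b"
  by (rule mps_eqI; simp add: mps_coeff_const one_mps_def)+

lemma mps_const_of_nat: "mps_const (of_nat n) = of_nat n"
  by (induction n) (simp_all add: mps_const_hom)

lemma mps_coeff_of_nat_mult [simp]: "mps_coeff (of_nat n * f) l = of_nat n * mps_coeff f l"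
  by (simp flip: mps_const_of_nat)

lemma mps_coeff_of_nat_power_mult [simp]: "mps_coeff (of_nat n ^ k * f) l = of_nat n ^ k * mps_coeff f l"
  using mps_coeff_of_nat_mult[of "n ^ k" f l] by simp

definition unit_exp :: "'v \<Rightarrow> 'v \<Rightarrow> nat" where
  "unit_exp i = (\<lambda>j. if j = i then 1 else 0)"

lemma mps_coeff_var: "mps_coeff (mps_var i) l = (if l = unit_exp i then 1 else 0)"
  by (simp add: mps_var_def unit_exp_def)

lemma mdeg_0 [simp]: "mdeg 0 = 0"
  by (simp add: mdeg_def)

lemma mdeg_add [simp]: "mdeg (l + k) = mdeg l + mdeg k"
  by (simp add: mdeg_def sum.distrib)

lemma mdeg_unit_exp [simp]: "mdeg (unit_exp i) = 1"
  by (simp add: mdeg_def unit_exp_def)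

lemma mdeg_eq_0_iff [simp]: "mdeg l = 0 \<longleftrightarrow> l = 0"
  by (auto simp: mdeg_def fun_eq_iff)

lemma mdeg_diff: "k \<le> l \<Longrightarrow> mdeg k + mdeg (l - k) = mdeg l"
  by (simp add: monomial_diff_add flip: mdeg_add)

lemma finite_mdeg_le [simp]: "finite {l :: 'v::finite \<Rightarrow> nat. mdeg l \<le> n}"
proof (rule finite_subset)
  show "{l :: 'v \<Rightarrow> nat. mdeg l \<le> n} \<subseteq> {..\<lambda>_. n}"
  proof (clarsimp simp: le_fun_def)
    fix l :: "'v \<Rightarrow> nat" and i
    assume "mdeg l \<le> n"
    moreover have "l i \<le> mdeg l" unfolding mdeg_def by (rule member_le_sum) auto
    ultimately show "l i \<le> n" by simp
  qed
qed simp

lemma finite_mdeg_less [simp]: "finite {l :: 'v::finite \<Rightarrow> nat. mdeg l < n}"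
  by (rule finite_subset[OF _ finite_mdeg_le[of n]]) auto

lemma monomial_split:
  fixes l :: "'v \<Rightarrow> nat"
  assumes "l i > 0"
  shows "l = unit_exp i + (l - unit_exp i)"
  using assms by (auto simp: fun_eq_iff unit_exp_def)

lemma monomial_induct [case_names zero add]:
  fixes l :: "'v::finite \<Rightarrow> nat"
  assumes "P 0" and "\<And>i l. P l \<Longrightarrow> P (unit_exp i + l)"
  shows "P l"
proof (induction "mdeg l" arbitrary: l)
  case 0
  then show "P l" using assms(1) by simp
next
  case (Suc n)
  then obtain i where i: "l i > 0"
    by (metis mdeg_eq_0_iff fun_eq_iff zero_fun_apply gr0I nat.distinct(1))
  then have l: "l = unit_exp i + (l - unit_exp i)" by (rule monomial_split)
  then have "mdeg (l - unit_exp i) = n"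
    using Suc(2) by (metis mdeg_add mdeg_unit_exp add_left_cancel plus_1_eq_Suc)
  then show "P l" using assms(2) Suc(1) l by metis
qed

definition mono_eval :: "('v::finite \<Rightarrow> 'b::comm_ring_1) \<Rightarrow> ('v \<Rightarrow> nat) \<Rightarrow> 'b" where
  "mono_eval b l = (\<Prod>i\<in>UNIV. b i ^ l i)"

lemma mono_eval_0 [simp]: "mono_eval b 0 = 1"
  by (simp add: mono_eval_def)

lemma mono_eval_add: "mono_eval b (l + k) = mono_eval b l * mono_eval b k"
  by (simp add: mono_eval_def power_add prod.distrib)

lemma mono_eval_unit_exp [simp]: "mono_eval b (unit_exp i) = b i"
proof -
  have "mono_eval b (unit_exp i) = (\<Prod>j\<in>UNIV. if j = i then b i else 1)"
    unfolding mono_eval_def by (rule prod.cong) (auto simp: unit_exp_def)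
  then show ?thesis by simp
qed

lemma mps_coeff_var_mult:
  "mps_coeff (mps_var i * g) l = (if l i > 0 then mps_coeff g (l - unit_exp i) else 0)"
proof -
  have "mps_coeff (mps_var i * g) l = (\<Sum>k\<in>{..l}. if k = unit_exp i then mps_coeff g (l - unit_exp i) else 0)"
    unfolding mps_coeff_mult by (rule sum.cong) (auto simp: mps_coeff_var)
  also have "\<dots> = (if unit_exp i \<le> l then mps_coeff g (l - unit_exp i) else 0)"
    by (simp add: sum.delta)
  also have "unit_exp i \<le> l \<longleftrightarrow> l i > 0"
    by (force simp: le_fun_def unit_exp_def)
  finally show ?thesis .
qed

lemma mps_coeff_mono_eval_var:
  fixes l :: "'v::finite \<Rightarrow> nat"
  shows "mps_coeff (mono_eval mps_var l :: ('a::comm_ring_1, 'v) mps) k = (if k = l then 1 else 0)"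
proof (induction l arbitrary: k rule: monomial_induct)
  case zero
  show "mps_coeff (mono_eval mps_var 0 :: ('a, 'v) mps) k = (if k = 0 then 1 else 0)"
    by (simp add: one_mps_def)
next
  case (add i l)
  have "k = unit_exp i + l \<longleftrightarrow> k i > 0 \<and> k - unit_exp i = l"
    using monomial_split[of k i] by (auto simp: monomial_add_diff) (simp add: unit_exp_def)
  moreover have "mps_coeff (mono_eval mps_var l :: ('a, 'v) mps) j = (if j = l then 1 else 0)" for j
    by (rule add)
  ultimately show "mps_coeff (mono_eval mps_var (unit_exp i + l) :: ('a, 'v) mps) k = (if k = unit_exp i + l then 1 else 0)"
    by (auto simp: mono_eval_add mps_coeff_var_mult)
qed

section \<open>Order and truncation of power series\<close>

definition mps_order_ge :: "nat \<Rightarrow> ('a::comm_ring_1, 'v::finite) mps set" where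
  "mps_order_ge n = {f. \<forall>l. mdeg l < n \<longrightarrow> mps_coeff f l = 0}"

text \<open>Every monomial of positive degree is assigned to one of its variables by the choice
  \<open>s\<close>; \<open>g i\<close> collects those assigned to \<open>i\<close>, divided by that
  variable.\<close>

lemma mps_order_ge_decompose:
  assumes "f \<in> mps_order_ge (Suc n)"
  shows "\<exists>g. (\<forall>i. g i \<in> mps_order_ge n) \<and> f = (\<Sum>i\<in>UNIV. mps_var i * g i)"
proof -
  obtain s where s: "\<And>l::'b \<Rightarrow> nat. l \<noteq> 0 \<Longrightarrow> l (s l) > 0"
    by (metis fun_eq_iff zero_fun_apply gr0I)
  define g where "g i = Abs_mps (\<lambda>k. if s (unit_exp i + k) = i then mps_coeff f (unit_exp i + k) else 0)" for i
  have "mps_coeff f l = mps_coeff (\<Sum>i\<in>UNIV. mps_var i * g i) l" for l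
  proof (cases "l = 0")
    case True
    then show ?thesis using assms by (simp add: mps_coeff_var_mult mps_order_ge_def)
  next
    case False
    have "mps_coeff (mps_var i * g i) l = (if i = s l then mps_coeff f l else 0)" for i
      using s[OF False] monomial_split[of l i] by (auto simp: mps_coeff_var_mult g_def)
    then show ?thesis by simp
  qed
  then have "f = (\<Sum>i\<in>UNIV. mps_var i * g i)" by (rule mps_eqI)
  moreover have "g i \<in> mps_order_ge n" for i
    using assms by (auto simp: g_def mps_order_ge_def)
  ultimately show ?thesis by blast
qed

definition mps_trunc :: "nat \<Rightarrow> ('a::comm_ring_1, 'v::finite) mps \<Rightarrow> ('a, 'v) mps" where
  "mps_trunc n f = (\<Sum>l | mdeg l < n. mps_const (mps_coeff f l) * mono_eval mps_var l)"

lemma mps_coeff_trunc: "mps_coeff (mps_trunc n f) l = (if mdeg l < n then mps_coeff f l else 0)"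
  by (simp add: mps_trunc_def mps_coeff_mono_eval_var if_distrib[of "\<lambda>x. _ * x"] sum.delta cong: if_cong)

lemma mps_trunc_diff: "f - mps_trunc n f \<in> mps_order_ge n"
  by (simp add: mps_order_ge_def mps_coeff_trunc)

section \<open>Filtered rings\<close>

locale filtered_ring =
  fixes I :: "nat \<Rightarrow> 'b::comm_ring_1 set"
  assumes I_0: "I 0 = UNIV" and I_Suc: "I (Suc n) \<subseteq> I n" and I_zero: "0 \<in> I n"
    and I_add: "x \<in> I n \<Longrightarrow> y \<in> I n \<Longrightarrow> x + y \<in> I n"
    and I_mult: "x \<in> I m \<Longrightarrow> y \<in> I n \<Longrightarrow> x * y \<in> I (m + n)"
begin

lemma I_mult_left: "y \<in> I n \<Longrightarrow> x * y \<in> I n"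
  using I_mult[of x 0 y n] by (simp add: I_0)

lemma I_mult_right: "x \<in> I n \<Longrightarrow> x * y \<in> I n"
  using I_mult_left[of x n y] by (simp add: mult.commute)

lemma I_uminus: "x \<in> I n \<Longrightarrow> - x \<in> I n"
  using I_mult_left[of x n "-1"] by simp

lemma I_diff: "x \<in> I n \<Longrightarrow> y \<in> I n \<Longrightarrow> x - y \<in> I n"
  using I_add[of x n "- y"] I_uminus[of y n] by simp

lemma I_minus_commute: "x - y \<in> I n \<Longrightarrow> y - x \<in> I n"
  using I_uminus[of "x - y"] by simp

lemma I_trans: "x - y \<in> I n \<Longrightarrow> y - z \<in> I n \<Longrightarrow> x - z \<in> I n"
  using I_add[of "x - y" n "y - z"] by simp

lemma I_antimono: "m \<le> n \<Longrightarrow> x \<in> I n \<Longrightarrow> x \<in> I m"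
  by (induction n rule: dec_induct) (use I_Suc in auto)

lemma I_sum: "(\<And>i. i \<in> A \<Longrightarrow> f i \<in> I n) \<Longrightarrow> sum f A \<in> I n"
  by (induction A rule: infinite_finite_induct) (auto intro: I_add I_zero)

lemma mono_eval_in_I:
  assumes "range b \<subseteq> I 1"
  shows "mono_eval b l \<in> I (mdeg l)"
proof (induction l rule: monomial_induct)
  case zero
  show "mono_eval b 0 \<in> I (mdeg 0)" by (simp add: I_0)
next
  case (add i l)
  show "mono_eval b (unit_exp i + l) \<in> I (mdeg (unit_exp i + l))"
    using I_mult[OF _ add, of "b i" 1] assms by (auto simp: mono_eval_add)
qed

lemma mono_eval_diff_in_I:
  assumes "\<forall>i. b i - b' i \<in> I k"
  shows "mono_eval b l - mono_eval b' l \<in> I k"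
proof (induction l rule: monomial_induct)
  case (add i l)
  have "mono_eval b (unit_exp i + l) - mono_eval b' (unit_exp i + l) =
      b i * (mono_eval b l - mono_eval b' l) + (b i - b' i) * mono_eval b' l"
    by (simp add: mono_eval_add algebra_simps)
  then show "mono_eval b (unit_exp i + l) - mono_eval b' (unit_exp i + l) \<in> I k"
    using add assms by (simp add: I_add I_mult_left I_mult_right)
next
  case zero
  show "mono_eval b 0 - mono_eval b' 0 \<in> I k" by (simp add: I_zero)
qed

text \<open>Telescoping replaces one factor of the monomial by \<open>q * t i\<close>, where nothing
  is known about the size of \<open>t i\<close>; the quotient therefore keeps all but one degree,
  enough for the series of quotients to converge.\<close>

lemma mono_eval_diff_factor:
  assumes b: "range b \<subseteq> I 1" and b': "range b' \<subseteq> I 1" and t: "\<forall>i. b i - b' i = q * t i"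
  shows "\<exists>s \<in> I (mdeg l - 1). mono_eval b l - mono_eval b' l = q * s"
proof (induction l rule: monomial_induct)
  case zero
  show "\<exists>s \<in> I (mdeg 0 - 1). mono_eval b 0 - mono_eval b' 0 = q * s"
    by (rule bexI[of _ 0]) (auto simp: I_zero)
next
  case (add i l)
  then obtain s where s: "s \<in> I (mdeg l - 1)" "mono_eval b l - mono_eval b' l = q * s" by blast
  have "b i * s \<in> I (mdeg l)"
  proof (cases "mdeg l = 0")
    case False
    then have "1 + (mdeg l - 1) = mdeg l" by linarith
    then show ?thesis using I_mult[OF _ s(1), of "b i" 1] b by (metis rangeI subsetD)
  qed (simp add: I_0)
  moreover have "t i * mono_eval b' l \<in> I (mdeg l)"
    by (rule I_mult_left[OF mono_eval_in_I[OF b']])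
  moreover have "mono_eval b (unit_exp i + l) - mono_eval b' (unit_exp i + l) =
      b i * (mono_eval b l - mono_eval b' l) + (b i - b' i) * mono_eval b' l"
    by (simp add: mono_eval_add algebra_simps)
  ultimately show "\<exists>s \<in> I (mdeg (unit_exp i + l) - 1).
      mono_eval b (unit_exp i + l) - mono_eval b' (unit_exp i + l) = q * s"
    by (intro bexI[of _ "b i * s + t i * mono_eval b' l"]) (auto simp: s(2) t algebra_simps intro: I_add)
qed

end

text \<open>Covers two cases: values at points of the maximal ideal, with \<open>c\<close> the
  identity, and substitution into power series, with \<open>c = mps_const\<close>.\<close>

locale eval_ring = filtered_ring I
  for I :: "nat \<Rightarrow> 'b::comm_ring_1 set" and c :: "'a::comm_ring_1 \<Rightarrow> 'b" +
  assumes c_one: "c 1 = 1" and c_add: "c (x + y) = c x + c y" and c_mult: "c (x * y) = c x * c y"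
    and I_separated: "(\<And>n. z \<in> I n) \<Longrightarrow> z = 0"
    and I_complete: "(\<And>n. s (Suc n) - s n \<in> I n) \<Longrightarrow> \<exists>l. \<forall>n. l - s n \<in> I n"
begin

lemma c_zero: "c 0 = 0"
  using c_add[of 0 0] by simp

lemma c_sum: "c (sum f A) = (\<Sum>x\<in>A. c (f x))"
  by (induction A rule: infinite_finite_induct) (auto simp: c_zero c_add)

definition part :: "('v::finite \<Rightarrow> 'b) \<Rightarrow> ('a, 'v) mps \<Rightarrow> nat \<Rightarrow> 'b" where
  "part b f n = (\<Sum>l | mdeg l < n. c (mps_coeff f l) * mono_eval b l)"

definition peval :: "('v::finite \<Rightarrow> 'b) \<Rightarrow> ('a, 'v) mps \<Rightarrow> 'b" where
  "peval b f = (THE s. \<forall>n. s - part b f n \<in> I n)"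

lemma eqI_mod: "(\<And>n. x - y \<in> I n) \<Longrightarrow> x = y"
  using I_separated[of "x - y"] by simp

lemma limit_unique: "\<forall>n. s - f n \<in> I n \<Longrightarrow> \<forall>n. t - f n \<in> I n \<Longrightarrow> s = t"
  by (rule eqI_mod) (meson I_trans I_minus_commute)

lemma part_Suc_diff:
  fixes f :: "('a, 'v::finite) mps"
  assumes "\<And>l. mdeg l = n \<Longrightarrow> u l \<in> I k"
  shows "(\<Sum>l | mdeg l < Suc n. c (mps_coeff f l) * u l) - (\<Sum>l | mdeg l < n. c (mps_coeff f l) * u l) \<in> I k"
proof -
  have un: "{l. mdeg l < Suc n} = {l. mdeg l < n} \<union> {l::'v \<Rightarrow> nat. mdeg l = n}" by auto
  have fin: "finite {l::'v \<Rightarrow> nat. mdeg l = n}"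
    by (rule finite_subset[OF _ finite_mdeg_le[of n]]) auto
  have "(\<Sum>l | mdeg l < Suc n. c (mps_coeff f l) * u l) =
      (\<Sum>l | mdeg l < n. c (mps_coeff f l) * u l) + (\<Sum>l | mdeg l = n. c (mps_coeff f l) * u l)"
    unfolding un by (rule sum.union_disjoint[OF finite_mdeg_less fin]) auto
  then have "(\<Sum>l | mdeg l < Suc n. c (mps_coeff f l) * u l) - (\<Sum>l | mdeg l < n. c (mps_coeff f l) * u l) =
      (\<Sum>l | mdeg l = n. c (mps_coeff f l) * u l)"
    by simp
  also have "\<dots> \<in> I k"
    using assms by (auto intro!: I_sum I_mult_left)
  finally show ?thesis .
qed

lemma peval_eqI: "(\<And>n. s - part b f n \<in> I n) \<Longrightarrow> peval b f = s"
  unfolding peval_def by (rule the_equality) (auto intro: limit_unique)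

lemma peval_part:
  assumes "range b \<subseteq> I 1"
  shows "peval b f - part b f n \<in> I n"
proof -
  have "part b f (Suc n) - part b f n \<in> I n" for n
    unfolding part_def by (rule part_Suc_diff) (use mono_eval_in_I[OF assms] in auto)
  then obtain s where "\<forall>n. s - part b f n \<in> I n"
    using I_complete[of "part b f"] by blast
  then show ?thesis using peval_eqI[of s b f] by auto
qed

lemma peval_add:
  fixes b :: "'v::finite \<Rightarrow> 'b"
  assumes "range b \<subseteq> I 1"
  shows "peval b (f + g) = peval b f + peval b g"
proof (rule peval_eqI)
  fix n
  have "part b (f + g) n = part b f n + part b g n"
    by (simp add: part_def c_add distrib_right sum.distrib)
  then show "peval b f + peval b g - part b (f + g) n \<in> I n"
    using I_add[OF peval_part[OF assms] peval_part[OF assms], of f n g] by (simp add: algebra_simps)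
qed

lemma peval_const:
  fixes b :: "'v::finite \<Rightarrow> 'b"
  shows "peval b (mps_const r) = c r"
proof (rule peval_eqI)
  fix n
  have "part b (mps_const r) n = (\<Sum>l::'v \<Rightarrow> nat | mdeg l < n. if l = 0 then c r else 0)"
    unfolding part_def by (rule sum.cong) (auto simp: mps_coeff_const c_zero)
  then show "c r - part b (mps_const r) n \<in> I n"
    by (cases n) (auto simp: I_0 I_zero)
qed

lemma peval_var:
  fixes b :: "'v::finite \<Rightarrow> 'b"
  assumes "range b \<subseteq> I 1"
  shows "peval b (mps_var i) = b i"
proof (rule peval_eqI)
  fix n
  have "part b (mps_var i) n = (\<Sum>l | mdeg l < n. if l = unit_exp i then b i else 0)"
    unfolding part_def by (rule sum.cong) (auto simp: mps_coeff_var c_zero c_one)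
  then have "part b (mps_var i) n = (if n > 1 then b i else 0)"
    by simp
  then show "b i - part b (mps_var i) n \<in> I n"
    using I_antimono[of n 1 "b i"] assms by (auto simp: I_zero image_subset_iff)
qed

lemma peval_mult:
  fixes b :: "'v::finite \<Rightarrow> 'b"
  assumes b: "range b \<subseteq> I 1"
  shows "peval b (f * g) = peval b f * peval b g"
proof (rule peval_eqI)
  fix n
  let ?h = "\<lambda>(l, k). c (mps_coeff f l) * c (mps_coeff g k) * mono_eval b (l + k)"
  let ?S = "{l::'v \<Rightarrow> nat. mdeg l < n} \<times> {l::'v \<Rightarrow> nat. mdeg l < n}"
    and ?T = "{(l::'v \<Rightarrow> nat, k). mdeg (l + k) < n}"
  have sub: "?T \<subseteq> ?S" by auto
  have fin: "finite ?S" by simp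
  have "part b f n * part b g n = (\<Sum>x\<in>?S. ?h x)"
    by (simp add: part_def sum_product sum.cartesian_product mono_eval_add mult_ac)
  moreover have "part b (f * g) n = (\<Sum>x\<in>?T. ?h x)"
  proof -
    have "part b (f * g) n = (\<Sum>(m, l)\<in>Sigma {m. mdeg m < n} (\<lambda>m. {..m}). c (mps_coeff f l) * c (mps_coeff g (m - l)) * mono_eval b m)"
      by (simp add: part_def mps_coeff_mult c_sum c_mult sum_distrib_right sum.Sigma)
    also have "\<dots> = (\<Sum>x\<in>?T. ?h x)"
      by (rule sum.reindex_bij_witness[where i = "\<lambda>(l, k). (l + k, l)" and j = "\<lambda>(m, l). (l, m - l)"])
         (auto simp: monomial_add_diff monomial_diff_add monomial_le_add mdeg_diff simp del: mdeg_add)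
    finally show ?thesis .
  qed
  moreover have "(\<Sum>x\<in>?S. ?h x) - (\<Sum>x\<in>?T. ?h x) = (\<Sum>x\<in>?S - ?T. ?h x)"
    by (rule sum_diff[OF fin sub, symmetric])
  \<comment> \<open>Pairs outside the triangle give monomials of total degree at least
    \<open>n\<close>.\<close>
  moreover have "(\<Sum>x\<in>?S - ?T. ?h x) \<in> I n"
  proof (rule I_sum)
    fix x assume "x \<in> ?S - ?T"
    then obtain l k where "x = (l, k)" "n \<le> mdeg (l + k)" by (auto simp: not_less)
    then show "?h x \<in> I n"
      using I_antimono[OF _ mono_eval_in_I[OF b]] by (auto intro: I_mult_left simp del: mdeg_add)
  qed
  moreover have "peval b f * peval b g - part b f n * part b g n \<in> I n"
    using I_add[OF I_mult_left[OF peval_part[OF b]] I_mult_right[OF peval_part[OF b]], of "peval b f" g n f "part b g n"]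
    by (simp add: algebra_simps)
  ultimately show "peval b f * peval b g - part b (f * g) n \<in> I n"
    using I_trans by presburger
qed

section \<open>Algebra homomorphisms on power series\<close>

definition alg_hom :: "(('a, 'v::finite) mps \<Rightarrow> 'b) \<Rightarrow> bool" where
  "alg_hom \<phi> \<longleftrightarrow> (\<forall>r. \<phi> (mps_const r) = c r) \<and> (\<forall>f g. \<phi> (f + g) = \<phi> f + \<phi> g) \<and> (\<forall>f g. \<phi> (f * g) = \<phi> f * \<phi> g)"

lemma alg_hom_peval: "range b \<subseteq> I 1 \<Longrightarrow> alg_hom (peval b)"
  by (simp add: alg_hom_def peval_const peval_add peval_mult)

lemma alg_hom_sum:
  assumes "alg_hom \<phi>"
  shows "\<phi> (sum f A) = (\<Sum>x\<in>A. \<phi> (f x))"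
proof -
  have "\<phi> 0 = 0" using assms by (metis alg_hom_def mps_const_hom(2) c_zero)
  then show ?thesis
    using assms by (induction A rule: infinite_finite_induct) (auto simp: alg_hom_def)
qed

lemma alg_hom_mono_eval:
  assumes "alg_hom \<phi>"
  shows "\<phi> (mono_eval mps_var l) = mono_eval (\<lambda>i. \<phi> (mps_var i)) l"
proof -
  have "\<phi> 1 = 1" using assms by (metis alg_hom_def mps_const_hom(1) c_one)
  show ?thesis
  proof (induction l rule: monomial_induct)
    case zero
    show "\<phi> (mono_eval mps_var 0) = mono_eval (\<lambda>i. \<phi> (mps_var i)) 0" using \<open>\<phi> 1 = 1\<close> by simp
  next
    case (add i l)
    then show "\<phi> (mono_eval mps_var (unit_exp i + l)) = mono_eval (\<lambda>i. \<phi> (mps_var i)) (unit_exp i + l)"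
      using assms by (simp add: mono_eval_add alg_hom_def)
  qed
qed

lemma alg_hom_trunc:
  assumes "alg_hom \<phi>"
  shows "\<phi> (mps_trunc n f) = part (\<lambda>i. \<phi> (mps_var i)) f n"
proof -
  have "\<phi> (mps_const r * g) = c r * \<phi> g" for r g
    using assms by (simp add: alg_hom_def)
  then show ?thesis
    unfolding mps_trunc_def alg_hom_sum[OF assms] part_def by (simp add: alg_hom_mono_eval[OF assms])
qed

lemma alg_hom_order_ge:
  assumes "alg_hom \<phi>" "range (\<lambda>i. \<phi> (mps_var i)) \<subseteq> I 1" "f \<in> mps_order_ge n"
  shows "\<phi> f \<in> I n"
  using assms(3)
proof (induction n arbitrary: f)
  case (Suc n)
  then obtain g where g: "\<And>i. g i \<in> mps_order_ge n" "f = (\<Sum>i\<in>UNIV. mps_var i * g i)"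
    using mps_order_ge_decompose by metis
  have "\<phi> f = (\<Sum>i\<in>UNIV. \<phi> (mps_var i) * \<phi> (g i))"
    unfolding g(2) alg_hom_sum[OF assms(1)] using assms(1) by (simp add: alg_hom_def)
  also have "\<dots> \<in> I (Suc n)"
    using I_mult[OF _ Suc.IH[OF g(1)], of _ 1] assms(2) by (auto intro!: I_sum simp: image_subset_iff)
  finally show ?case .
qed (simp add: I_0)

text \<open>No continuity has to be assumed, since a series of order \<open>n\<close> is a finite combination of
  products of \<open>n\<close> variables with series.\<close>
lemma alg_hom_unique:
  assumes "alg_hom \<phi>" "range (\<lambda>i. \<phi> (mps_var i)) \<subseteq> I 1"
  shows "\<phi> f = peval (\<lambda>i. \<phi> (mps_var i)) f"
proof (rule peval_eqI[symmetric])
  fix n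
  have "f = mps_trunc n f + (f - mps_trunc n f)" by simp
  then have "\<phi> f = \<phi> (mps_trunc n f) + \<phi> (f - mps_trunc n f)"
    using assms(1) unfolding alg_hom_def by metis
  then show "\<phi> f - part (\<lambda>i. \<phi> (mps_var i)) f n \<in> I n"
    using alg_hom_order_ge[OF assms mps_trunc_diff] by (simp add: alg_hom_trunc[OF assms(1)])
qed

text \<open>The difference is divided by \<open>q\<close> monomial by monomial, and the quotients
  are summed.\<close>

lemma peval_cong_factor:
  assumes b: "range b \<subseteq> I 1" and b': "range b' \<subseteq> I 1" and t: "\<forall>i. b i - b' i = q * t i"
  shows "\<exists>s. peval b f - peval b' f = q * s"
proof -
  have "\<forall>l. \<exists>s. s \<in> I (mdeg l - 1) \<and> mono_eval b l - mono_eval b' l = q * s"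
    using mono_eval_diff_factor[OF b b' t] by blast
  from choice[OF this] obtain u where u: "\<And>l. u l \<in> I (mdeg l - 1)" "\<And>l. mono_eval b l - mono_eval b' l = q * u l"
    by blast
  \<comment> \<open>The sums run below \<open>Suc n\<close> because \<open>u l\<close> may lie one
    filtration step lower than its monomial.\<close>
  define T where "T n = (\<Sum>l | mdeg l < Suc n. c (mps_coeff f l) * u l)" for n
  have "T (Suc n) - T n \<in> I n" for n
    unfolding T_def using u(1) by (intro part_Suc_diff) (metis diff_Suc_1)
  then obtain L where L: "\<forall>n. L - T n \<in> I n" using I_complete[of T] by blast
  have "(peval b f - peval b' f) - q * L \<in> I n" for n
  proof -
    have "part b f (Suc n) - part b' f (Suc n) = (\<Sum>l | mdeg l < Suc n. c (mps_coeff f l) * (mono_eval b l - mono_eval b' l))"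
      unfolding part_def by (simp only: right_diff_distrib sum_subtractf)
    also have "\<dots> = q * T n"
      by (simp add: u(2) T_def sum_distrib_left mult_ac)
    finally have "(peval b f - peval b' f) - q * L =
        (peval b f - part b f (Suc n)) - (peval b' f - part b' f (Suc n)) - q * (L - T n)"
      by (simp add: algebra_simps)
    moreover have "(peval b f - part b f (Suc n)) - (peval b' f - part b' f (Suc n)) - q * (L - T n) \<in> I n"
      using I_diff[OF I_diff[OF subsetD[OF I_Suc peval_part[OF b]] subsetD[OF I_Suc peval_part[OF b']]] I_mult_left] L
      by blast
    ultimately show ?thesis by metis
  qed
  then have "peval b f - peval b' f = q * L" by (rule eqI_mod)
  then show ?thesis ..
qed

lemma mono_eval_case_sum:
  "mono_eval (case_sum x y) l = mono_eval x (l \<circ> Inl) * mono_eval y (l \<circ> Inr)"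
  using prod.Plus[of UNIV UNIV "\<lambda>i. case_sum x y i ^ l i"] by (simp add: mono_eval_def)

text \<open>Only monomials that involve both sets of variables survive; their \<open>x\<close>-part
  contributes one filtration step and the difference in \<open>y\<close> the other \<open>k\<close>.
  This will make \<open>y \<mapsto> y - xy\<close> a contraction.\<close>

lemma peval_mixed_difference:
  fixes x :: "'v::finite \<Rightarrow> 'b" and y y' :: "'w::finite \<Rightarrow> 'b"
  assumes x: "range x \<subseteq> I 1" and y: "range y \<subseteq> I 1" and y': "range y' \<subseteq> I 1"
    and yy': "\<forall>i. y i - y' i \<in> I k"
  shows "(peval (case_sum x y) f - peval (case_sum x y') f) -
     (peval (case_sum (\<lambda>_. 0) y) f - peval (case_sum (\<lambda>_. 0) y') f) \<in> I (Suc k)"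
proof -
  have in1: "range (case_sum u v) \<subseteq> I 1" if "range u \<subseteq> I 1" "range v \<subseteq> I 1" for u :: "'v \<Rightarrow> 'b" and v :: "'w \<Rightarrow> 'b"
    using that by (auto simp: image_subset_iff split: sum.split)
  have zero: "range (\<lambda>_::'v. 0) \<subseteq> I 1" by (auto simp: I_zero)
  note in1s = in1[OF x y] in1[OF x y'] in1[OF zero y] in1[OF zero y']
  let ?p = "\<lambda>x y. part (case_sum x y) f (Suc k)"
  have "(?p x y - ?p x y') - (?p (\<lambda>_. 0) y - ?p (\<lambda>_. 0) y') =
    (\<Sum>l | mdeg l < Suc k. c (mps_coeff f l) *
      ((mono_eval x (l \<circ> Inl) - mono_eval (\<lambda>_. 0) (l \<circ> Inl)) * (mono_eval y (l \<circ> Inr) - mono_eval y' (l \<circ> Inr))))"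
    unfolding part_def by (simp add: mono_eval_case_sum algebra_simps sum_subtractf sum.distrib)
  also have "\<dots> \<in> I (Suc k)"
  proof (rule I_sum, rule I_mult_left)
    fix l :: "'v + 'w \<Rightarrow> nat"
    have "mono_eval x (l \<circ> Inl) - mono_eval (\<lambda>_. 0) (l \<circ> Inl) \<in> I 1"
    proof (cases "l \<circ> Inl = 0")
      case False
      then have "1 \<le> mdeg (l \<circ> Inl)" by (metis mdeg_eq_0_iff less_one not_le)
      then show ?thesis
        by (intro I_diff I_antimono[OF _ mono_eval_in_I] x zero)
    qed (simp add: I_zero)
    then show "(mono_eval x (l \<circ> Inl) - mono_eval (\<lambda>_. 0) (l \<circ> Inl)) * (mono_eval y (l \<circ> Inr) - mono_eval y' (l \<circ> Inr)) \<in> I (Suc k)"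
      using I_mult[of _ 1 _ k] mono_eval_diff_in_I[OF yy'] by simp
  qed
  finally have *: "(?p x y - ?p x y') - (?p (\<lambda>_. 0) y - ?p (\<lambda>_. 0) y') \<in> I (Suc k)" .
  have "((peval (case_sum x y) f - ?p x y) - (peval (case_sum x y') f - ?p x y')) -
      ((peval (case_sum (\<lambda>_. 0) y) f - ?p (\<lambda>_. 0) y) - (peval (case_sum (\<lambda>_. 0) y') f - ?p (\<lambda>_. 0) y')) \<in> I (Suc k)"
    by (intro I_diff peval_part in1s)
  from I_add[OF this *] show ?thesis by (simp add: algebra_simps)
qed

end


section \<open>Pro-\<open>p\<close> domains\<close>

abbreviation typ_ring :: "'a::ring_1 ring" where
  "typ_ring \<equiv> ring_of_type_algebra"

lemma typ_ring_simps [simp]: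
  "carrier typ_ring = UNIV" "x \<otimes>\<^bsub>typ_ring\<^esub> y = x * y" "x \<oplus>\<^bsub>typ_ring\<^esub> y = x + y"
  "\<zero>\<^bsub>typ_ring\<^esub> = 0" "\<one>\<^bsub>typ_ring\<^esub> = 1"
  by (simp_all add: ring_of_type_algebra_def)

locale pro_p_ring = prime_nat p
  for p :: nat +
  fixes mm :: "'a::{idom, ring_char_0} set"
  assumes pro_p: "noetherian_local_pro_p_domain p mm"
begin

lemma ideal_mm: "ideal mm typ_ring"
  using pro_p maximalideal.axioms(1) by (auto simp: noetherian_local_pro_p_domain_def)

lemma mm_simps: "0 \<in> mm" "x \<in> mm \<Longrightarrow> y \<in> mm \<Longrightarrow> x + y \<in> mm" "x \<in> mm \<Longrightarrow> r * x \<in> mm"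
  using ideal_mm ideal.I_l_closed[OF ideal_mm, of x r]
    additive_subgroup.a_closed[OF ideal.axioms(1)[OF ideal_mm], of x y]
    additive_subgroup.zero_closed[OF ideal.axioms(1)[OF ideal_mm]] by simp_all

lemma p_in_mm: "of_nat p \<in> mm"
proof -
  interpret K: ring "typ_ring Quot mm" by (rule ideal.quotient_is_ring[OF ideal_mm])
  interpret mm: ideal mm typ_ring by (rule ideal_mm)
  have pow: "add_pow (typ_ring Quot mm) n (mm +>\<^bsub>typ_ring\<^esub> 1) = mm +>\<^bsub>typ_ring\<^esub> of_nat n" for n :: nat
  proof (induction n)
    case 0
    show ?case using mm.a_coset_add_zero[of mm] by (simp add: add_pow_def FactRing_def)
  next
    case (Suc n)
    show ?case
      using Suc mm.a_rcos_sum[of "of_nat n" 1]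
      by (simp add: FactRing_def add_pow_def) (simp add: add.commute)
  qed
  have "\<forall>n::nat. add_pow (typ_ring Quot mm) n \<one>\<^bsub>typ_ring Quot mm\<^esub> = \<zero>\<^bsub>typ_ring Quot mm\<^esub> \<longleftrightarrow> p dvd n"
    using pro_p by (simp add: noetherian_local_pro_p_domain_def has_characteristic_def)
  then have "add_pow (typ_ring Quot mm) p \<one>\<^bsub>typ_ring Quot mm\<^esub> = \<zero>\<^bsub>typ_ring Quot mm\<^esub>" by simp
  moreover have "\<one>\<^bsub>typ_ring Quot mm\<^esub> = mm +>\<^bsub>typ_ring\<^esub> 1" "\<zero>\<^bsub>typ_ring Quot mm\<^esub> = mm"
    by (simp_all add: FactRing_def)
  ultimately have "mm +>\<^bsub>typ_ring\<^esub> of_nat p = mm"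
    using pow[of p] by simp
  then show ?thesis
    using mm.a_rcos_self[of "of_nat p"] by simp
qed

lemma ideal_power_zero: "0 \<in> ideal_power mm n"
proof (induction n)
  case (Suc n)
  then show ?case using ideal_prod.prod[of 0 mm 0 "ideal_power mm n" typ_ring] mm_simps(1) by simp
qed simp

lemma ideal_power_add: "x \<in> ideal_power mm n \<Longrightarrow> y \<in> ideal_power mm n \<Longrightarrow> x + y \<in> ideal_power mm n"
  using ideal_prod.sum[of x typ_ring] by (cases n) auto

lemma ideal_power_1: "ideal_power mm 1 = mm"
proof -
  have "x \<in> mm" if "x \<in> ideal_prod typ_ring mm UNIV" for x
    using that by induction (use mm_simps in \<open>auto simp: mult.commute\<close>)
  moreover have "x \<in> ideal_prod typ_ring mm UNIV" if "x \<in> mm" for x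
    using ideal_prod.prod[OF that, of 1 UNIV typ_ring] by simp
  ultimately show ?thesis by auto
qed

lemma ideal_power_mult:
  "x \<in> ideal_power mm m \<Longrightarrow> y \<in> ideal_power mm n \<Longrightarrow> x * y \<in> ideal_power mm (m + n)"
proof (induction m arbitrary: x)
  case 0
  show ?case
  proof (cases n)
    case (Suc k)
    have "y \<in> ideal_prod typ_ring mm (ideal_power mm k)" using 0 Suc by simp
    then have "x * y \<in> ideal_prod typ_ring mm (ideal_power mm k)"
    proof induction
      case (prod i j)
      then show ?case
        using ideal_prod.prod[of "x * i" mm j _ typ_ring] mm_simps by (simp add: mult.assoc)
    next
      case (sum s1 s2)
      then show ?case using ideal_prod.sum[of "x * s1" typ_ring] by (simp add: distrib_left)
    qed
    then show ?thesis using Suc by simp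
  qed simp
next
  case (Suc m)
  have "x \<in> ideal_prod typ_ring mm (ideal_power mm m)" using Suc by simp
  then have "x * y \<in> ideal_prod typ_ring mm (ideal_power mm (m + n))"
  proof induction
    case (prod i j)
    then show ?case
      using ideal_prod.prod[of i mm "j * y" _ typ_ring] Suc by (simp add: mult.assoc)
  next
    case (sum s1 s2)
    then show ?case using ideal_prod.sum[of "s1 * y" typ_ring] by (simp add: distrib_right)
  qed
  then show ?case by simp
qed

sublocale fil: filtered_ring "ideal_power mm"
proof
  have mult: "x * y \<in> ideal_power mm n" if "y \<in> ideal_power mm n" for x y n
    using ideal_power_mult[of x 0 y n] that by simp
  show "ideal_power mm (Suc n) \<subseteq> ideal_power mm n" for n
  proof (intro subsetI)
    fix x assume "x \<in> ideal_power mm (Suc n)"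
    then have "x \<in> ideal_prod typ_ring mm (ideal_power mm n)" by simp
    then show "x \<in> ideal_power mm n" by induction (auto intro: mult ideal_power_add)
  qed
qed (auto intro: ideal_power_zero ideal_power_add ideal_power_mult)

sublocale R: eval_ring "ideal_power mm" "\<lambda>x. x"
proof
  show "z = 0" if "\<And>n. z \<in> ideal_power mm n" for z
    using that pro_p by (auto simp: noetherian_local_pro_p_domain_def adic_complete_def)
  show "\<exists>l. \<forall>n. l - s n \<in> ideal_power mm n" if s: "\<And>n. s (Suc n) - s n \<in> ideal_power mm n" for s
  proof -
    have diff: "s n - s k \<in> ideal_power mm k" if "n \<ge> k" for n k
      using that
    proof (induction n rule: dec_induct)
      case (step n)
      then show ?case
        using s[of n] fil.I_antimono[of k n] by (auto intro: fil.I_trans[of _ "s n"])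
    qed (simp add: ideal_power_zero)
    have "adic_Cauchy mm s"
      unfolding adic_Cauchy_def
      using diff by (meson fil.I_minus_commute fil.I_trans)
    then obtain l where l: "adic_limit mm s l"
      using pro_p by (auto simp: noetherian_local_pro_p_domain_def adic_complete_def)
    have "l - s n \<in> ideal_power mm n" for n
    proof -
      obtain N where "\<forall>m\<ge>N. s m - l \<in> ideal_power mm n"
        using l unfolding adic_limit_def by blast
      then show ?thesis
        using diff[of n "max n N"] by (meson fil.I_minus_commute fil.I_trans max.cobounded1 max.cobounded2)
    qed
    then show ?thesis by blast
  qed
qed auto

lemma mps_eval_eq:
  assumes "range x \<subseteq> mm"
  shows "mps_eval mm f x = R.peval x f"
proof -
  have x: "range x \<subseteq> ideal_power mm 1" using assms ideal_power_1 by simp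
  have part: "(\<lambda>N. \<Sum>k | mdeg k < N. mps_coeff f k * (\<Prod>i\<in>UNIV. x i ^ k i)) = R.part x f"
    by (simp add: R.part_def mono_eval_def fun_eq_iff)
  have lim: "adic_limit mm (R.part x f) (R.peval x f)"
    unfolding adic_limit_def
    using R.peval_part[OF x, of f] fil.I_antimono fil.I_minus_commute by blast
  show ?thesis
    unfolding mps_eval_def part
  proof (rule the_equality, rule lim)
    fix s assume s: "adic_limit mm (R.part x f) s"
    have "s - R.peval x f \<in> ideal_power mm k" for k
    proof -
      obtain N M where "\<forall>n\<ge>N. R.part x f n - s \<in> ideal_power mm k" "\<forall>n\<ge>M. R.part x f n - R.peval x f \<in> ideal_power mm k"
        using s lim unfolding adic_limit_def by meson
      then have "R.part x f (max N M) - s \<in> ideal_power mm k" "R.part x f (max N M) - R.peval x f \<in> ideal_power mm k"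
        by auto
      then show ?thesis by (meson fil.I_minus_commute fil.I_trans)
    qed
    then show "s = R.peval x f" by (rule R.eqI_mod)
  qed
qed

lemma p_power_in: "of_nat p ^ k * x \<in> ideal_power mm k"
proof -
  have "of_nat p ^ k \<in> ideal_power mm k"
    by (induction k) (use p_in_mm ideal_power_1 fil.I_mult[of "of_nat p" 1] in auto)
  then show ?thesis by (rule fil.I_mult_right)
qed

text \<open>The inverse is the geometric series. It is applied to multiples of \<open>p\<close> to
  invert the integers prime to \<open>p\<close>.\<close>

lemma geometric_unit:
  assumes "w \<in> mm"
  shows "\<exists>u. (1 - w) * u = 1"
proof -
  have w: "w ^ k \<in> ideal_power mm k" for k
    by (induction k) (use assms ideal_power_1 fil.I_mult[of w 1] in auto)
  obtain u where u: "\<forall>n. u - (\<Sum>i<n. w ^ i) \<in> ideal_power mm n"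
    using R.I_complete[of "\<lambda>n. \<Sum>i<n. w ^ i"] w by auto
  have "(1 - w) * u - 1 \<in> ideal_power mm n" for n
  proof -
    have "(1 - w) * u - 1 = (1 - w) * (u - (\<Sum>i<n. w ^ i)) - w ^ n"
      using one_diff_power_eq[of w n] by (simp add: algebra_simps)
    then show ?thesis using u w fil.I_diff fil.I_mult_left by metis
  qed
  then show ?thesis using R.eqI_mod by blast
qed

text \<open>Since \<open>p\<close> lies in \<open>mm\<close>, \<open>p\<close>-adic expansions
  converge in the \<open>mm\<close>-adic topology; the remainder must moreover be an exact multiple
  of \<open>p ^ N\<close>, and it is supplied by the limits of the shifted expansions.\<close>

sublocale Rp: padic_ring p "TYPE('a)"
proof
  fix n :: nat and x :: 'a
  show "of_nat n * x = 0 \<Longrightarrow> n = 0 \<or> x = 0" by simp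
next
  fix x :: 'a
  assume "\<exists>y. x = of_nat p ^ k * y" for k
  then show "x = 0" using p_power_in R.I_separated by metis
next
  fix f :: "nat \<Rightarrow> 'a"
  \<comment> \<open>\<open>t M k\<close> is a partial sum of the expansion with the first
    \<open>M\<close> digits removed and shifted down; its limit \<open>y M\<close> is the wanted
    cofactor of \<open>p ^ M\<close>.\<close>
  define t where "t M k = (\<Sum>n<k. of_nat p ^ n * f (M + n))" for M k
  have "\<exists>y. \<forall>k. y - t M k \<in> ideal_power mm k" for M
    using R.I_complete[of "t M"] p_power_in by (simp add: t_def)
  then obtain y where y: "\<And>M k. y M - t M k \<in> ideal_power mm k" by metis
  have "y 0 = t 0 N + of_nat p ^ N * y N" for N
  proof (rule R.eqI_mod)
    fix k
    have "t 0 (N + k) = t 0 N + of_nat p ^ N * t N k"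
      by (induction k) (simp_all add: t_def algebra_simps power_add)
    then have "y 0 - (t 0 N + of_nat p ^ N * y N) = (y 0 - t 0 (N + k)) - of_nat p ^ N * (y N - t N k)"
      by (simp add: algebra_simps)
    moreover have "y 0 - t 0 (N + k) \<in> ideal_power mm k"
      using fil.I_antimono[of k "N + k"] y by simp
    moreover have "of_nat p ^ N * (y N - t N k) \<in> ideal_power mm k"
      by (rule fil.I_mult_left[OF y])
    ultimately show "y 0 - (t 0 N + of_nat p ^ N * y N) \<in> ideal_power mm k"
      using fil.I_diff by metis
  qed
  then show "\<exists>s. \<forall>N. \<exists>y. s = (\<Sum>n<N. of_nat p ^ n * f n) + of_nat p ^ N * y"
    by (auto simp: t_def)
next
  fix n :: nat
  assume "\<not> p dvd n"
  then have "coprime p n" by (rule prime_imp_coprime_nat[OF prime_p])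
  then have "coprime (int n) (int p)" by (simp add: coprime_commute)
  \<comment> \<open>Bezout gives \<open>a n = 1 - b p\<close>, a unit by the geometric
    series.\<close>
  then obtain a b where ab: "a * int n + b * int p = 1"
    using bezout_int[of "int n" "int p"] by auto
  have "of_int b * of_nat p \<in> mm" using mm_simps(3)[OF p_in_mm] by blast
  then obtain u where "(1 - of_int b * of_nat p) * u = (1::'a)" using geometric_unit by blast
  moreover have "1 - of_int b * of_nat p = of_nat n * (of_int a :: 'a)"
    using arg_cong[OF ab, of "of_int :: int \<Rightarrow> 'a"] by (simp add: algebra_simps)
  ultimately show "\<exists>u::'a. of_nat n * u = 1" by (metis mult.assoc)
qed

end

sublocale pro_p_ring \<subseteq> Ap: padic_ring p "TYPE(('a, 'v::finite) mps)"
proof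
  fix n :: nat and x :: "('a, 'v) mps"
  assume *: "of_nat n * x = 0"
  have "of_nat n * mps_coeff x l = 0" for l
    using arg_cong[OF *, of "\<lambda>x. mps_coeff x l"] by simp
  then show "n = 0 \<or> x = 0" by (cases "n = 0") (auto intro!: mps_eqI)
next
  fix x :: "('a, 'v) mps"
  assume *: "\<exists>y. x = of_nat p ^ k * y" for k
  have "mps_coeff x l = 0" for l
  proof (rule Rp.separated)
    show "\<exists>y. mps_coeff x l = of_nat p ^ k * y" for k
      using *[of k] by auto
  qed
  then show "x = 0" by (intro mps_eqI) simp
next
  fix f :: "nat \<Rightarrow> ('a, 'v) mps"
  have "\<forall>l. \<exists>s. \<forall>N. \<exists>y. s = (\<Sum>n<N. of_nat p ^ n * mps_coeff (f n) l) + of_nat p ^ N * y"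
    by (intro allI Rp.complete)
  from choice[OF this] obtain s
    where s: "\<And>l N. \<exists>y. s l = (\<Sum>n<N. of_nat p ^ n * mps_coeff (f n) l) + of_nat p ^ N * y"
    by blast
  define y where "y l N = (SOME y. s l = (\<Sum>n<N. of_nat p ^ n * mps_coeff (f n) l) + of_nat p ^ N * y)" for l N
  have sy: "s l = (\<Sum>n<N. of_nat p ^ n * mps_coeff (f n) l) + of_nat p ^ N * y l N" for l N
    unfolding y_def by (rule someI_ex[OF s])
  have "Abs_mps s = (\<Sum>n<N. of_nat p ^ n * f n) + of_nat p ^ N * Abs_mps (\<lambda>l. y l N)" for N
    by (rule mps_eqI) (use sy in simp)
  then show "\<exists>s. \<forall>N. \<exists>y. s = (\<Sum>n<N. of_nat p ^ n * f n) + of_nat p ^ N * y" by blast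
next
  fix n :: nat
  assume "\<not> p dvd n"
  then obtain u :: 'a where "of_nat n * u = 1" using Rp.unit_of_nat by blast
  then show "\<exists>u::('a, 'v) mps. of_nat n * u = 1"
    by (intro exI[of _ "mps_const u"]) (simp flip: mps_const_of_nat mps_const_hom)
qed

context pro_p_ring
begin

text \<open>A variable counts 1 and the \<open>k\<close>-th power of \<open>mm\<close> counts
  \<open>k\<close>, so that variables and constants from \<open>mm\<close> are equally admissible
  for substitution. Truncated subtraction leaves coefficients of degree at least \<open>n\<close>
  unrestricted.\<close>

definition mps_filtration :: "nat \<Rightarrow> ('a, 'v::finite) mps set" where
  "mps_filtration n = {f. \<forall>l. mps_coeff f l \<in> ideal_power mm (n - mdeg l)}"

end

sublocale pro_p_ring \<subseteq> A: eval_ring "mps_filtration :: nat \<Rightarrow> ('a, 'v::finite) mps set" mps_const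
proof
  show "mps_filtration (Suc n) \<subseteq> (mps_filtration n :: ('a, 'v) mps set)" for n
  proof (clarsimp simp: mps_filtration_def)
    fix x :: "('a, 'v) mps" and l
    assume "\<forall>l. mps_coeff x l \<in> ideal_power mm (Suc n - mdeg l)"
    then show "mps_coeff x l \<in> ideal_power mm (n - mdeg l)"
      using fil.I_antimono[of "n - mdeg l" "Suc n - mdeg l"] by simp
  qed
  show "x * y \<in> mps_filtration (m + n)" if xy: "x \<in> mps_filtration m" "y \<in> mps_filtration n" for m n and x y :: "('a, 'v) mps"
    unfolding mps_filtration_def
  proof (intro CollectI allI, unfold mps_coeff_mult, rule fil.I_sum)
    fix l k :: "'v \<Rightarrow> nat"
    assume "k \<in> {..l}"
    then have "k \<le> l" by simp
    have "mps_coeff x k * mps_coeff y (l - k) \<in> ideal_power mm ((m - mdeg k) + (n - mdeg (l - k)))"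
      using xy by (intro ideal_power_mult) (auto simp: mps_filtration_def)
    moreover have "m + n - mdeg l \<le> (m - mdeg k) + (n - mdeg (l - k))"
      using mdeg_diff[OF \<open>k \<le> l\<close>] by linarith
    ultimately show "mps_coeff x k * mps_coeff y (l - k) \<in> ideal_power mm (m + n - mdeg l)"
      using fil.I_antimono by blast
  qed
  show "z = 0" if "\<And>n. z \<in> mps_filtration n" for z :: "('a, 'v) mps"
  proof (rule mps_eqI)
    fix l
    have "mps_coeff z l \<in> ideal_power mm n" for n
      using that[of "n + mdeg l"] unfolding mps_filtration_def by (auto dest: spec[of _ l])
    then show "mps_coeff z l = mps_coeff 0 l" using R.I_separated by simp
  qed
  show "\<exists>L. \<forall>n. L - s n \<in> mps_filtration n" if s: "\<And>n. s (Suc n) - s n \<in> mps_filtration n" for s :: "nat \<Rightarrow> ('a, 'v) mps"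
  proof -
    \<comment> \<open>The coefficient at \<open>l\<close> comes under control \<open>mdeg l\<close>
      steps late, hence the shift.\<close>
    have "\<exists>L. \<forall>n. L - mps_coeff (s (n + mdeg l)) l \<in> ideal_power mm n" for l
    proof (rule R.I_complete)
      fix n
      show "mps_coeff (s (Suc n + mdeg l)) l - mps_coeff (s (n + mdeg l)) l \<in> ideal_power mm n"
        using s[of "n + mdeg l"] unfolding mps_filtration_def by (auto dest: spec[of _ l])
    qed
    then obtain L where L: "\<And>l n. L l - mps_coeff (s (n + mdeg l)) l \<in> ideal_power mm n" by metis
    have "L l - mps_coeff (s n) l \<in> ideal_power mm (n - mdeg l)" for l n
      using L[of l "n - mdeg l"] by (cases "mdeg l \<le> n") auto
    then show ?thesis by (intro exI[of _ "Abs_mps L"]) (simp add: mps_filtration_def)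
  qed
qed (auto simp: mps_filtration_def mps_const_hom intro: fil.I_add ideal_power_zero)


section \<open>The ring of endomorphisms of the power series module\<close>

lemma mps_End_iff:
  fixes u :: "('a::comm_ring_1, 'n::finite) mps \<Rightarrow> ('a, 'n) mps"
  shows "u \<in> mps_End \<longleftrightarrow> (\<forall>f g. u (f + g) = u f + u g) \<and> (\<forall>r f. u (mps_const r * f) = mps_const r * u f)"
proof -
  have "Modules.module (\<lambda>c (f :: ('a, 'n) mps). mps_const c * f)"
    by unfold_locales (simp_all add: mps_const_hom algebra_simps)
  then show ?thesis
    by (simp add: mps_End_def module_hom_def module_hom_axioms_def)
qed

text \<open>As a type of its own the endomorphisms form a \<open>ring_1\<close> under composition,
  to which \<open>padic_ring\<close> applies.\<close>

typedef (overloaded) ('a, 'v) mps_endo = "mps_End :: (('a::comm_ring_1, 'v::finite) mps \<Rightarrow> ('a, 'v) mps) set"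
  morphisms app Endo
  by (rule exI[of _ "\<lambda>f. f"]) (simp add: mps_End_iff)

setup_lifting type_definition_mps_endo

lemma endo_eqI: "(\<And>f. app u f = app v f) \<Longrightarrow> u = v"
  by (metis app_inverse ext)

instantiation mps_endo :: (comm_ring_1, finite) ring_1
begin

lift_definition zero_mps_endo :: "('a, 'b) mps_endo" is "\<lambda>_. 0" by (simp add: mps_End_iff)
lift_definition one_mps_endo :: "('a, 'b) mps_endo" is "\<lambda>f. f" by (simp add: mps_End_iff)
lift_definition plus_mps_endo :: "('a, 'b) mps_endo \<Rightarrow> ('a, 'b) mps_endo \<Rightarrow> ('a, 'b) mps_endo"
  is "\<lambda>u v f. u f + v f" by (simp add: mps_End_iff algebra_simps)
lift_definition minus_mps_endo :: "('a, 'b) mps_endo \<Rightarrow> ('a, 'b) mps_endo \<Rightarrow> ('a, 'b) mps_endo"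
  is "\<lambda>u v f. u f - v f" by (simp add: mps_End_iff algebra_simps)
lift_definition uminus_mps_endo :: "('a, 'b) mps_endo \<Rightarrow> ('a, 'b) mps_endo"
  is "\<lambda>u f. - u f" by (simp add: mps_End_iff)
lift_definition times_mps_endo :: "('a, 'b) mps_endo \<Rightarrow> ('a, 'b) mps_endo \<Rightarrow> ('a, 'b) mps_endo"
  is "\<lambda>u v f. u (v f)" by (simp add: mps_End_iff)

instance
proof
  show "(0 :: ('a, 'b) mps_endo) \<noteq> 1"
    by transfer (metis zero_neq_one)
qed (transfer; simp add: mps_End_iff fun_eq_iff algebra_simps)+

end

lemma app_in_mps_End [simp]: "app u \<in> mps_End"
  using app by blast

lemma app_linear: "app u (f + g) = app u f + app u g" "app u (mps_const r * f) = mps_const r * app u f"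
  using app_in_mps_End[of u] unfolding mps_End_iff by blast+

lemma app_simps [simp]:
  "app 0 f = 0" "app 1 f = f" "app (u + v) f = app u f + app v f" "app (u - v) f = app u f - app v f"
  "app (- u) f = - app u f" "app (u * v) f = app u (app v f)"
  by (transfer, simp)+

lemma app_zero [simp]: "app u 0 = 0"
  using app_linear(2)[of u 0 0] by (simp add: mps_const_hom)

lemma app_of_nat [simp]: "app (of_nat n) f = of_nat n * f"
  by (induction n) (simp_all add: distrib_right)

lemma app_of_nat_power [simp]: "app (of_nat n ^ k) f = of_nat n ^ k * f"
  using app_of_nat[of "n ^ k" f] by simp

lemma app_mult_of_nat: "app u (of_nat n * f) = of_nat n * app u f"
  using app_linear(2)[of u "of_nat n" f] by (simp add: mps_const_of_nat)

lemma app_of_int [simp]: "app (of_int z) f = of_int z * f"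
  by (cases z rule: int_cases2) simp_all

lemma app_sum: "app (sum u A) f = (\<Sum>x\<in>A. app (u x) f)"
  by (induction A rule: infinite_finite_induct) auto

lemma app_power: "app (u ^ n) = (app u) ^^ n"
  by (induction n) (auto simp: fun_eq_iff)

lemma sum_fun_apply: "(sum u A) f = (\<Sum>x\<in>A. u x f)"
  by (induction A rule: infinite_finite_induct) auto

lemma zmult_apply: "zmult z (u :: 'b \<Rightarrow> 'c::ring_1) f = of_int z * u f"
  by (cases z rule: int_cases2) (simp_all add: zmult_def sum_fun_apply)

lemma zmult_app: "zmult z (app u) = app (of_int z * u)"
  by (rule ext) (simp add: zmult_apply)

context pro_p_ring
begin

text \<open>Pointwise quotients are unique because the power series ring is torsion free, and
  uniqueness forces them to be linear.\<close>

lemma endo_divide: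
  fixes u :: "('a, 'v::finite) mps_endo"
  assumes "n > 0" "\<And>f. \<exists>g. app u f = of_nat n * g"
  shows "\<exists>v. u = of_nat n * v"
proof -
  obtain v where v: "\<And>f. app u f = of_nat n * v f" using assms(2) by metis
  have "v \<in> mps_End"
    unfolding mps_End_iff
  proof safe
    fix f g
    have "of_nat n * v (f + g) = of_nat n * (v f + v g)"
      by (simp add: v[symmetric] app_linear algebra_simps)
    then show "v (f + g) = v f + v g" using assms(1) by (rule Ap.of_nat_mult_cancel)
  next
    fix r f
    have "of_nat n * v (mps_const r * f) = of_nat n * (mps_const r * v f)"
      using app_linear(2)[of u r f] by (simp add: v mult.left_commute)
    then show "v (mps_const r * f) = mps_const r * v f" using assms(1) by (rule Ap.of_nat_mult_cancel)
  qed
  then have "u = of_nat n * Endo v"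
    by (intro endo_eqI) (simp add: v Endo_inverse)
  then show ?thesis ..
qed

end

text \<open>The limit is formed pointwise; its defect from linearity is divisible by every power of
  \<open>p\<close>, and \<open>endo_divide\<close> turns pointwise remainders into an
  endomorphism.\<close>

sublocale pro_p_ring \<subseteq> Ep: padic_ring p "TYPE(('a, 'v::finite) mps_endo)"
proof
  fix n :: nat and u :: "('a, 'v) mps_endo"
  assume *: "of_nat n * u = 0"
  have "n = 0 \<or> app u f = 0" for f
    using arg_cong[OF *, of "\<lambda>u. app u f"] Ap.torsion_free[of n "app u f"] by simp
  then show "n = 0 \<or> u = 0" by (auto intro: endo_eqI)
next
  fix u :: "('a, 'v) mps_endo"
  assume *: "\<exists>v. u = of_nat p ^ k * v" for k
  have "app u f = 0" for f
  proof (rule Ap.separated)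
    show "\<exists>g. app u f = of_nat p ^ k * g" for k using *[of k] by auto
  qed
  then show "u = 0" by (intro endo_eqI) simp
next
  fix e :: "nat \<Rightarrow> ('a, 'v) mps_endo"
  define S where "S N f = (\<Sum>n<N. of_nat p ^ n * app (e n) f)" for N f
  have "\<forall>f. \<exists>s. \<forall>N. \<exists>y. s = S N f + of_nat p ^ N * y"
    unfolding S_def by (intro allI Ap.complete)
  from choice[OF this] obtain s where s: "\<And>f N. \<exists>y. s f = S N f + of_nat p ^ N * y"
    by blast
  have s_diff: "Ap.pmult N (s f - S N f)" for f N
    using s[of f N] by (auto simp: Ap.pmult_def)
  have S: "S N (f + g) = S N f + S N g" "S N (mps_const r * f) = mps_const r * S N f" for N f g r
    by (simp_all add: S_def app_linear distrib_left sum.distrib sum_distrib_left mult.left_commute)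
  have "s \<in> mps_End"
    unfolding mps_End_iff
  proof safe
    fix f g
    have "Ap.pmult N (s (f + g) - (s f + s g))" for N
    proof -
      have "s (f + g) - (s f + s g) = (s (f + g) - S N (f + g)) - ((s f - S N f) + (s g - S N g))"
        by (simp add: S)
      then show ?thesis
        using Ap.pmult_diff[OF s_diff Ap.pmult_add[OF s_diff s_diff]] by metis
    qed
    then show "s (f + g) = s f + s g" using Ap.eq_0_if_pmult[of "s (f + g) - (s f + s g)"] by simp
  next
    fix r f
    have "Ap.pmult N (s (mps_const r * f) - mps_const r * s f)" for N
    proof -
      have "s (mps_const r * f) - mps_const r * s f =
          (s (mps_const r * f) - S N (mps_const r * f)) - mps_const r * (s f - S N f)"
        by (simp add: S right_diff_distrib)
      then show ?thesis
        using Ap.pmult_diff[OF s_diff Ap.pmult_mult_left[OF s_diff]] by metis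
    qed
    then show "s (mps_const r * f) = mps_const r * s f"
      using Ap.eq_0_if_pmult[of "s (mps_const r * f) - mps_const r * s f"] by simp
  qed
  then have app_s: "app (Endo s) f = s f" for f by (simp add: Endo_inverse)
  have "\<exists>y. Endo s - (\<Sum>n<N. of_nat p ^ n * e n) = of_nat (p ^ N) * y" for N
  proof (rule endo_divide)
    show "p ^ N > 0" using p_ge_2 by simp
    show "\<exists>g. app (Endo s - (\<Sum>n<N. of_nat p ^ n * e n)) f = of_nat (p ^ N) * g" for f
      using s[of f N] by (auto simp: app_s app_sum S_def)
  qed
  then have "\<exists>y. Endo s = (\<Sum>n<N. of_nat p ^ n * e n) + of_nat p ^ N * y" for N
    by (simp add: diff_eq_eq add.commute)
  then show "\<exists>s. \<forall>N. \<exists>y. s = (\<Sum>n<N. of_nat p ^ n * e n) + of_nat p ^ N * y"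
    by blast
next
  fix n :: nat
  assume "\<not> p dvd n"
  then obtain u :: 'a where u: "of_nat n * u = 1" using Rp.unit_of_nat by blast
  have "(\<lambda>f::('a, 'v) mps. mps_const u * f) \<in> mps_End"
    by (simp add: mps_End_iff algebra_simps)
  moreover have "of_nat n * (mps_const u * f) = f" for f :: "('a, 'v) mps"
    by (rule mps_eqI) (simp, simp add: u flip: mult.assoc)
  ultimately have "of_nat n * Endo (\<lambda>f::('a, 'v) mps. mps_const u * f) = 1"
    by (intro endo_eqI) (simp add: Endo_inverse)
  then show "\<exists>v::('a, 'v) mps_endo. of_nat n * v = 1" by blast
qed

context pro_p_ring
begin

abbreviation bpn :: "'b::semiring_1" where "bpn \<equiv> of_nat (bold_p p)"

lemma psums_app:
  assumes "Ep.psums g s"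
  shows "Ap.psums (\<lambda>n. app (g n) f) (app s f)"
  unfolding Ap.psums_def
proof
  fix K
  obtain N where N: "\<forall>n\<ge>N. Ep.pmult K (s - (\<Sum>i<n. g i))"
    using assms unfolding Ep.psums_def by blast
  have "Ap.pmult K (app s f - (\<Sum>i<n. app (g i) f))" if n: "n \<ge> N" for n
  proof -
    obtain y where "s - (\<Sum>i<n. g i) = of_nat p ^ K * y"
      using N n unfolding Ep.pmult_def by blast
    then have "app (s - (\<Sum>i<n. g i)) f = of_nat p ^ K * app y f" by simp
    then show ?thesis by (auto simp: app_sum Ap.pmult_def)
  qed
  then show "\<exists>N. \<forall>n\<ge>N. Ap.pmult K (app s f - (\<Sum>i<n. app (g i) f))" by blast
qed

lemma padic_limit_iff:
  "padic_limit p mps_End (\<lambda>N. \<Sum>n<N. app (g n)) (app s) \<longleftrightarrow> Ep.psums g s"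
proof -
  have "app s - (\<Sum>i<n. app (g i)) \<in> zmult (int p ^ k) ` mps_End \<longleftrightarrow> Ep.pmult k (s - (\<Sum>i<n. g i))" (is "?a \<longleftrightarrow> ?b") for k n
  proof -
    have e: "app s - (\<Sum>i<n. app (g i)) = app (s - (\<Sum>i<n. g i))"
      by (rule ext) (simp add: sum_fun_apply app_sum)
    have "?a \<longleftrightarrow> (\<exists>v. app (s - (\<Sum>i<n. g i)) = app (of_nat p ^ k * v))"
      unfolding e
    proof safe
      fix w :: "('a, 'b) mps \<Rightarrow> ('a, 'b) mps"
      assume "app (s - (\<Sum>i<n. g i)) = zmult (int p ^ k) w" "w \<in> mps_End"
      then show "\<exists>v. app (s - (\<Sum>i<n. g i)) = app (of_nat p ^ k * v)"
        using zmult_app[of "int p ^ k" "Endo w"] by (auto simp: Endo_inverse)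
    next
      fix v
      assume "app (s - (\<Sum>i<n. g i)) = app (of_nat p ^ k * v)"
      then show "app (s - (\<Sum>i<n. g i)) \<in> zmult (int p ^ k) ` mps_End"
        using zmult_app[of "int p ^ k" v] by (metis app_in_mps_End image_eqI of_int_of_nat_eq of_int_power)
    qed
    also have "\<dots> \<longleftrightarrow> ?b"
      by (simp add: Ep.pmult_def app_inject)
    finally show ?thesis .
  qed
  then show ?thesis
    unfolding padic_limit_def Ep.psums_def by simp
qed

text \<open>Torsion-freeness makes the quotients by \<open>n!\<close> in the definition unique, so
  that they are the terms of \<open>pexp\<close>.\<close>

lemma mps_End_exp_eq:
  fixes s :: "('a, 'b::finite) mps_endo"
  shows "mps_End_exp p (app (bpn * s)) = app (Ep.pexp s)"
proof -
  have fact: "of_int (fact n) = (of_nat (fact n) :: ('a, 'b) mps_endo)" for n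
    by (metis of_int_of_nat_eq of_nat_fact)
  have the_term: "(THE u. u \<in> mps_End \<and> zmult (fact n) u = app (bpn * s) ^^ n) = app (Ep.exp_term s n)" for n
  proof (rule the_equality)
    have "of_int (fact n) * Ep.exp_term s n = (bpn * s) ^ n"
      using Ep.fact_mult_exp_term[of n s] unfolding fact .
    then show "app (Ep.exp_term s n) \<in> mps_End \<and> zmult (fact n) (app (Ep.exp_term s n)) = app (bpn * s) ^^ n"
      unfolding zmult_app by (simp only: app_power[symmetric] app_in_mps_End simp_thms)
  next
    fix u assume u: "u \<in> mps_End \<and> zmult (fact n) u = app (bpn * s) ^^ n"
    then have "app (of_int (fact n) * Endo u) = app ((bpn * s) ^ n)"
      using zmult_app[of "fact n" "Endo u"] by (simp add: Endo_inverse app_power)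
    then have "of_nat (fact n) * Endo u = of_nat (fact n) * Ep.exp_term s n"
      using Ep.fact_mult_exp_term[of n s] unfolding fact by (simp only: app_inject)
    then have "Endo u = Ep.exp_term s n" by (rule Ep.of_nat_mult_cancel) simp
    then show "u = app (Ep.exp_term s n)" using u by (metis Endo_inverse)
  qed
  show ?thesis
    unfolding mps_End_exp_def the_term
  proof (rule the_equality)
    show "padic_limit p mps_End (\<lambda>N. \<Sum>n<N. app (Ep.exp_term s n)) (app (Ep.pexp s))"
      by (simp add: padic_limit_iff Ep.psums_exp_term)
    fix e assume e: "padic_limit p mps_End (\<lambda>N. \<Sum>n<N. app (Ep.exp_term s n)) e"
    then have "e \<in> mps_End" by (simp add: padic_limit_def)
    then have "e = app (Endo e)" by (simp add: Endo_inverse)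
    then show "e = app (Ep.pexp s)"
      using e padic_limit_iff Ep.psums_exp_term Ep.psums_unique by metis
  qed
qed

lemma commutator_app: "commutator (app u) (app v) = app (ad u v)"
  by (rule ext) (simp add: commutator_def ad_def)

lemma lie_monomial_eval_app:
  "lie_monomial_eval commutator (app a) (app b) t = app (lie_monomial_eval ad a b t)"
  by (induction t) (auto simp: commutator_app)

text \<open>The two representations may use different denominators and are compared after
  multiplication by both.\<close>

lemma eq_in_tensor_Q_unique:
  fixes x y :: "('a, 'v::finite) mps_endo"
  assumes "eq_in_tensor_Q (app x) us" "eq_in_tensor_Q (app y) us"
  shows "x = y"
proof -
  let ?s = "\<lambda>N. \<Sum>(q, u)\<leftarrow>us. zmult \<lfloor>rat_of_int N * q\<rfloor> u"
  obtain N M where N: "N > 0" "\<forall>(q, u)\<in>set us. of_int N * q \<in> \<int>" "zmult N (app x) = ?s N"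
    and M: "M > 0" "\<forall>(q, u)\<in>set us. of_int M * q \<in> \<int>" "zmult M (app y) = ?s M"
    using assms unfolding eq_in_tensor_Q_def by blast
  have scale: "of_int b * (?s a) f = (?s (a * b)) f" if "\<forall>(q, u)\<in>set us. of_int a * q \<in> \<int>" for a b f
    using that
  proof (induction us)
    case (Cons x us)
    obtain q u where x: "x = (q, u)" by (cases x)
    obtain z where z: "rat_of_int a * q = of_int z" using Cons.prems x by (auto elim: Ints_cases)
    have "rat_of_int (a * b) * q = of_int (b * z)" by (simp add: z[symmetric] mult_ac)
    then have "\<lfloor>rat_of_int (a * b) * q\<rfloor> = b * z" by (simp only: floor_of_int)
    then show ?case using Cons by (simp add: x z zmult_apply distrib_left mult.assoc)
  qed simp
  have "of_int (N * M) * app x f = of_int (N * M) * app y f" for f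
  proof -
    have "of_int (N * M) * app x f = of_int M * (zmult N (app x)) f" by (simp add: zmult_apply mult_ac)
    also have "\<dots> = of_int N * (zmult M (app y)) f"
      unfolding N(3) M(3) scale[OF N(2)] scale[OF M(2)] by (simp add: mult.commute)
    finally show ?thesis by (simp add: zmult_apply mult_ac)
  qed
  moreover have "N * M \<noteq> 0" using N(1) M(1) by simp
  ultimately have "app x f = app y f" for f by (rule Ap.of_int_mult_cancel)
  then show "x = y" by (rule endo_eqI)
qed

text \<open>The second statement is what later places the partial sums among the invariant
  derivations, which are closed under division by positive integers.\<close>

lemma bch_partial_sum_eq:
  fixes a b :: "('a, 'v::finite) mps_endo"
  shows "eq_in_tensor_Q (app (\<Sum>n\<le>N. Ep.fs_eval a b fs_bch n))
     (bch_partial_sum commutator (app (bpn * a)) (app (bpn * b)) N)"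
    and "\<exists>D>0. of_nat D * (\<Sum>n\<le>N. Ep.fs_eval a b fs_bch n) \<in>
      range (\<lambda>P. \<Sum>(z, t)\<leftarrow>P. of_int z * lie_monomial_eval ad (bpn * a) (bpn * b) t)"
proof -
  let ?P = "Ep.bch_partial_polynomial N" and ?S = "\<Sum>n\<le>N. Ep.fs_eval a b fs_bch n"
  let ?e = "lie_monomial_eval ad (bpn * a) (bpn * b)"
  obtain D :: int where D: "D > 0" "\<forall>(q, t)\<in>set ?P. of_int D * q \<in> \<int>"
    using Ep.common_denominator[of ?P] by auto
  have S: "of_int D * ?S = (\<Sum>(q, t)\<leftarrow>?P. of_int \<lfloor>of_int D * q\<rfloor> * ?e t)"
    by (rule Ep.bch_partial_sum_eval) (use D(2) in auto)
  have ps: "bch_partial_sum commutator (app (bpn * a)) (app (bpn * b)) N = map (\<lambda>(q, t). (q, app (?e t))) ?P"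
    by (simp add: bch_partial_sum_def Ep.bch_partial_polynomial_def map_concat comp_def lie_monomial_eval_app)
  have "app (\<Sum>(q, t)\<leftarrow>P. of_int \<lfloor>rat_of_int D * q\<rfloor> * ?e t) = (\<Sum>(q, u)\<leftarrow>map (\<lambda>(q, t). (q, app (?e t))) P. zmult \<lfloor>of_int D * q\<rfloor> u)" for P
    by (induction P) (auto simp: fun_eq_iff zmult_apply)
  then have "zmult D (app ?S) = (\<Sum>(q, u)\<leftarrow>map (\<lambda>(q, t). (q, app (?e t))) ?P. zmult \<lfloor>of_int D * q\<rfloor> u)"
    unfolding zmult_app S by blast
  then show "eq_in_tensor_Q (app ?S) (bch_partial_sum commutator (app (bpn * a)) (app (bpn * b)) N)"
    unfolding ps eq_in_tensor_Q_def using D by (intro exI[of _ D]) auto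
  have "of_nat (nat D) * ?S = (\<Sum>(z, t)\<leftarrow>map (\<lambda>(q, t). (\<lfloor>of_int D * q\<rfloor>, t)) ?P. of_int z * ?e t)"
    using S D(1) by (simp add: comp_def case_prod_unfold)
  then have "of_nat (nat D) * ?S \<in> range (\<lambda>P. \<Sum>(z, t)\<leftarrow>P. of_int z * ?e t)"
    by (rule range_eqI)
  then show "\<exists>D>0. of_nat D * ?S \<in> range (\<lambda>P. \<Sum>(z, t)\<leftarrow>P. of_int z * ?e t)"
    using D(1) by (intro exI[of _ "nat D"]) simp
qed

end


section \<open>Power series as functions\<close>

text \<open>The restriction to \<open>V\<close> and \<open>\<kappa>\<close> permits induction on the
  variables: fixing the others gives a polynomial in one variable that vanishes at all natural
  numbers, an infinite set in characteristic 0.\<close>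

lemma finite_sum_monomials_eq_0:
  fixes c :: "('v \<Rightarrow> nat) \<Rightarrow> 'a::{idom, ring_char_0}"
  assumes "finite V" "finite S" "\<And>a::'v \<Rightarrow> nat. (\<Sum>k\<in>S. c k * (\<Prod>i\<in>V. of_nat (a i) ^ k i)) = 0"
  shows "(\<Sum>k | k \<in> S \<and> (\<forall>i\<in>V. k i = \<kappa> i). c k) = 0"
  using assms
proof (induction V arbitrary: S rule: finite_induct)
  case empty
  then show ?case by simp
next
  case (insert i V)
  let ?S' = "{k \<in> S. k i = \<kappa> i}"
  have "(\<Sum>k\<in>?S'. c k * (\<Prod>j\<in>V. of_nat (a j) ^ k j)) = 0" for a :: "'v \<Rightarrow> nat"
  proof -
    define P where "P = (\<Sum>k\<in>S. monom (c k * (\<Prod>j\<in>V. of_nat (a j) ^ k j)) (k i))"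
    have "poly P (of_nat t) = 0" for t
    proof -
      have "(\<Prod>j\<in>insert i V. of_nat ((a(i := t)) j) ^ k j) = of_nat t ^ k i * (\<Prod>j\<in>V. of_nat (a j) ^ k j :: 'a)" for k
      proof -
        have "(\<Prod>j\<in>V. of_nat ((a(i := t)) j) ^ k j) = (\<Prod>j\<in>V. of_nat (a j) ^ k j :: 'a)"
          using insert.hyps(2) by (intro prod.cong) auto
        then show ?thesis using insert.hyps by (simp add: prod.insert)
      qed
      then show ?thesis
        using insert.prems(2)[of "a(i := t)"] by (simp add: P_def poly_sum poly_monom mult_ac)
    qed
    then have "range (of_nat :: nat \<Rightarrow> 'a) \<subseteq> {x. poly P x = 0}" by auto
    then have "infinite {x. poly P x = 0}"
      using finite_subset infinite_UNIV_nat inj_of_nat finite_imageD by (metis (no_types))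
    then have "P = 0" using poly_roots_finite by blast
    then have "0 = coeff P (\<kappa> i)" by simp
    also have "\<dots> = (\<Sum>k\<in>S. if k i = \<kappa> i then c k * (\<Prod>j\<in>V. of_nat (a j) ^ k j) else 0)"
      by (simp add: P_def coeff_sum)
    also have "\<dots> = (\<Sum>k\<in>?S'. c k * (\<Prod>j\<in>V. of_nat (a j) ^ k j))"
      by (simp add: sum.inter_filter insert.prems(1))
    finally show ?thesis by simp
  qed
  then have "(\<Sum>k | k \<in> ?S' \<and> (\<forall>j\<in>V. k j = \<kappa> j). c k) = 0"
    using insert.prems(1) by (intro insert.IH) auto
  moreover have "{k. k \<in> ?S' \<and> (\<forall>j\<in>V. k j = \<kappa> j)} = {k. k \<in> S \<and> (\<forall>j\<in>insert i V. k j = \<kappa> j)}"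
    by auto
  ultimately show ?case by simp
qed

context pro_p_ring
begin

definition point :: "('v \<Rightarrow> 'a) \<Rightarrow> bool" where
  "point x \<longleftrightarrow> range x \<subseteq> mm"

lemma point_I1: "point x \<longleftrightarrow> range x \<subseteq> ideal_power mm 1"
  unfolding point_def ideal_power_1 ..

lemma pointD: "point x \<Longrightarrow> range x \<subseteq> ideal_power mm 1"
  by (simp only: point_I1)

lemma peval_factor_order_ge:
  assumes "point (\<lambda>i. q * t i)" "f \<in> mps_order_ge n"
  shows "\<exists>s. R.peval (\<lambda>i. q * t i) f = q ^ n * s"
  using assms(2)
proof (induction n arbitrary: f)
  case (Suc n)
  let ?x = "\<lambda>i. q * t i"
  obtain g where g: "\<And>i. g i \<in> mps_order_ge n" "f = (\<Sum>i\<in>UNIV. mps_var i * g i)"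
    using mps_order_ge_decompose[OF Suc.prems] by metis
  have x: "range ?x \<subseteq> ideal_power mm 1" by (rule pointD[OF assms(1)])
  obtain s where s: "\<And>i. R.peval ?x (g i) = q ^ n * s i" using Suc.IH[OF g(1)] by metis
  have "R.peval ?x f = (\<Sum>i\<in>UNIV. q * t i * (q ^ n * s i))"
    unfolding g(2) R.alg_hom_sum[OF R.alg_hom_peval[OF x]]
    by (simp only: R.peval_mult[OF x] R.peval_var[OF x] s)
  also have "\<dots> = q ^ Suc n * (\<Sum>i\<in>UNIV. t i * s i)"
    by (simp add: sum_distrib_left mult_ac)
  finally show ?case by blast
qed simp

lemma mono_eval_scale: "mono_eval (\<lambda>i. q * t i) l = q ^ mdeg l * mono_eval t l"
  by (simp add: mono_eval_def mdeg_def power_mult_distrib prod.distrib power_sum)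

lemma point_p_multiple:
  assumes "m > 0"
  shows "point (\<lambda>i. of_nat p ^ m * t i)"
proof -
  have "of_nat p ^ m * x = (of_nat p ^ (m - 1) * x) * of_nat p" for x :: 'a
    using assms power_Suc2[of "of_nat p :: 'a" "m - 1"] by (simp add: mult_ac)
  then show ?thesis unfolding point_def using mm_simps(3)[OF p_in_mm] by (metis image_subsetI)
qed

text \<open>The lowest homogeneous component of \<open>f\<close> at \<open>a\<close> is approximated by
  \<open>p\<^sup>-\<^sup>m\<^sup>n f(p\<^sup>m a)\<close>, and a polynomial vanishing at all natural points is zero.\<close>
lemma peval_faithful:
  fixes f :: "('a, 'v::finite) mps"
  assumes "\<And>x. point x \<Longrightarrow> R.peval x f = 0"
  shows "f = 0"
proof -
  have "f \<in> mps_order_ge n" for n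
  proof (induction n)
    case 0
    show ?case by (simp add: mps_order_ge_def)
  next
    case (Suc n)
    let ?S = "{l::'v \<Rightarrow> nat. mdeg l = n}"
    have fin: "finite ?S" by (rule finite_subset[OF _ finite_mdeg_le[of n]]) auto
    have "(\<Sum>l\<in>?S. mps_coeff f l * (\<Prod>i\<in>UNIV. of_nat (a i) ^ l i)) = 0" for a :: "'v \<Rightarrow> nat"
    proof -
      define h where "h = (\<Sum>l\<in>?S. mps_coeff f l * mono_eval (\<lambda>i. of_nat (a i)) l)"
      have "\<exists>s. h = of_nat p ^ Suc m * s" for m
      proof -
        define q where "q = (of_nat p ^ Suc m :: 'a)"
        let ?x = "\<lambda>i. q * of_nat (a i)"
        have x: "point ?x" unfolding q_def by (rule point_p_multiple) simp
        have x1: "range ?x \<subseteq> ideal_power mm 1" by (rule pointD[OF x])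
        obtain s where s: "R.peval ?x (f - mps_trunc (Suc n) f) = q ^ Suc n * s"
          using peval_factor_order_ge[OF x mps_trunc_diff] by blast
        have "R.part ?x f (Suc n) = (\<Sum>l\<in>?S. mps_coeff f l * mono_eval ?x l)"
          unfolding R.part_def
        proof (rule sum.mono_neutral_right)
          show "\<forall>l\<in>{l. mdeg l < Suc n} - ?S. mps_coeff f l * mono_eval ?x l = 0"
            using Suc by (auto simp: mps_order_ge_def)
        qed auto
        also have "\<dots> = q ^ n * h"
          by (simp add: h_def mono_eval_scale sum_distrib_left mult_ac)
        finally have "R.peval ?x (mps_trunc (Suc n) f) = q ^ n * h"
          using R.alg_hom_trunc[OF R.alg_hom_peval[OF x1]] by (simp add: R.peval_var[OF x1])
        moreover have "R.peval ?x f = R.peval ?x (f - mps_trunc (Suc n) f) + R.peval ?x (mps_trunc (Suc n) f)"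
          using R.peval_add[OF x1, of "f - mps_trunc (Suc n) f" "mps_trunc (Suc n) f"] by simp
        ultimately have "q ^ n * h = q ^ n * (- (q * s))"
          using assms[OF x] s by (simp add: algebra_simps eq_neg_iff_add_eq_0)
        moreover have "q ^ n \<noteq> 0" using p_ge_2 by (simp add: q_def)
        ultimately have "h = - (q * s)" using mult_left_cancel by blast
        then have "h = q * (- s)" by simp
        then show ?thesis unfolding q_def by blast
      qed
      then have "\<exists>s. h = of_nat p ^ m * s" for m
        by (cases m) auto
      then have "h = 0" by (rule Rp.separated)
      then show ?thesis by (simp add: h_def mono_eval_def)
    qed
    from finite_sum_monomials_eq_0[OF _ fin this] have "(\<Sum>k | k \<in> ?S \<and> (\<forall>i\<in>UNIV. k i = l i). mps_coeff f k) = 0" for l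
      by simp
    moreover have "{k. k \<in> ?S \<and> (\<forall>i\<in>UNIV. k i = l i)} = {l}" if "mdeg l = n" for l
      using that by auto
    ultimately have "mps_coeff f l = 0" if "mdeg l = n" for l
      using that by (metis (no_types, lifting) sum.insert finite.emptyI empty_iff sum.empty add_0_right)
    then show ?case using Suc by (auto simp: mps_order_ge_def less_Suc_eq)
  qed
  then show ?thesis
    by (intro mps_eqI) (auto simp: mps_order_ge_def)
qed

lemma mps_filtration_1_iff: "f \<in> mps_filtration 1 \<longleftrightarrow> mps_coeff f 0 \<in> mm"
proof
  assume "f \<in> mps_filtration 1"
  then have "\<forall>l. mps_coeff f l \<in> ideal_power mm (1 - mdeg l)"
    by (simp only: mps_filtration_def mem_Collect_eq simp_thms)
  from spec[OF this, of 0] show "mps_coeff f 0 \<in> mm" by (simp only: mdeg_0 diff_zero ideal_power_1)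
next
  assume *: "mps_coeff f 0 \<in> mm"
  have "mps_coeff f l \<in> ideal_power mm (1 - mdeg l)" for l
  proof (cases "l = 0")
    case True
    then show ?thesis using * by (simp only: mdeg_0 diff_zero ideal_power_1)
  next
    case False
    then have "1 - mdeg l = 0" using mdeg_eq_0_iff[of l] by linarith
    then show ?thesis by simp
  qed
  then show "f \<in> mps_filtration 1" by (simp add: mps_filtration_def)
qed

lemma peval_in_mm:
  fixes x :: "'v::finite \<Rightarrow> 'a"
  assumes "point x" "mps_coeff f 0 \<in> mm"
  shows "R.peval x f \<in> mm"
proof -
  have x1: "range x \<subseteq> ideal_power mm 1" by (rule pointD[OF assms(1)])
  have "{l::'v \<Rightarrow> nat. mdeg l < 1} = {0}" by auto
  then have "R.part x f 1 = mps_coeff f 0" by (simp add: R.part_def)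
  then have "R.peval x f - mps_coeff f 0 \<in> mm"
    using R.peval_part[OF x1, of f 1] ideal_power_1 by metis
  then show ?thesis using mm_simps(2)[OF _ assms(2)] by fastforce
qed

text \<open>Both sides are algebra homomorphisms in \<open>f\<close> with the same values on the
  variables, so \<open>alg_hom_unique\<close> replaces a rearrangement of double series.\<close>

lemma peval_compose:
  fixes g :: "'w::finite \<Rightarrow> ('a, 'v::finite) mps"
  assumes x: "point x" and g: "range g \<subseteq> mps_filtration 1"
  shows "R.peval x (A.peval g f) = R.peval (\<lambda>w. R.peval x (g w)) f"
proof -
  let ?\<phi> = "\<lambda>f. R.peval x (A.peval g f)"
  have x1: "range x \<subseteq> ideal_power mm 1" by (rule pointD[OF x])
  have hom: "R.alg_hom ?\<phi>"
    unfolding R.alg_hom_def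
    by (simp only: A.peval_const A.peval_add[OF g] A.peval_mult[OF g] R.peval_const R.peval_add[OF x1] R.peval_mult[OF x1]) simp
  have v: "?\<phi> (mps_var w) = R.peval x (g w)" for w
    by (simp add: A.peval_var[OF g])
  have "range (\<lambda>w. ?\<phi> (mps_var w)) \<subseteq> ideal_power mm 1"
    unfolding v ideal_power_1 using g peval_in_mm[OF x] mps_filtration_1_iff by blast
  from R.alg_hom_unique[OF hom this] show ?thesis unfolding v .
qed

text \<open>A monomial \<open>l\<close> in series without constant term has order at least
  \<open>mdeg l\<close>; hence the finite sum in the definition of \<open>mps_subst\<close> agrees
  with the truncations in the relevant degrees.\<close>

lemma mps_subst_eq_peval:
  fixes g :: "'w::finite \<Rightarrow> ('a, 'v::finite) mps"
  assumes g: "\<And>w. mps_coeff (g w) 0 = 0"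
  shows "mps_subst f g = A.peval g f"
proof (rule A.peval_eqI[symmetric])
  fix n
  have "\<forall>k. mdeg k < mdeg l \<longrightarrow> mps_coeff (mono_eval g l) k = 0" for l
  proof (rule monomial_induct[where P = "\<lambda>l. \<forall>k. mdeg k < mdeg l \<longrightarrow> mps_coeff (mono_eval g l) k = 0"])
    fix i l
    assume IH: "\<forall>k. mdeg k < mdeg l \<longrightarrow> mps_coeff (mono_eval g l) k = 0"
    have "mps_coeff (g i * mono_eval g l) k = 0" if k: "mdeg k < mdeg (unit_exp i + l)" for k
      unfolding mps_coeff_mult
    proof (rule sum.neutral, safe)
      fix j assume "j \<le> k"
      show "mps_coeff (g i) j * mps_coeff (mono_eval g l) (k - j) = 0"
      proof (cases "j = 0")
        case False
        then have "mdeg j > 0" by (metis mdeg_eq_0_iff gr0I)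
        then have "mdeg (k - j) < mdeg l"
          using mdeg_diff[OF \<open>j \<le> k\<close>] k by simp
        then show ?thesis using IH by simp
      qed (simp add: g)
    qed
    then show "\<forall>k. mdeg k < mdeg (unit_exp i + l) \<longrightarrow> mps_coeff (mono_eval g (unit_exp i + l)) k = 0"
      by (simp only: mono_eval_add mono_eval_unit_exp) blast
  qed simp
  then have order: "mps_coeff (mono_eval g l) k = 0" if "mdeg k < mdeg l" for l k
    using that by blast
  show "mps_subst f g - A.part g f n \<in> mps_filtration n"
    unfolding mps_filtration_def
  proof (intro CollectI allI)
    fix k :: "'v \<Rightarrow> nat"
    show "mps_coeff (mps_subst f g - A.part g f n) k \<in> ideal_power mm (n - mdeg k)"
    proof (cases "mdeg k < n")
      case True
      have "mps_coeff (mps_subst f g) k = (\<Sum>l | mdeg l \<le> mdeg k. mps_coeff f l * mps_coeff (mono_eval g l) k)"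
        by (simp add: mps_subst_def mono_eval_def)
      also have "\<dots> = (\<Sum>l | mdeg l < n. mps_coeff f l * mps_coeff (mono_eval g l) k)"
        using True by (intro sum.mono_neutral_left) (auto simp: order)
      also have "\<dots> = mps_coeff (A.part g f n) k" by (simp add: A.part_def)
      finally show ?thesis by (simp add: ideal_power_zero)
    qed simp
  qed
qed

lemma peval_subst:
  assumes "point x" "\<And>w. mps_coeff (g w) 0 = 0"
  shows "R.peval x (mps_subst f g) = R.peval (\<lambda>w. R.peval x (g w)) f"
  unfolding mps_subst_eq_peval[OF assms(2)]
  by (rule peval_compose[OF assms(1)]) (auto simp: mps_filtration_1_iff assms(2) mm_simps(1) simp del: One_nat_def)

lemma mps_coeff_one: "mps_coeff 1 k = (if k = 0 then 1 else 0)"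
  by (simp add: one_mps_def)

lemma mps_coeff_subst_0:
  fixes f :: "('a, 'w::finite) mps" and g :: "'w \<Rightarrow> ('a, 'v::finite) mps"
  shows "mps_coeff (mps_subst f g) 0 = mps_coeff f 0"
proof -
  have "{l. mdeg l \<le> mdeg (0 :: 'v \<Rightarrow> nat)} = {0 :: 'w \<Rightarrow> nat}" by auto
  then show ?thesis by (simp add: mps_subst_def mps_coeff_one)
qed

lemma mps_coeff_var_0 [simp]: "mps_coeff (mps_var i) 0 = 0"
  by (auto simp: mps_coeff_var fun_eq_iff unit_exp_def)

end

section \<open>The standard group and its translations\<close>

locale standard_fgl = pro_p_ring p mm
  for p :: nat and mm :: "'a::{idom, ring_char_0} set" +
  fixes F :: "'n::finite \<Rightarrow> ('a, 'n + 'n) mps"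
  assumes fgl: "formal_group_law F"
begin

lemma fgl_unit:
  "mps_subst (F i) (case_sum mps_var (\<lambda>_. 0)) = (mps_var i :: ('a, 'n) mps)"
  "mps_subst (F i) (case_sum (\<lambda>_. 0) mps_var) = (mps_var i :: ('a, 'n) mps)"
  using fgl unfolding formal_group_law_def by blast+

lemma F_coeff_0 [simp]: "mps_coeff (F i) 0 = 0"
  using arg_cong[OF fgl_unit(1)[of i], of "\<lambda>f. mps_coeff f 0"] by (simp add: mps_coeff_subst_0)

definition gmul :: "('n \<Rightarrow> 'a) \<Rightarrow> ('n \<Rightarrow> 'a) \<Rightarrow> 'n \<Rightarrow> 'a" where
  "gmul x y = (\<lambda>i. R.peval (case_sum x y) (F i))"

lemma point_case_sum: "point x \<Longrightarrow> point y \<Longrightarrow> point (case_sum x y)"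
  by (auto simp: point_def image_subset_iff split: sum.split)

lemma point_zero [simp]: "point (\<lambda>_. 0)"
  using mm_simps(1) by (auto simp: point_def)

lemma point_gmul: "point x \<Longrightarrow> point y \<Longrightarrow> point (gmul x y)"
  using peval_in_mm[OF point_case_sum, of x y "F _"] mm_simps(1)
  by (auto simp: gmul_def point_def[of "\<lambda>i. R.peval _ (F i)"])

lemma peval_var_point: "point x \<Longrightarrow> R.peval x (mps_var i) = x i"
  by (rule R.peval_var[OF pointD])

lemma peval_zero_point: "point x \<Longrightarrow> R.peval x 0 = 0"
  using R.peval_const[of x 0] by (simp add: mps_const_hom)

lemma gmul_zero:
  assumes x: "point x"
  shows "gmul x (\<lambda>_. 0) = x" "gmul (\<lambda>_. 0) x = x"
proof -
  have "(\<lambda>w. R.peval x (case_sum mps_var (\<lambda>_. 0) w)) = case_sum x (\<lambda>_. 0)"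
    "(\<lambda>w. R.peval x (case_sum (\<lambda>_. 0) mps_var w)) = case_sum (\<lambda>_. 0) x"
    using x by (auto simp: fun_eq_iff peval_var_point peval_zero_point split: sum.split)
  moreover have "mps_coeff (case_sum mps_var (\<lambda>_. 0) w :: ('a, 'n) mps) 0 = 0"
    "mps_coeff (case_sum (\<lambda>_. 0) mps_var w :: ('a, 'n) mps) 0 = 0" for w :: "'n + 'n"
    by (auto split: sum.split)
  ultimately show "gmul x (\<lambda>_. 0) = x" "gmul (\<lambda>_. 0) x = x"
    using peval_subst[OF x, of "case_sum mps_var (\<lambda>_. 0)"] peval_subst[OF x, of "case_sum (\<lambda>_. 0) mps_var"] x
    unfolding gmul_def by (metis (no_types) fgl_unit peval_var_point ext)+
qed

lemma gmul_assoc: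
  assumes x: "point x" and y: "point y" and z: "point z"
  shows "gmul (gmul x y) z = gmul x (gmul y z)"
proof
  fix i
  let ?x = "(\<lambda>j. mps_var (Inl j)) :: 'n \<Rightarrow> ('a, 'n + 'n + 'n) mps"
  let ?y = "(\<lambda>j. mps_var (Inr (Inl j))) :: 'n \<Rightarrow> ('a, 'n + 'n + 'n) mps"
  let ?z = "(\<lambda>j. mps_var (Inr (Inr j))) :: 'n \<Rightarrow> ('a, 'n + 'n + 'n) mps"
  let ?p = "case_sum x (case_sum y z)"
  have p: "point ?p" by (intro point_case_sum x y z)
  have cs: "(\<lambda>w. R.peval ?p (case_sum u v w)) = case_sum (\<lambda>j. R.peval ?p (u j)) (\<lambda>j. R.peval ?p (v j))"
    for u v :: "'n \<Rightarrow> ('a, 'n + 'n + 'n) mps"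
    by (auto simp: fun_eq_iff split: sum.split)
  have v: "R.peval ?p (?x j) = x j" "R.peval ?p (?y j) = y j" "R.peval ?p (?z j) = z j" for j
    by (simp_all add: peval_var_point[OF p])
  have s: "R.peval ?p (mps_subst (F j) (case_sum u w)) = R.peval (case_sum (\<lambda>j. R.peval ?p (u j)) (\<lambda>j. R.peval ?p (w j))) (F j)"
    if "\<And>j. mps_coeff (u j) 0 = 0" "\<And>j. mps_coeff (w j) 0 = 0" for u w :: "'n \<Rightarrow> ('a, 'n + 'n + 'n) mps" and j
  proof -
    have "mps_coeff (case_sum u w k) 0 = 0" for k using that by (auto split: sum.split)
    then have "R.peval ?p (mps_subst (F j) (case_sum u w)) = R.peval (\<lambda>k. R.peval ?p (case_sum u w k)) (F j)"
      by (rule peval_subst[OF p])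
    then show ?thesis unfolding cs .
  qed
  have "mps_subst (F i) (case_sum (\<lambda>j. mps_subst (F j) (case_sum ?x ?y)) ?z) =
      mps_subst (F i) (case_sum ?x (\<lambda>j. mps_subst (F j) (case_sum ?y ?z)))"
    using fgl unfolding formal_group_law_def Let_def by blast
  from arg_cong[OF this, of "R.peval ?p"]
  show "gmul (gmul x y) z i = gmul x (gmul y z) i"
    by (simp add: s mps_coeff_subst_0 v gmul_def)
qed

text \<open>As \<open>F(0, y) = y\<close>, the expression is up to sign the mixed difference, which
  gains one power of \<open>mm\<close>.\<close>

lemma point_diff_step:
  assumes x: "point x" and y: "point y" and y': "point y'" and d: "\<forall>i. y i - y' i \<in> ideal_power mm k"
  shows "(y i - gmul x y i) - (y' i - gmul x y' i) \<in> ideal_power mm (Suc k)"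
proof -
  have "(R.peval (case_sum x y) (F i) - R.peval (case_sum x y') (F i)) -
     (R.peval (case_sum (\<lambda>_. 0) y) (F i) - R.peval (case_sum (\<lambda>_. 0) y') (F i)) \<in> ideal_power mm (Suc k)"
    using x y y' d unfolding point_I1 by (rule R.peval_mixed_difference)
  then have "(gmul x y i - gmul x y' i) - (y i - y' i) \<in> ideal_power mm (Suc k)"
    using gmul_zero(2)[OF y] gmul_zero(2)[OF y'] by (simp add: gmul_def fun_eq_iff)
  from fil.I_uminus[OF this] show ?thesis by (simp add: algebra_simps)
qed

text \<open>Inverses are found as fixed points of the contraction \<open>y \<mapsto> y - xy\<close>.\<close>
lemma gmul_right_inverse:
  assumes x: "point x"
  shows "\<exists>y. point y \<and> gmul x y = (\<lambda>_. 0)"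
proof -
  define T where "T y = (\<lambda>i. y i - gmul x y i)" for y
  define s where "s n = (T ^^ n) (\<lambda>_. 0)" for n
  have diff_mm: "a - b \<in> mm" if "a \<in> mm" "b \<in> mm" for a b
    using fil.I_diff[of a 1 b] that ideal_power_1 by metis
  have pT: "point (T y)" if "point y" for y
    using point_gmul[OF x that] that diff_mm by (auto simp: point_def T_def image_subset_iff)
  have ps: "point (s n)" for n
    by (induction n) (auto simp: s_def pT)
  have step: "\<forall>i. s (Suc n) i - s n i \<in> ideal_power mm n" for n
  proof (induction n)
    case (Suc n)
    have "s (Suc n) = T (s n)" for n by (simp add: s_def)
    then show ?case
      using point_diff_step[OF x ps ps Suc] by (simp add: T_def del: ideal_power.simps)
  qed simp
  have "\<exists>l. \<forall>n. l - s n i \<in> ideal_power mm n" for i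
    by (rule R.I_complete) (use step in blast)
  then obtain y where y: "\<And>i n. y i - s n i \<in> ideal_power mm n" by metis
  have py: "point y"
  proof -
    have "y i \<in> mm" for i
      using fil.I_add[OF y[of i 1], of "s 1 i"] ps[of 1] ideal_power_1 by (auto simp: point_def simp del: ideal_power.simps)
    then show ?thesis by (auto simp: point_def)
  qed
  have "T y i - y i \<in> ideal_power mm n" for i n
  proof -
    have "T y i - T (s n) i \<in> ideal_power mm (Suc n)"
      using point_diff_step[OF x py ps, of n n i] y by (simp add: T_def del: ideal_power.simps)
    moreover have "T (s n) i - y i \<in> ideal_power mm (Suc n)"
      using fil.I_minus_commute[OF y[of i "Suc n"]] by (simp add: s_def del: ideal_power.simps)
    ultimately have "T y i - y i \<in> ideal_power mm (Suc n)" by (rule fil.I_trans)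
    then show ?thesis using fil.I_Suc by blast
  qed
  then have "T y i = y i" for i by (rule R.eqI_mod)
  then have "gmul x y = (\<lambda>_. 0)" by (simp add: T_def fun_eq_iff)
  with py show ?thesis by blast
qed

section \<open>The group of points\<close>

abbreviation G :: "('n \<Rightarrow> 'a) monoid" where "G \<equiv> standard_group mm F mm"

lemma G_simps: "x \<in> carrier G \<longleftrightarrow> point x" "\<one>\<^bsub>G\<^esub> = (\<lambda>_. 0)"
  by (auto simp: standard_group_def point_def)

lemma G_mult: "point x \<Longrightarrow> point y \<Longrightarrow> x \<otimes>\<^bsub>G\<^esub> y = gmul x y"
  using point_case_sum[of x y] by (simp add: standard_group_def gmul_def mps_eval_eq point_def)

lemma group_G: "group G"
proof (rule groupI)
  fix x assume "x \<in> carrier G"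
  then have x: "point x" by (simp add: G_simps)
  obtain y where y: "point y" "gmul x y = (\<lambda>_. 0)" using gmul_right_inverse[OF x] by blast
  obtain z where z: "point z" "gmul y z = (\<lambda>_. 0)" using gmul_right_inverse[OF y(1)] by blast
  \<comment> \<open>The right inverse \<open>z\<close> of \<open>y\<close> equals \<open>x\<close>,
    so the right inverse \<open>y\<close> of \<open>x\<close> is a left inverse as well.\<close>
  have "x = z" using gmul_assoc[OF x y(1) z(1)] gmul_zero x z y by simp
  then show "\<exists>y\<in>carrier G. y \<otimes>\<^bsub>G\<^esub> x = \<one>\<^bsub>G\<^esub>"
    using x y(1) z(2) by (auto simp: G_simps G_mult)
qed (auto simp: G_simps G_mult point_gmul gmul_assoc gmul_zero)

definition ginv :: "('n \<Rightarrow> 'a) \<Rightarrow> 'n \<Rightarrow> 'a" where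
  "ginv x = inv\<^bsub>G\<^esub> x"

lemma ginv:
  assumes "point x"
  shows "point (ginv x)" "gmul x (ginv x) = (\<lambda>_. 0)" "gmul (ginv x) x = (\<lambda>_. 0)" "ginv (ginv x) = x"
  using assms group.inv_closed[OF group_G, of x] group.r_inv[OF group_G, of x] group.l_inv[OF group_G, of x] group.inv_inv[OF group_G, of x]
  by (simp_all add: G_simps G_mult ginv_def)

definition bold_point :: "('n \<Rightarrow> 'a) \<Rightarrow> bool" where
  "bold_point x \<longleftrightarrow> (\<exists>t. x = (\<lambda>i. bpn * t i))"

lemma bold_point_point: "bold_point x \<Longrightarrow> point x"
  unfolding bold_point_def bold_p_eq
  using point_p_multiple[of bold_exponent] by (auto simp: bold_exponent_def)

text \<open>The product is compared with \<open>F(0, 0) = 0\<close>; the arguments differ by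
  multiples of \<open>bpn\<close>, and so do the values.\<close>

lemma bold_point_gmul:
  assumes "bold_point x" "bold_point y"
  shows "bold_point (gmul x y)"
proof -
  obtain s t where st: "x = (\<lambda>i. bpn * s i)" "y = (\<lambda>i. bpn * t i)"
    using assms unfolding bold_point_def by blast
  have "\<exists>r. gmul x y i = bpn * r" for i
  proof -
    have "range (case_sum x y) \<subseteq> ideal_power mm 1" "range (case_sum (\<lambda>_. 0) (\<lambda>_. 0) :: 'n + 'n \<Rightarrow> 'a) \<subseteq> ideal_power mm 1"
      by (intro pointD point_case_sum bold_point_point assms point_zero)+
    moreover have "\<forall>w. case_sum x y w - case_sum (\<lambda>_. 0) (\<lambda>_. 0) w = bpn * case_sum s t w"
      by (auto simp: st split: sum.split)
    ultimately have "\<exists>r. R.peval (case_sum x y) (F i) - R.peval (case_sum (\<lambda>_. 0) (\<lambda>_. 0)) (F i) = bpn * r"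
      by (rule R.peval_cong_factor)
    then show ?thesis
      using gmul_zero(1)[OF point_zero] by (simp add: gmul_def fun_eq_iff)
  qed
  then show ?thesis unfolding bold_point_def by metis
qed

lemma bold_point_ginv:
  assumes "bold_point x"
  shows "bold_point (ginv x)"
proof -
  let ?y = "ginv x"
  have x: "point x" by (rule bold_point_point[OF assms])
  have y: "point ?y" by (rule ginv(1)[OF x])
  obtain s where s: "x = (\<lambda>i. bpn * s i)" using assms unfolding bold_point_def by blast
  have "\<exists>r. ?y i = bpn * r" for i
  proof -
    have "range (case_sum (\<lambda>_. 0) ?y) \<subseteq> ideal_power mm 1" "range (case_sum x ?y) \<subseteq> ideal_power mm 1"
      by (intro pointD point_case_sum x y point_zero)+
    \<comment> \<open>\<open>F(0, y) = y\<close> and \<open>F(x, y) = 0\<close> are values at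
      arguments that differ by multiples of \<open>bpn\<close>.\<close>
    moreover have "\<forall>w. case_sum (\<lambda>_. 0) ?y w - case_sum x ?y w = bpn * case_sum (\<lambda>i. - s i) (\<lambda>_. 0) w"
      by (auto simp: s split: sum.split)
    ultimately have "\<exists>r. R.peval (case_sum (\<lambda>_. 0) ?y) (F i) - R.peval (case_sum x ?y) (F i) = bpn * r"
      by (rule R.peval_cong_factor)
    then show ?thesis
      using gmul_zero(2)[OF y] ginv(2)[OF x] by (simp add: gmul_def fun_eq_iff)
  qed
  then show ?thesis unfolding bold_point_def by metis
qed

text \<open>Explicit form of the right translation: substitution of \<open>F(X, x)\<close> for
  \<open>X\<close>. It uses \<open>A.peval\<close> because \<open>mps_subst\<close> is meant for
  series without constant term, whereas the components of \<open>x\<close> are constants from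
  \<open>mm\<close>.\<close>

definition rho :: "('n \<Rightarrow> 'a) \<Rightarrow> ('a, 'n) mps \<Rightarrow> ('a, 'n) mps" where
  "rho x = A.peval (\<lambda>i. A.peval (case_sum mps_var (\<lambda>j. mps_const (x j))) (F i))"

definition lam :: "('n \<Rightarrow> 'a) \<Rightarrow> ('a, 'n) mps \<Rightarrow> ('a, 'n) mps" where
  "lam x = A.peval (\<lambda>i. A.peval (case_sum (\<lambda>j. mps_const (ginv x j)) mps_var) (F i))"

lemma filtration_points:
  assumes "point x"
  shows "range (case_sum mps_var (\<lambda>j. mps_const (x j)) :: 'n + 'n \<Rightarrow> ('a, 'n) mps) \<subseteq> mps_filtration 1"
    "range (case_sum (\<lambda>j. mps_const (x j)) mps_var :: 'n + 'n \<Rightarrow> ('a, 'n) mps) \<subseteq> mps_filtration 1"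
  using assms mm_simps(1)
  by (auto simp: mps_filtration_1_iff point_def image_subset_iff mps_coeff_const simp del: One_nat_def split: sum.split)

lemma filtration_peval_F:
  assumes "range b \<subseteq> mps_filtration 1"
  shows "range (\<lambda>i. A.peval b (F i) :: ('a, 'n) mps) \<subseteq> mps_filtration 1"
proof -
  have "mps_coeff (A.peval b (F i) :: ('a, 'n) mps) 0 \<in> mm" for i
  proof -
    \<comment> \<open>The constant term is the value at the origin, to which
      \<open>peval_compose\<close> applies.\<close>
    have "mps_coeff (A.peval b (F i)) 0 = R.peval (\<lambda>_. 0) (A.peval b (F i))"
    proof -
      have "R.peval (\<lambda>_::'n. 0) g = mps_coeff g 0" for g :: "('a, 'n) mps"
      proof (rule R.peval_eqI)
        fix n
        have "mono_eval (\<lambda>_::'n. 0::'a) l = (if l = 0 then 1 else 0)" for l :: "'n \<Rightarrow> nat"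
          by (auto simp: mono_eval_def fun_eq_iff)
        then have "R.part (\<lambda>_::'n. 0) g n = (\<Sum>l::'n \<Rightarrow> nat | mdeg l < n. if l = 0 then mps_coeff g 0 else 0)"
          unfolding R.part_def by (intro sum.cong) auto
        then show "mps_coeff g 0 - R.part (\<lambda>_::'n. 0) g n \<in> ideal_power mm n"
          by (cases n) (auto simp: ideal_power_zero simp del: ideal_power.simps(2))
      qed
      then show ?thesis by simp
    qed
    also have "\<dots> = R.peval (\<lambda>w. R.peval (\<lambda>_. 0) (b w)) (F i)"
      by (rule peval_compose[OF point_zero assms])
    also have "\<dots> \<in> mm"
    proof (rule peval_in_mm)
      show "point (\<lambda>w. R.peval (\<lambda>_. 0) (b w))"
        unfolding point_def using assms peval_in_mm[OF point_zero] mps_filtration_1_iff by blast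
      show "mps_coeff (F i) 0 \<in> mm" using mm_simps(1) by simp
    qed
    finally show ?thesis .
  qed
  then show ?thesis using mps_filtration_1_iff by blast
qed

lemma peval_rho:
  assumes x: "point x" and y: "point y"
  shows "R.peval y (rho x f) = R.peval (gmul y x) f"
proof -
  have "R.peval y (rho x f) = R.peval (\<lambda>i. R.peval y (A.peval (case_sum mps_var (\<lambda>j. mps_const (x j))) (F i))) f"
    unfolding rho_def by (rule peval_compose[OF y filtration_peval_F[OF filtration_points(1)[OF x]]])
  also have "(\<lambda>i. R.peval y (A.peval (case_sum mps_var (\<lambda>j. mps_const (x j))) (F i))) =
      (\<lambda>i. R.peval (\<lambda>w. R.peval y (case_sum mps_var (\<lambda>j. mps_const (x j)) w)) (F i))"
    by (intro ext peval_compose[OF y filtration_points(1)[OF x]])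
  also have "(\<lambda>w. R.peval y (case_sum mps_var (\<lambda>j. mps_const (x j)) w)) = case_sum y x"
    by (auto simp: fun_eq_iff peval_var_point[OF y] R.peval_const split: sum.split)
  finally show ?thesis by (simp add: gmul_def)
qed

lemma peval_lam:
  assumes x: "point x" and y: "point y"
  shows "R.peval y (lam x f) = R.peval (gmul (ginv x) y) f"
proof -
  note x' = ginv(1)[OF x]
  have "R.peval y (lam x f) = R.peval (\<lambda>i. R.peval y (A.peval (case_sum (\<lambda>j. mps_const (ginv x j)) mps_var) (F i))) f"
    unfolding lam_def by (rule peval_compose[OF y filtration_peval_F[OF filtration_points(2)[OF x']]])
  also have "(\<lambda>i. R.peval y (A.peval (case_sum (\<lambda>j. mps_const (ginv x j)) mps_var) (F i))) =
      (\<lambda>i. R.peval (\<lambda>w. R.peval y (case_sum (\<lambda>j. mps_const (ginv x j)) mps_var w)) (F i))"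
    by (intro ext peval_compose[OF y filtration_points(2)[OF x']])
  also have "(\<lambda>w. R.peval y (case_sum (\<lambda>j. mps_const (ginv x j)) mps_var w)) = case_sum (ginv x) y"
    by (auto simp: fun_eq_iff peval_var_point[OF y] R.peval_const split: sum.split)
  finally show ?thesis by (simp add: gmul_def)
qed

lemma peval_inject:
  assumes "\<And>x. point x \<Longrightarrow> R.peval x f = R.peval x g"
  shows "f = g"
proof -
  have "R.peval x (f - g) = 0" if "point x" for x
    using R.peval_add[OF pointD[OF that], of "f - g" g] assms[OF that] by simp
  then show ?thesis using peval_faithful[of "f - g"] by simp
qed

lemma mps_eval_point: "point x \<Longrightarrow> mps_eval mm f x = R.peval x f"
  by (simp add: mps_eval_eq point_def)

text \<open>The description by values determines the series because evaluation at points is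
  faithful.\<close>

lemma right_trans_eq:
  assumes x: "point x"
  shows "right_trans mm F x f = rho x f"
  unfolding right_trans_def Let_def
proof (rule the_equality)
  show "\<forall>y\<in>carrier G. mps_eval mm (rho x f) y = mps_eval mm f (y \<otimes>\<^bsub>G\<^esub> x)"
    using x by (simp add: G_simps G_mult mps_eval_point point_gmul peval_rho)
  fix g assume "\<forall>y\<in>carrier G. mps_eval mm g y = mps_eval mm f (y \<otimes>\<^bsub>G\<^esub> x)"
  then show "g = rho x f"
    using x by (intro peval_inject) (simp add: G_simps G_mult mps_eval_point point_gmul peval_rho)
qed

lemma left_trans_eq:
  assumes x: "point x"
  shows "left_trans mm F x f = lam x f"
  unfolding left_trans_def Let_def ginv_def[symmetric]
proof (rule the_equality)
  show "\<forall>y\<in>carrier G. mps_eval mm (lam x f) y = mps_eval mm f (ginv x \<otimes>\<^bsub>G\<^esub> y)"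
    using x by (simp add: G_simps G_mult mps_eval_point point_gmul peval_lam ginv)
  fix g assume "\<forall>y\<in>carrier G. mps_eval mm g y = mps_eval mm f (ginv x \<otimes>\<^bsub>G\<^esub> y)"
  then show "g = lam x f"
    using x by (intro peval_inject) (simp add: G_simps G_mult mps_eval_point point_gmul peval_lam ginv)
qed

lemma alg_hom_rho: "point x \<Longrightarrow> A.alg_hom (rho x)"
  unfolding rho_def by (intro A.alg_hom_peval filtration_peval_F filtration_points)

lemma alg_hom_lam: "point x \<Longrightarrow> A.alg_hom (lam x)"
  unfolding lam_def by (intro A.alg_hom_peval filtration_peval_F filtration_points ginv)

lemma alg_hom_End: "A.alg_hom \<phi> \<Longrightarrow> \<phi> \<in> mps_End"
  by (simp add: A.alg_hom_def mps_End_iff)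

lemma rho_mult: "point x \<Longrightarrow> point y \<Longrightarrow> rho x (rho y f) = rho (gmul x y) f"
  by (rule peval_inject) (simp add: peval_rho point_gmul gmul_assoc)

lemma rho_zero: "rho (\<lambda>_. 0) f = f"
  by (rule peval_inject) (simp add: peval_rho gmul_zero)

lemma rho_lam: "point x \<Longrightarrow> point y \<Longrightarrow> rho x (lam y f) = lam y (rho x f)"
  by (rule peval_inject) (simp add: peval_rho peval_lam point_gmul gmul_assoc ginv)

lemma rho_inject:
  assumes "point x" "point y" "\<And>f. rho x f = rho y f"
  shows "x = y"
proof
  fix i
  have "R.peval (\<lambda>_. 0) (rho x (mps_var i)) = R.peval (\<lambda>_. 0) (rho y (mps_var i))"
    using assms(3) by simp
  then show "x i = y i"
    using assms(1,2) by (simp add: peval_rho gmul_zero peval_var_point)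
qed

lemma A_peval_var:
  fixes f :: "('a, 'n) mps"
  shows "A.peval mps_var f = f"
proof -
  have "A.alg_hom (\<lambda>f :: ('a, 'n) mps. f)" by (simp add: A.alg_hom_def)
  moreover have "range (mps_var :: 'n \<Rightarrow> ('a, 'n) mps) \<subseteq> mps_filtration 1"
    using mm_simps(1) by (auto simp: mps_filtration_1_iff simp del: One_nat_def)
  ultimately show ?thesis using A.alg_hom_unique[of "\<lambda>f. f" f] by simp
qed

text \<open>\<open>rho x\<close> and the identity are the substitutions of \<open>F(X, x)\<close>
  and \<open>F(X, 0) = X\<close>. Two applications of \<open>peval_cong_factor\<close> carry the
  divisibility of \<open>x\<close> first to these tuples and then to \<open>f\<close>.\<close>

lemma rho_cong:
  assumes "bold_point x"
  shows "\<exists>g. rho x f - f = bpn * g"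
proof -
  obtain t where t: "x = (\<lambda>i. bpn * t i)" using assms unfolding bold_point_def by blast
  have x: "point x" by (rule bold_point_point[OF assms])
  let ?b = "case_sum mps_var (\<lambda>j. mps_const (x j)) :: 'n + 'n \<Rightarrow> ('a, 'n) mps"
  let ?c = "case_sum mps_var (\<lambda>_. 0) :: 'n + 'n \<Rightarrow> ('a, 'n) mps"
  have b0: "range ?c \<subseteq> mps_filtration 1"
    using filtration_points(1)[OF point_zero] unfolding mps_const_hom .
  have var: "A.peval ?c (F i) = mps_var i" for i
    using fgl_unit(1)[of i] by (subst mps_subst_eq_peval[symmetric]) (auto split: sum.split)
  have "\<forall>w. ?b w - ?c w = bpn * case_sum (\<lambda>_. 0) (\<lambda>j. mps_const (t j)) w"
  proof
    fix w :: "'n + 'n"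
    show "?b w - ?c w = bpn * case_sum (\<lambda>_. 0) (\<lambda>j. mps_const (t j)) w"
    proof (cases w)
      case (Inr j)
      have "mps_const (x j) = (bpn * mps_const (t j) :: ('a, 'n) mps)"
        by (simp only: t mps_const_hom mps_const_of_nat)
      then show ?thesis unfolding Inr by simp
    qed simp
  qed
  then have "\<exists>s. A.peval ?b (F i) - A.peval ?c (F i) = bpn * s" for i
    by (rule A.peval_cong_factor[OF filtration_points(1)[OF x] b0])
  then obtain s where s: "\<forall>i. A.peval ?b (F i) - mps_var i = bpn * s i"
    unfolding var by metis
  have "range (mps_var :: 'n \<Rightarrow> ('a, 'n) mps) \<subseteq> mps_filtration 1"
    using mm_simps(1) by (auto simp: mps_filtration_1_iff simp del: One_nat_def)
  from A.peval_cong_factor[OF filtration_peval_F[OF filtration_points(1)[OF x]] this s, of f]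
  show ?thesis by (simp add: rho_def A_peval_var)
qed

end


section \<open>Exponentials of left invariant derivations\<close>

definition is_derivation :: "('a::comm_ring_1, 'v::finite) mps_endo \<Rightarrow> bool" where
  "is_derivation D \<longleftrightarrow> (\<forall>f g. app D (f * g) = app D f * g + f * app D g)"

lemma derivation_mult: "is_derivation D \<Longrightarrow> app D (f * g) = app D f * g + f * app D g"
  by (simp add: is_derivation_def)

lemma derivation_one: "is_derivation D \<Longrightarrow> app D 1 = 0"
  using derivation_mult[of D 1 1] by simp

lemma derivation_power_mult:
  assumes D: "is_derivation D"
  shows "app (D ^ n) (f * g) = (\<Sum>i\<le>n. of_nat (n choose i) * (app (D ^ i) f * app (D ^ (n - i)) g))"
proof (induction n)
  case (Suc n)
  let ?u = "\<lambda>i. app (D ^ i) f" and ?v = "\<lambda>i. app (D ^ i) g"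
  have D_sum: "app D (sum h A) = (\<Sum>i\<in>A. app D (h i))" for h :: "nat \<Rightarrow> _" and A
    by (induction A rule: infinite_finite_induct) (auto simp: app_linear)
  have "app (D ^ Suc n) (f * g) = (\<Sum>i\<le>n. of_nat (n choose i) * app D (?u i * ?v (n - i)))"
    by (simp add: Suc D_sum app_mult_of_nat)
  also have "\<dots> = (\<Sum>i\<le>n. of_nat (n choose i) * (?u (Suc i) * ?v (n - i))) +
      (\<Sum>i\<le>n. of_nat (n choose i) * (?u i * ?v (Suc n - i)))"
    by (simp add: derivation_mult[OF D] distrib_left Suc_diff_le flip: sum.distrib)
  also have "(\<Sum>i\<le>n. of_nat (n choose i) * (?u i * ?v (Suc n - i))) =
      (\<Sum>i\<le>Suc n. of_nat (n choose i) * (?u i * ?v (Suc n - i)))"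
    by (simp add: binomial_eq_0)
  also have "\<dots> = ?u 0 * ?v (Suc n) + (\<Sum>i\<le>n. of_nat (n choose Suc i) * (?u (Suc i) * ?v (n - i)))"
    by (subst sum.atMost_Suc_shift) simp
  also have "(\<Sum>i\<le>n. of_nat (n choose i) * (?u (Suc i) * ?v (n - i))) + \<dots> =
      ?u 0 * ?v (Suc n) + (\<Sum>i\<le>n. of_nat (Suc n choose Suc i) * (?u (Suc i) * ?v (n - i)))"
    by (simp add: algebra_simps sum.distrib)
  also have "\<dots> = (\<Sum>i\<le>Suc n. of_nat (Suc n choose i) * (?u i * ?v (Suc n - i)))"
    by (subst sum.atMost_Suc_shift) simp
  finally show ?case .
qed simp

lemma derivation_scale: "is_derivation D \<Longrightarrow> is_derivation (of_nat n * D)"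
  by (simp add: is_derivation_def algebra_simps)

context pro_p_ring
begin

text \<open>Leibniz's rule for the \<open>n\<close>-th power, freed of its binomial coefficients by
  dividing by \<open>n!\<close>; the division is a cancellation in a torsion-free ring.\<close>

lemma derivation_exp_term_mult:
  assumes D: "is_derivation D"
  shows "app (Ep.exp_term D n) (f * g) = (\<Sum>i\<le>n. app (Ep.exp_term D i) f * app (Ep.exp_term D (n - i)) g)"
proof -
  have e: "app ((bpn * D) ^ k) h = of_nat (fact k) * app (Ep.exp_term D k) h" for k h
    by (simp add: Ep.fact_mult_exp_term[symmetric] del: of_nat_fact)
  have "of_nat (fact n) * app (Ep.exp_term D n) (f * g) = app ((bpn * D) ^ n) (f * g)"
    by (simp only: e)
  also have "\<dots> = (\<Sum>i\<le>n. of_nat (n choose i) * (app ((bpn * D) ^ i) f * app ((bpn * D) ^ (n - i)) g))"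
    by (rule derivation_power_mult[OF derivation_scale[OF D]])
  also have "\<dots> = (\<Sum>i\<le>n. of_nat (fact n) * (app (Ep.exp_term D i) f * app (Ep.exp_term D (n - i)) g))"
  proof (rule sum.cong[OF refl])
    fix i assume "i \<in> {..n}"
    then have "fact i * fact (n - i) * (n choose i) = (fact n :: nat)"
      by (intro binomial_fact_lemma) simp
    then have "(of_nat (fact n) :: ('a, 'b) mps) = of_nat (n choose i) * (of_nat (fact i) * of_nat (fact (n - i)))"
      by (metis mult.commute of_nat_mult)
    then show "of_nat (n choose i) * (app ((bpn * D) ^ i) f * app ((bpn * D) ^ (n - i)) g) =
        of_nat (fact n) * (app (Ep.exp_term D i) f * app (Ep.exp_term D (n - i)) g)"
      unfolding e by (simp only: mult_ac)
  qed
  also have "\<dots> = of_nat (fact n) * (\<Sum>i\<le>n. app (Ep.exp_term D i) f * app (Ep.exp_term D (n - i)) g)"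
    by (simp only: sum_distrib_left)
  finally show ?thesis by (rule Ap.of_nat_mult_cancel) simp
qed

lemma pexp_derivation_mult:
  assumes "is_derivation D"
  shows "app (Ep.pexp D) (f * g) = app (Ep.pexp D) f * app (Ep.pexp D) g"
proof (rule Ap.psums_unique)
  show "Ap.psums (\<lambda>n. app (Ep.exp_term D n) (f * g)) (app (Ep.pexp D) (f * g))"
    by (rule psums_app[OF Ep.psums_exp_term])
  show "Ap.psums (\<lambda>n. app (Ep.exp_term D n) (f * g)) (app (Ep.pexp D) f * app (Ep.pexp D) g)"
    unfolding derivation_exp_term_mult[OF assms]
    by (intro Ap.psums_product psums_app Ep.psums_exp_term)
qed

lemma pexp_derivation_one:
  fixes D :: "('a, 'v::finite) mps_endo"
  assumes D: "is_derivation D"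
  shows "app (Ep.pexp D) 1 = 1"
proof (rule Ap.psums_unique)
  show "Ap.psums (\<lambda>n. app (Ep.exp_term D n) 1) (app (Ep.pexp D) 1)"
    by (rule psums_app[OF Ep.psums_exp_term])
  have "app (Ep.exp_term D n) 1 = 0" if "n \<ge> 1" for n
  proof -
    from that obtain k where n: "n = Suc k" by (cases n) auto
    have "of_nat (fact n) * app (Ep.exp_term D n) 1 = app ((bpn * D) ^ n) 1"
      by (simp add: Ep.fact_mult_exp_term[symmetric] del: of_nat_fact)
    also have "\<dots> = app ((bpn * D) ^ k) (app (bpn * D) 1)"
      by (simp only: n power_Suc2 app_simps)
    also have "\<dots> = of_nat (fact n) * 0"
      using derivation_one[OF derivation_scale[OF D]] by simp
    finally show ?thesis by (rule Ap.of_nat_mult_cancel) simp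
  qed
  then have "Ap.psums (\<lambda>n. app (Ep.exp_term D n) 1) (\<Sum>n<1. app (Ep.exp_term D n) 1)"
    by (rule Ap.psums_finite)
  then show "Ap.psums (\<lambda>n. app (Ep.exp_term D n) 1) 1"
    by (simp add: Ep.exp_term_def)
qed

lemma alg_hom_pexp: "is_derivation D \<Longrightarrow> A.alg_hom (app (Ep.pexp D))"
  unfolding A.alg_hom_def
  using app_linear(2)[of "Ep.pexp D" _ 1] by (simp add: app_linear pexp_derivation_mult pexp_derivation_one)

end

section \<open>Left invariant derivations\<close>

context standard_fgl
begin

definition Lam :: "('n \<Rightarrow> 'a) \<Rightarrow> ('a, 'n) mps_endo" where "Lam x = Endo (lam x)"
definition Rho :: "('n \<Rightarrow> 'a) \<Rightarrow> ('a, 'n) mps_endo" where "Rho x = Endo (rho x)"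

lemma app_Lam: "point x \<Longrightarrow> app (Lam x) = lam x"
  by (simp add: Lam_def Endo_inverse alg_hom_End alg_hom_lam)

lemma app_Rho: "point x \<Longrightarrow> app (Rho x) = rho x"
  by (simp add: Rho_def Endo_inverse alg_hom_End alg_hom_rho)

definition L :: "('a, 'n) mps_endo set" where
  "L = {D. is_derivation D \<and> (\<forall>x. point x \<longrightarrow> D * Lam x = Lam x * D)}"

lemma left_inv_der_eq: "left_inv_der mm F = app ` L"
proof -
  have "app D \<in> left_inv_der mm F \<longleftrightarrow> D \<in> L" for D
  proof -
    have "(\<forall>f. app D (lam x f) = lam x (app D f)) \<longleftrightarrow> D * Lam x = Lam x * D" if "point x" for x
    proof -
      have "D * Lam x = Lam x * D \<longleftrightarrow> (\<forall>f. app (D * Lam x) f = app (Lam x * D) f)"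
        by (auto intro: endo_eqI simp del: app_simps)
      then show ?thesis by (simp add: app_Lam[OF that])
    qed
    then show ?thesis
      unfolding left_inv_der_def L_def is_derivation_def by (auto simp: G_simps left_trans_eq)
  qed
  moreover have "w \<in> range app" if "w \<in> left_inv_der mm F" for w
  proof -
    have "w \<in> mps_End" using that by (simp add: left_inv_der_def)
    then show ?thesis using Endo_inverse by (metis rangeI)
  qed
  ultimately show ?thesis by blast
qed

lemma L_add: "D \<in> L \<Longrightarrow> E \<in> L \<Longrightarrow> D + E \<in> L"
  by (simp add: L_def is_derivation_def algebra_simps)

lemma L_zero: "0 \<in> L"
  by (simp add: L_def is_derivation_def)

lemma L_of_int_mult: "D \<in> L \<Longrightarrow> of_int z * D \<in> L"
proof -
  assume D: "D \<in> L"
  have "of_int z * D * Lam x = Lam x * (of_int z * D)" if "point x" for x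
  proof -
    have "of_int z * D * Lam x = of_int z * (Lam x * D)" using D that by (simp add: L_def mult.assoc)
    also have "\<dots> = Lam x * (of_int z * D)"
      using mult_of_int_commute[of z "Lam x"] by (simp flip: mult.assoc)
    finally show ?thesis .
  qed
  then show ?thesis
    using D by (simp add: L_def is_derivation_def algebra_simps)
qed

lemma L_of_nat_mult: "D \<in> L \<Longrightarrow> of_nat n * D \<in> L"
  using L_of_int_mult[of D "int n"] by simp

text \<open>The conditions defining \<open>L\<close> are linear and the modules torsion free.
  Divided elements arise both for logarithms and for the partial sums of the
  Baker--Campbell--Hausdorff series.\<close>

lemma L_divide:
  assumes "of_nat n * D \<in> L" "n > 0"
  shows "D \<in> L"
proof -
  have "app D (f * g) = app D f * g + f * app D g" for f g
  proof (rule Ap.of_nat_mult_cancel[OF _ assms(2)])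
    show "of_nat n * app D (f * g) = of_nat n * (app D f * g + f * app D g)"
      using assms(1) by (simp add: L_def is_derivation_def algebra_simps)
  qed
  moreover have "D * Lam x = Lam x * D" if "point x" for x
  proof (rule Ep.of_nat_mult_cancel[OF _ assms(2)])
    show "of_nat n * (D * Lam x) = of_nat n * (Lam x * D)"
    proof -
      have "of_nat n * (D * Lam x) = Lam x * (of_nat n * D)"
        using assms(1) that by (simp add: L_def flip: mult.assoc)
      also have "\<dots> = of_nat n * (Lam x * D)"
        using mult_of_nat_commute[of n "Lam x"] by (simp flip: mult.assoc)
      finally show ?thesis .
    qed
  qed
  ultimately show ?thesis by (simp add: L_def is_derivation_def)
qed

lemma L_ad: "D \<in> L \<Longrightarrow> E \<in> L \<Longrightarrow> ad D E \<in> L"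
proof -
  assume D: "D \<in> L" and E: "E \<in> L"
  have "U * V * Lam x = Lam x * (U * V)" if "U * Lam x = Lam x * U" "V * Lam x = Lam x * V" for U V x
    using that by (metis mult.assoc)
  then have "D * E * Lam x = Lam x * (D * E)" "E * D * Lam x = Lam x * (E * D)" if "point x" for x
    using D E that unfolding L_def by blast+
  moreover have "is_derivation (ad D E)"
    using D E by (simp add: L_def is_derivation_def ad_def app_linear algebra_simps)
  ultimately show ?thesis by (simp add: L_def ad_def algebra_simps)
qed

lemma L_lie_monomial: "a \<in> L \<Longrightarrow> b \<in> L \<Longrightarrow> lie_monomial_eval ad a b t \<in> L"
  by (induction t) (auto intro: L_ad)

lemma peval_of_nat_mult: "point x \<Longrightarrow> R.peval x (of_nat n * f) = of_nat n * R.peval x f"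
  using R.peval_mult[OF pointD, of x "of_nat n" f] R.peval_const[of x "of_nat n"]
  by (simp add: mps_const_of_nat)

lemma exp_in_rho:
  assumes "D \<in> L"
  shows "\<exists>z. bold_point z \<and> Ep.pexp D = Rho z"
proof -
  let ?e = "Ep.pexp D"
  have D: "is_derivation D" using assms by (simp add: L_def)
  have hom: "A.alg_hom (app ?e)" by (rule alg_hom_pexp[OF D])
  define z where "z i = R.peval (\<lambda>_. 0) (app ?e (mps_var i))" for i
  \<comment> \<open>Since a variable vanishes at the origin, only the part \<open>bpn * u\<close>
    contributes to \<open>z\<close>.\<close>
  obtain u where u: "?e = 1 + bpn * u" using Ep.pexp_eq_one_plus by blast
  have "z i = bpn * R.peval (\<lambda>_. 0) (app u (mps_var i))" for i
    unfolding z_def u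
    by (simp add: R.peval_add[OF pointD[OF point_zero]] peval_var_point peval_of_nat_mult)
  then have "z = (\<lambda>i. bpn * R.peval (\<lambda>_. 0) (app u (mps_var i)))" by (rule ext)
  then have bz: "bold_point z" unfolding bold_point_def
    by (intro exI[of _ "\<lambda>i. R.peval (\<lambda>_. 0) (app u (mps_var i))"])
  then have z: "point z" by (rule bold_point_point)
  have "R.alg_hom (\<lambda>f. R.peval (\<lambda>_. 0) (app ?e f))"
    using hom pointD[OF point_zero]
    by (simp add: R.alg_hom_def A.alg_hom_def R.peval_add R.peval_mult R.peval_const)
  then have at_0: "R.peval (\<lambda>_. 0) (app ?e f) = R.peval z f" for f
    using R.alg_hom_unique[of "\<lambda>f. R.peval (\<lambda>_. 0) (app ?e f)" f] pointD[OF z] by (simp add: z_def[abs_def])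
  have "app ?e f = rho z f" for f :: "('a, 'n) mps"
  proof (rule peval_inject)
    fix y :: "'n \<Rightarrow> 'a"
    assume y: "point y"
    have y': "point (ginv y)" by (rule ginv(1)[OF y])
    have "Lam (ginv y) * D = D * Lam (ginv y)" using assms y' by (simp add: L_def)
    then have "Lam (ginv y) * ?e = ?e * Lam (ginv y)" by (rule Ep.pexp_commute)
    then have comm: "lam (ginv y) (app ?e f) = app ?e (lam (ginv y) f)"
      using app_Lam[OF y'] app_simps(6) by metis
    \<comment> \<open>Translation by the inverse of \<open>y\<close> moves the value at
      \<open>y\<close> to the origin; invariance of \<open>D\<close> lets the translation pass the
      exponential.\<close>
    have "R.peval y (app ?e f) = R.peval (\<lambda>_. 0) (lam (ginv y) (app ?e f))"
      by (simp add: peval_lam[OF y' point_zero] ginv(4)[OF y] gmul_zero(1)[OF y])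
    also have "\<dots> = R.peval z (lam (ginv y) f)" unfolding comm by (rule at_0)
    also have "\<dots> = R.peval y (rho z f)"
      by (simp add: peval_lam[OF y' z] peval_rho[OF z y] ginv(4)[OF y])
    finally show "R.peval y (app ?e f) = R.peval y (rho z f)" .
  qed
  then have "?e = Rho z" by (intro endo_eqI) (simp add: app_Rho[OF z])
  with bz show ?thesis by blast
qed

lemma app_Rho_power_mult:
  assumes "point x"
  shows "app (Rho x ^ n) (f * g) = app (Rho x ^ n) f * app (Rho x ^ n) g"
  by (induction n) (use alg_hom_rho[OF assms] in \<open>simp_all add: app_Rho[OF assms] A.alg_hom_def\<close>)

text \<open>The logarithm \<open>C\<close> of \<open>\<sigma> = \<rho>\<^sub>z\<close> is the limit of \<open>(\<sigma>\<^sup>q - 1)/q\<close> for \<open>q = p\<^sup>k\<close>, and the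
  automorphisms \<open>\<sigma>\<^sup>q\<close> commute with the left translations.\<close>
lemma rho_in_exp:
  assumes "bold_point z"
  shows "\<exists>D\<in>L. Ep.pexp D = Rho z"
proof -
  have z: "point z" by (rule bold_point_point[OF assms])
  have "\<exists>u. Rho z - 1 = bpn * u"
    by (rule endo_divide[OF Ep.bp_gt_0]) (use rho_cong[OF assms] in \<open>simp add: app_Rho[OF z]\<close>)
  then obtain u where u: "Rho z = 1 + bpn * u" by (auto simp: algebra_simps)
  obtain c where c: "Ep.pexp c = Rho z" using Ep.pexp_surj[of u] u by auto
  define C where "C = bpn * c"
  have "\<exists>r. Rho z ^ (p ^ k) = 1 + of_nat p ^ k * (C + of_nat p ^ k * r)" for k
  proof -
    have "Ep.pmult (2 * k) (Rho z ^ (p ^ k) - 1 - bpn * (of_nat p ^ k * c))"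
      using Ep.pexp_linear[of k c] Ep.pexp_power[of c "p ^ k"] c by simp
    then obtain r where "Rho z ^ (p ^ k) - 1 - bpn * (of_nat p ^ k * c) = of_nat p ^ (2 * k) * r"
      unfolding Ep.pmult_def by blast
    moreover have "bpn * (of_nat p ^ k * c) = of_nat p ^ k * C"
      unfolding C_def by (metis mult.assoc Ep.of_nat_power_commute)
    moreover have "of_nat p ^ (2 * k) * r = of_nat p ^ k * (of_nat p ^ k * r)"
      by (simp add: mult_2 power_add mult.assoc)
    ultimately show ?thesis by (intro exI[of _ r]) (simp add: algebra_simps)
  qed
  then obtain r where r: "\<And>k. Rho z ^ (p ^ k) = 1 + of_nat p ^ k * (C + of_nat p ^ k * r k)" by metis
  have "is_derivation C"
    unfolding is_derivation_def
  proof (intro allI)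
    fix f g
    let ?X = "app C (f * g) - (app C f * g + f * app C g)"
    have "Ap.pmult k ?X" for k
    proof -
      let ?q = "of_nat p ^ k :: ('a, 'n) mps"
      define d where "d = C + of_nat p ^ k * r k"
      have app_r: "app (Rho z ^ (p ^ k)) h = h + ?q * app d h" for h
        unfolding r d_def[symmetric] by simp
      \<comment> \<open>Multiplicativity of the power of \<open>Rho z\<close> makes the difference
        quotient \<open>d\<close> a derivation up to the error
        \<open>?q * (app d f * app d g)\<close>; \<open>C\<close> is congruent to \<open>d\<close>
        modulo \<open>?q\<close>.\<close>
      have "?q * app d (f * g) = ?q * (app d f * g + f * app d g + ?q * (app d f * app d g))"
        using app_Rho_power_mult[OF z, of "p ^ k" f g] unfolding app_r by (simp add: algebra_simps)
      then have "app d (f * g) = app d f * g + f * app d g + ?q * (app d f * app d g)"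
        by (rule Ap.p_power_cancel)
      moreover define v where "v = app d f * app d g"
      moreover have "app d h = app C h + ?q * app (r k) h" for h by (simp add: d_def)
      ultimately have "app C (f * g) + ?q * app (r k) (f * g) =
          (app C f + ?q * app (r k) f) * g + f * (app C g + ?q * app (r k) g) + ?q * v"
        by simp
      then have "?X = ?q * (v - app (r k) (f * g) + app (r k) f * g + f * app (r k) g)"
        by (simp add: algebra_simps)
      then show ?thesis by (auto simp: Ap.pmult_def)
    qed
    then have "?X = 0" by (rule Ap.eq_0_if_pmult)
    then show "app C (f * g) = app C f * g + f * app C g" by simp
  qed
  moreover have "C * Lam x = Lam x * C" if x: "point x" for x
  proof -
    have "Rho z * Lam x = Lam x * Rho z"
      by (rule endo_eqI) (simp add: app_Rho[OF z] app_Lam[OF x] rho_lam[OF z x])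
    then have comm: "Rho z ^ n * Lam x = Lam x * Rho z ^ n" for n
      by (metis power_commuting_commutes)
    have "Ep.pmult k (C * Lam x - Lam x * C)" for k
    proof -
      let ?q = "of_nat p ^ k :: ('a, 'n) mps_endo"
      define d where "d = C + ?q * r k"
      have "(1 + ?q * d) * Lam x = Lam x * (1 + ?q * d)"
        using comm[of "p ^ k"] unfolding r d_def[symmetric] .
      then have "?q * (d * Lam x) = Lam x * ?q * d" by (simp add: algebra_simps)
      then have "?q * (d * Lam x) = ?q * (Lam x * d)"
        by (simp only: Ep.of_nat_power_commute mult.assoc)
      then have "d * Lam x = Lam x * d" by (rule Ep.p_power_cancel)
      then have "C * Lam x - Lam x * C = Lam x * ?q * r k - ?q * r k * Lam x"
        by (simp add: d_def algebra_simps)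
      also have "\<dots> = ?q * (Lam x * r k - r k * Lam x)"
        by (simp add: Ep.of_nat_power_commute right_diff_distrib mult.assoc)
      finally show ?thesis by simp
    qed
    then show ?thesis using Ep.eq_0_if_pmult[of "C * Lam x - Lam x * C"] by simp
  qed
  ultimately have "C \<in> L" by (simp add: L_def)
  then have "c \<in> L" unfolding C_def using Ep.bp_gt_0 by (rule L_divide)
  with c show ?thesis by blast
qed

lemma Rho_mult: "point x \<Longrightarrow> point y \<Longrightarrow> Rho x * Rho y = Rho (gmul x y)"
  by (rule endo_eqI) (simp add: app_Rho point_gmul rho_mult)

lemma Rho_zero: "Rho (\<lambda>_. 0) = 1"
  by (rule endo_eqI) (simp add: app_Rho rho_zero)

lemma Rho_inject: "point x \<Longrightarrow> point y \<Longrightarrow> Rho x = Rho y \<Longrightarrow> x = y"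
  using rho_inject[of x y] app_Rho by metis


section \<open>The Baker--Campbell--Hausdorff group of the derivations\<close>

text \<open>The definition asks for approximation within \<open>L\<close>, whereas convergence is
  known in the endomorphism ring. The partial sums are in \<open>L\<close> because a multiple of
  each is an integral combination of brackets, and the remainders follow by division.\<close>

lemma bch_value_eq:
  assumes a: "a \<in> L" and b: "b \<in> L" and c: "c \<in> L" and abc: "Ep.pexp a * Ep.pexp b = Ep.pexp c"
  shows "bch_value p (left_inv_der mm F) commutator (app (bpn * a)) (app (bpn * b)) = app (bpn * c)"
proof -
  let ?us = "bch_partial_sum commutator (app (bpn * a)) (app (bpn * b))"
  let ?S = "\<lambda>N. \<Sum>n\<le>N. Ep.fs_eval a b fs_bch n"
  obtain h where h: "Ep.psums (Ep.fs_eval a b fs_bch) (bpn * h)" "Ep.pexp h = Ep.pexp a * Ep.pexp b"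
    using Ep.pexp_bch by blast
  have "h = c" by (rule Ep.pexp_inj) (simp only: h(2) abc)
  have bL: "bpn * d \<in> L" if "d \<in> L" for d using that by (rule L_of_nat_mult)
  have S: "?S N \<in> L" for N
  proof -
    have "(\<Sum>(z, t)\<leftarrow>P. of_int z * lie_monomial_eval ad (bpn * a) (bpn * b) t) \<in> L" for P
      by (induction P) (auto intro!: L_zero L_add L_of_int_mult L_lie_monomial bL a b)
    moreover obtain D P where "D > 0" "of_nat D * ?S N = (\<Sum>(z, t)\<leftarrow>P. of_int z * lie_monomial_eval ad (bpn * a) (bpn * b) t)"
      using bch_partial_sum_eq(2)[of a b N] by blast
    ultimately have "of_nat D * ?S N \<in> L" by simp
    then show ?thesis using \<open>D > 0\<close> by (rule L_divide)
  qed
  have zm: "zmult (int p ^ k) (app m) = app (of_nat p ^ k * m)" for k and m :: "('a, 'n) mps_endo"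
    using zmult_app[of "int p ^ k" m] by simp
  have app_diff: "app u - app v = app (u - v)" for u v :: "('a, 'n) mps_endo" by (rule ext) simp
  let ?lim = "\<lambda>h. h \<in> app ` L \<and> (\<forall>k. \<exists>N0. \<forall>N\<ge>N0. \<exists>m\<in>app ` L. eq_in_tensor_Q (h - zmult (int p ^ k) m) (?us N))"
  have "?lim (app (bpn * c))"
  proof (intro conjI allI)
    show "app (bpn * c) \<in> app ` L" using bL[OF c] by blast
    fix k
    obtain N where N: "\<forall>n\<ge>N. Ep.pmult k (bpn * c - (\<Sum>i<n. Ep.fs_eval a b fs_bch i))"
      using h(1) unfolding \<open>h = c\<close> Ep.psums_def by blast
    have "\<exists>m\<in>app ` L. eq_in_tensor_Q (app (bpn * c) - zmult (int p ^ k) m) (?us n)" if n: "n \<ge> N" for n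
    proof -
      obtain m where m: "bpn * c - ?S n = of_nat p ^ k * m"
        using N[rule_format, of "Suc n"] n unfolding Ep.pmult_def lessThan_Suc_atMost by auto
      have "of_nat (p ^ k) * m = bpn * c + of_int (- 1) * ?S n" by (simp add: m[symmetric])
      then have "of_nat (p ^ k) * m \<in> L" using L_add[OF bL[OF c] L_of_int_mult[OF S]] by metis
      then have "m \<in> L" by (rule L_divide) (use p_ge_2 in simp)
      moreover have "app (bpn * c) - zmult (int p ^ k) (app m) = app (?S n)"
        unfolding zm app_diff using m by (simp add: algebra_simps)
      ultimately have "eq_in_tensor_Q (app (bpn * c) - zmult (int p ^ k) (app m)) (?us n)"
        using bch_partial_sum_eq(1)[where a = a and b = b and N = n] by simp
      then show ?thesis using \<open>m \<in> L\<close> by blast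
    qed
    then show "\<exists>N0. \<forall>N\<ge>N0. \<exists>m\<in>app ` L. eq_in_tensor_Q (app (bpn * c) - zmult (int p ^ k) m) (?us N)" by blast
  qed
  moreover have "x = app (bpn * c)" if "?lim x" for x
  proof -
    from that obtain y where y: "x = app y" by blast
    have "Ep.pmult k (y - bpn * c)" for k
    proof -
      obtain N1 where N1: "\<forall>N\<ge>N1. \<exists>m\<in>app ` L. eq_in_tensor_Q (x - zmult (int p ^ k) m) (?us N)"
        using \<open>?lim x\<close> by blast
      obtain N2 where N2: "\<forall>N\<ge>N2. \<exists>m\<in>app ` L. eq_in_tensor_Q (app (bpn * c) - zmult (int p ^ k) m) (?us N)"
        using \<open>?lim (app (bpn * c))\<close> by blast
      obtain m1 where m1: "eq_in_tensor_Q (app y - zmult (int p ^ k) (app m1)) (?us (max N1 N2))"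
        using N1 y by (metis imageE max.cobounded1)
      obtain m2 where m2: "eq_in_tensor_Q (app (bpn * c) - zmult (int p ^ k) (app m2)) (?us (max N1 N2))"
        using N2 by (metis imageE max.cobounded2)
      have "y - of_nat p ^ k * m1 = bpn * c - of_nat p ^ k * m2"
        using m1 m2 unfolding zm app_diff by (rule eq_in_tensor_Q_unique)
      then have "y - bpn * c = of_nat p ^ k * (m1 - m2)" by (simp add: algebra_simps)
      then show ?thesis by simp
    qed
    then have "y - bpn * c = 0" by (rule Ep.eq_0_if_pmult)
    then show ?thesis by (simp add: y)
  qed
  ultimately show ?thesis
    unfolding bch_value_def left_inv_der_eq by (rule the_equality)
qed

section \<open>The logarithm as an isomorphism\<close>

definition log_point :: "('n \<Rightarrow> 'a) \<Rightarrow> ('a, 'n) mps_endo" where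
  "log_point x = (SOME D. D \<in> L \<and> Ep.pexp D = Rho x)"

lemma log_point: "bold_point x \<Longrightarrow> log_point x \<in> L" "bold_point x \<Longrightarrow> Ep.pexp (log_point x) = Rho x"
  using someI_ex[of "\<lambda>D. D \<in> L \<and> Ep.pexp D = Rho x"] rho_in_exp[of x] unfolding log_point_def by blast+

abbreviation GpR :: "('n \<Rightarrow> 'a) monoid" where
  "GpR \<equiv> standard_group mm F (PIdl\<^bsub>typ_ring\<^esub> (of_nat (bold_p p)))"

abbreviation BCH :: "(('a, 'n) mps \<Rightarrow> ('a, 'n) mps) monoid" where
  "BCH \<equiv> bch_group p (left_inv_der mm F) commutator"

lemma carrier_GpR: "x \<in> carrier GpR \<longleftrightarrow> bold_point x"
proof -
  have "x \<in> carrier GpR \<longleftrightarrow> (\<forall>i. \<exists>t. x i = bpn * t)"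
    by (simp add: standard_group_def cgenideal_def mult.commute)
  also have "\<dots> \<longleftrightarrow> bold_point x"
    unfolding bold_point_def fun_eq_iff by metis
  finally show ?thesis .
qed

lemma GpR_simps: "\<one>\<^bsub>GpR\<^esub> = (\<lambda>_. 0)" "bold_point x \<Longrightarrow> bold_point y \<Longrightarrow> x \<otimes>\<^bsub>GpR\<^esub> y = gmul x y"
  using G_mult[of x y] bold_point_point by (simp_all add: standard_group_def)

lemma bold_point_zero: "bold_point (\<lambda>_. 0)"
  unfolding bold_point_def by (rule exI[of _ "\<lambda>_. 0"]) simp

lemma group_GpR: "group GpR"
proof (rule groupI)
  fix x assume "x \<in> carrier GpR"
  then have x: "bold_point x" by (simp add: carrier_GpR)
  then show "\<exists>y\<in>carrier GpR. y \<otimes>\<^bsub>GpR\<^esub> x = \<one>\<^bsub>GpR\<^esub>"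
    using bold_point_ginv[OF x] ginv(3)[OF bold_point_point[OF x]]
    by (intro bexI[of _ "ginv x"]) (simp_all add: carrier_GpR GpR_simps)
qed (simp_all add: carrier_GpR GpR_simps bold_point_zero bold_point_gmul gmul_assoc gmul_zero bold_point_point)

lemma carrier_BCH: "carrier BCH = (\<lambda>D. app (bpn * D)) ` L"
  by (simp add: bch_group_def bold_p_multiples_def left_inv_der_eq image_image zmult_app)

text \<open>Products of points correspond to products of exponentials, hence to the series by
  \<open>bch_value_eq\<close>; \<open>exp_in_rho\<close> and injectivity of \<open>pexp\<close> give
  surjectivity.\<close>

lemma log_point_iso: "(\<lambda>x. app (bpn * log_point x)) \<in> iso GpR BCH"
proof -
  let ?h = "\<lambda>x. app (bpn * log_point x)"
  have "?h (x \<otimes>\<^bsub>GpR\<^esub> y) = ?h x \<otimes>\<^bsub>BCH\<^esub> ?h y" if x: "bold_point x" and y: "bold_point y" for x y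
  proof -
    have "Ep.pexp (log_point x) * Ep.pexp (log_point y) = Ep.pexp (log_point (gmul x y))"
      using x y by (simp add: log_point bold_point_gmul Rho_mult bold_point_point)
    then show ?thesis
      using bch_value_eq[OF log_point(1)[OF x] log_point(1)[OF y] log_point(1)[OF bold_point_gmul[OF x y]]] x y
      by (simp add: GpR_simps bch_group_def)
  qed
  moreover have "inj_on ?h (carrier GpR)"
  proof (rule inj_onI)
    fix x y assume xy: "x \<in> carrier GpR" "y \<in> carrier GpR" "?h x = ?h y"
    then have "bpn * log_point x = bpn * log_point y" by (simp add: app_inject)
    then have "log_point x = log_point y" by (rule Ep.of_nat_mult_cancel[OF _ Ep.bp_gt_0])
    then have "Rho x = Rho y" using xy log_point(2) carrier_GpR by metis
    then show "x = y" using xy by (intro Rho_inject) (auto simp: carrier_GpR bold_point_point)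
  qed
  moreover have "?h ` carrier GpR = carrier BCH"
  proof -
    have "D \<in> log_point ` Collect bold_point" if D: "D \<in> L" for D
    proof -
      obtain z where z: "bold_point z" "Ep.pexp D = Rho z" using exp_in_rho[OF D] by blast
      have "D = log_point z" by (rule Ep.pexp_inj) (simp only: z log_point(2))
      then show ?thesis using z by blast
    qed
    then have "log_point ` Collect bold_point = L" using log_point(1) by auto
    moreover have "carrier GpR = Collect bold_point" using carrier_GpR by blast
    ultimately show ?thesis unfolding carrier_BCH by (metis image_image)
  qed
  ultimately show ?thesis
    unfolding iso_def hom_def bij_betw_def by (auto simp: carrier_GpR)
qed

text \<open>The group structure is carried over along the isomorphism; the image of the unit has to
  be recognised as the \<open>0\<close> fixed in \<open>bch_group\<close>, so the logarithm of the
  identity point is computed.\<close>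

lemma group_BCH: "group BCH"
proof -
  have "log_point (\<lambda>_. 0) = 0"
  proof (rule Ep.pexp_inj)
    have "Ep.psums (Ep.exp_term (0 :: ('a, 'n) mps_endo)) (\<Sum>n<1. Ep.exp_term 0 n)"
      by (rule Ep.psums_finite) (simp add: Ep.exp_term_def power_0_left)
    then have "Ep.psums (Ep.exp_term (0 :: ('a, 'n) mps_endo)) 1" by (simp add: Ep.exp_term_def)
    then have "Ep.pexp (0 :: ('a, 'n) mps_endo) = 1" using Ep.psums_exp_term Ep.psums_unique by blast
    then show "Ep.pexp (log_point (\<lambda>_. 0)) = Ep.pexp 0"
      by (simp add: log_point bold_point_zero Rho_zero)
  qed
  then have "app (bpn * log_point \<one>\<^bsub>GpR\<^esub>) = 0"
    by (simp add: GpR_simps fun_eq_iff)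
  moreover have "BCH\<lparr>one := 0\<rparr> = BCH"
    by (simp add: bch_group_def)
  ultimately show ?thesis
    using group.iso_imp_img_group[OF group_GpR log_point_iso] by simp
qed

section \<open>The two groups of automorphisms\<close>

definition rho_set :: "(('a, 'n) mps \<Rightarrow> ('a, 'n) mps) set" where
  "rho_set = rho ` Collect bold_point"

lemma right_trans_set: "{right_trans mm F x | x. x \<in> carrier GpR} = rho_set"
proof -
  have "right_trans mm F x = rho x" if "bold_point x" for x
    using right_trans_eq[OF bold_point_point[OF that]] by (rule ext)
  then show ?thesis unfolding rho_set_def carrier_GpR by force
qed

lemma exp_set: "{mps_End_exp p a | a. a \<in> bold_p_multiples p (left_inv_der mm F)} = rho_set"
proof -
  have "{mps_End_exp p a | a. a \<in> bold_p_multiples p (left_inv_der mm F)} = (\<lambda>D. app (Ep.pexp D)) ` L"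
  proof -
    have "bold_p_multiples p (left_inv_der mm F) = (\<lambda>D. app (bpn * D)) ` L"
      using carrier_BCH by (simp add: bch_group_def)
    then show ?thesis by (simp add: Setcompr_eq_image image_image mps_End_exp_eq)
  qed
  also have "\<dots> = rho_set"
  proof (intro equalityI subsetI)
    fix w assume "w \<in> (\<lambda>D. app (Ep.pexp D)) ` L"
    then show "w \<in> rho_set"
      using exp_in_rho app_Rho bold_point_point unfolding rho_set_def by fastforce
  next
    fix w assume "w \<in> rho_set"
    then obtain z where z: "bold_point z" "w = rho z" unfolding rho_set_def by blast
    then show "w \<in> (\<lambda>D. app (Ep.pexp D)) ` L"
      using log_point[OF z(1)] app_Rho[OF bold_point_point[OF z(1)]] by (metis image_eqI)
  qed
  finally show ?thesis .
qed

lemma monoid_Aut: "monoid (mps_Aut :: (('a, 'n) mps \<Rightarrow> ('a, 'n) mps) monoid)"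
proof -
  have "u \<circ> v \<in> mps_End" if "u \<in> mps_End" "v \<in> mps_End" for u v :: "('a, 'n) mps \<Rightarrow> ('a, 'n) mps"
    using that by (simp add: mps_End_iff)
  moreover have "id \<in> (mps_End :: (('a, 'n) mps \<Rightarrow> ('a, 'n) mps) set)"
    by (simp add: mps_End_iff)
  ultimately show ?thesis
    by unfold_locales (auto simp: mps_Aut_def intro: bij_comp)
qed

lemma rho_in_Aut:
  assumes x: "point x"
  shows "rho x \<in> carrier mps_Aut"
proof -
  have "rho x \<circ> rho (ginv x) = id" "rho (ginv x) \<circ> rho x = id"
    using x by (auto simp: fun_eq_iff rho_mult ginv rho_zero)
  then have "bij (rho x)" by (rule o_bij[rotated])
  moreover have "rho x 1 = 1"
    using alg_hom_rho[OF x] mps_const_hom(1) by (metis A.alg_hom_def)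
  ultimately show ?thesis
    using alg_hom_End[OF alg_hom_rho[OF x]] alg_hom_rho[OF x] by (simp add: mps_Aut_def A.alg_hom_def)
qed

lemma subgroup_rho_set: "subgroup rho_set mps_Aut"
proof
  show "rho_set \<subseteq> carrier mps_Aut"
    using rho_in_Aut bold_point_point by (auto simp: rho_set_def)
  show "u \<otimes>\<^bsub>mps_Aut\<^esub> v \<in> rho_set" if uv: "u \<in> rho_set" "v \<in> rho_set" for u v
  proof -
    obtain x y where xy: "u = rho x" "v = rho y" "bold_point x" "bold_point y"
      using uv unfolding rho_set_def by blast
    then have "u \<otimes>\<^bsub>mps_Aut\<^esub> v = rho (gmul x y)"
      by (auto simp: mps_Aut_def fun_eq_iff rho_mult bold_point_point)
    then show ?thesis using xy bold_point_gmul unfolding rho_set_def by blast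
  qed
  have "\<one>\<^bsub>mps_Aut\<^esub> = rho (\<lambda>_. 0)"
    by (simp add: mps_Aut_def fun_eq_iff rho_zero)
  then show "\<one>\<^bsub>mps_Aut\<^esub> \<in> rho_set" using bold_point_zero unfolding rho_set_def by blast
  show "inv\<^bsub>mps_Aut\<^esub> u \<in> rho_set" if u: "u \<in> rho_set" for u
  proof -
    obtain x where x: "u = rho x" "bold_point x" using u unfolding rho_set_def by blast
    have px: "point x" by (rule bold_point_point[OF x(2)])
    have "inv\<^bsub>mps_Aut\<^esub> u = rho (ginv x)"
      unfolding x(1)
    proof (rule monoid.inv_char[OF monoid_Aut rho_in_Aut rho_in_Aut])
      show "rho x \<otimes>\<^bsub>mps_Aut\<^esub> rho (ginv x) = \<one>\<^bsub>mps_Aut\<^esub>" "rho (ginv x) \<otimes>\<^bsub>mps_Aut\<^esub> rho x = \<one>\<^bsub>mps_Aut\<^esub>"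
        using px by (auto simp: mps_Aut_def fun_eq_iff rho_mult ginv rho_zero)
    qed (use px ginv(1) in auto)
    then show ?thesis using bold_point_ginv[OF x(2)] unfolding rho_set_def by blast
  qed
qed

end

theorem theorem4p5:
  fixes p :: nat
    and mm :: "'a::{idom, ring_char_0} set"
    and F :: "'n::finite \<Rightarrow> ('a, 'n + 'n) mps"
  assumes "Factorial_Ring.prime p"
    and "noetherian_local_pro_p_domain p mm"
    and "formal_group_law F"
  shows "let GpR = standard_group mm F (PIdl\<^bsub>ring_of_type_algebra\<^esub> (of_nat (bold_p p)));
             L = left_inv_der mm F;
             \<Gamma> = bch_group p L commutator
         in subgroup {right_trans mm F x | x. x \<in> carrier GpR} mps_Aut \<and>
            subgroup {mps_End_exp p a | a. a \<in> bold_p_multiples p L} mps_Aut \<and>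
            {right_trans mm F x | x. x \<in> carrier GpR} =
              {mps_End_exp p a | a. a \<in> bold_p_multiples p L} \<and>
            group GpR \<and> group \<Gamma> \<and> GpR \<cong> \<Gamma>"
proof -
  interpret standard_fgl p mm F
    by unfold_locales (fact assms)+
  show ?thesis
    unfolding Let_def right_trans_set exp_set
    using subgroup_rho_set group_GpR group_BCH log_point_iso by (blast intro: is_isoI)
qed

end
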